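(* The assignment sending a commutative unital $C^*$-algebra $\mathcal{A}$ to its spectrum $\sigma(\mathcal{A})$ and a positive unital map $f:\mathcal{B}\to\mathcal{A}$ of commutative unital $C^*$-algebras to the stochastic map $\sigma(f)=\sigma^f$ from $\sigma(\mathcal{A})$ to $\sigma(\mathcal{B})$, $\chi\mapsto\sigma^f_\chi$, defines a functor $\sigma:\mathbf{cC^*\text{-}AlgPos}^{\mathrm{op}}\to\mathbf{cHausStoch}$.
   Context: For a compact Hausdorff space $Y$, $\mathcal{M}_Y$ is its Borel $\sigma$-algebra and $\mathrm{ProbMeas}(Y)$ is the set of regular Borel probability measures on $Y$, with the vague topology: the coarsest topology making $\mu\mapsto\int_Y\varphi\,d\mu$ continuous for every continuous $\varphi:Y\to\mathbb{C}$. A (continuous) stochastic map from $X$ to $Y$ is a continuous function $\mu:X\to\mathrm{ProbMeas}(Y)$, $x\mapsto\mu_x$. $\mathbf{cHausStoch}$ has compact Hausdorff spaces as objects and stochastic maps as morphisms; the composite of $\mu$ from $X$ to $Y$ followed by $\nu$ from $Y$ to $Z$ is $(\nu\circ\mu)_x(E)=\int_Y\nu_y(E)\,d\mu_x(y)$ for $E\in\mathcal{M}_Z$, and the identity of $X$ is $x\mapsto\delta_x$ (Dirac measure). A positive (unital) map $f:\mathcal{B}\to\mathcal{A}$ of unital $C^*$-algebras is a bounded linear map with $f(1_{\mathcal{B}})=1_{\mathcal{A}}$ and $f(b^*b)\ge0$ for all $b$. $\mathbf{cC^*\text{-}AlgPos}$ has commutative unital $C^*$-algebras as objects and positive unital maps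 as morphisms. The spectrum $\sigma(\mathcal{A})$ is the compact Hausdorff space of characters (nonzero continuous multiplicative linear functionals $\mathcal{A}\to\mathbb{C}$) with the weak* topology. For $f:\mathcal{B}\to\mathcal{A}$ positive unital and $\chi\in\sigma(\mathcal{A})$, $\sigma^f_\chi$ is the unique regular Borel probability measure on $\sigma(\mathcal{B})$ such that $\int_{\sigma(\mathcal{B})}\mathrm{ev}_b\,d\sigma^f_\chi=\chi(f(b))$ for all $b\in\mathcal{B}$, where $\mathrm{ev}_b(\psi)=\psi(b)$; the map $\chi\mapsto\sigma^f_\chi$ is a stochastic map. *)

theory Defs
  imports "HOL-Probability.Probability" "HOL-Algebra.Module"
begin

section \<open>Categories and functors\<close>

text \<open>
  Arrows do not carry their domain and codomain; hom-sets are indexed by pairs of objects and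
  need not be disjoint. \<open>Comp \<C> a b c g f\<close> is the composite of \<open>f : a \<rightarrow> b\<close> followed by
  \<open>g : b \<rightarrow> c\<close>.
\<close>

record ('o, 'm) cat =
  Obj :: "'o set"
  Hom :: "'o \<Rightarrow> 'o \<Rightarrow> 'm set"
  Comp :: "'o \<Rightarrow> 'o \<Rightarrow> 'o \<Rightarrow> 'm \<Rightarrow> 'm \<Rightarrow> 'm"
  Ident :: "'o \<Rightarrow> 'm"

locale category =
  fixes \<C> :: "('o, 'm) cat"
  assumes Ident_in_Hom: "a \<in> Obj \<C> \<Longrightarrow> Ident \<C> a \<in> Hom \<C> a a"
    and Comp_in_Hom:
      "\<lbrakk>a \<in> Obj \<C>; b \<in> Obj \<C>; c \<in> Obj \<C>; f \<in> Hom \<C> a b; g \<in> Hom \<C> b c\<rbrakk>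
        \<Longrightarrow> Comp \<C> a b c g f \<in> Hom \<C> a c"
    and Ident_left:
      "\<lbrakk>a \<in> Obj \<C>; b \<in> Obj \<C>; f \<in> Hom \<C> a b\<rbrakk> \<Longrightarrow> Comp \<C> a b b (Ident \<C> b) f = f"
    and Ident_right:
      "\<lbrakk>a \<in> Obj \<C>; b \<in> Obj \<C>; f \<in> Hom \<C> a b\<rbrakk> \<Longrightarrow> Comp \<C> a a b f (Ident \<C> a) = f"
    and Comp_assoc:
      "\<lbrakk>a \<in> Obj \<C>; b \<in> Obj \<C>; c \<in> Obj \<C>; d \<in> Obj \<C>;
        f \<in> Hom \<C> a b; g \<in> Hom \<C> b c; h \<in> Hom \<C> c d\<rbrakk>
        \<Longrightarrow> Comp \<C> a b d (Comp \<C> b c d h g) f = Comp \<C> a c d h (Comp \<C> a b c g f)"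

definition op_cat :: "('o, 'm) cat \<Rightarrow> ('o, 'm) cat" where
  "op_cat \<C> =
    \<lparr>Obj = Obj \<C>,
     Hom = (\<lambda>a b. Hom \<C> b a),
     Comp = (\<lambda>a b c g f. Comp \<C> c b a f g),
     Ident = Ident \<C>\<rparr>"

locale category_functor = C: category \<C> + D: category \<D>
  for \<C> :: "('o, 'm) cat" and \<D> :: "('p, 'n) cat" +
  fixes Fo :: "'o \<Rightarrow> 'p" and Fm :: "'o \<Rightarrow> 'o \<Rightarrow> 'm \<Rightarrow> 'n"
  assumes Fo_in_Obj: "a \<in> Obj \<C> \<Longrightarrow> Fo a \<in> Obj \<D>"
    and Fm_in_Hom:
      "\<lbrakk>a \<in> Obj \<C>; b \<in> Obj \<C>; f \<in> Hom \<C> a b\<rbrakk> \<Longrightarrow> Fm a b f \<in> Hom \<D> (Fo a) (Fo b)"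
    and Fm_Ident: "a \<in> Obj \<C> \<Longrightarrow> Fm a a (Ident \<C> a) = Ident \<D> (Fo a)"
    and Fm_Comp:
      "\<lbrakk>a \<in> Obj \<C>; b \<in> Obj \<C>; c \<in> Obj \<C>; f \<in> Hom \<C> a b; g \<in> Hom \<C> b c\<rbrakk>
        \<Longrightarrow> Fm a c (Comp \<C> a b c g f) = Comp \<D> (Fo a) (Fo b) (Fo c) (Fm b c g) (Fm a b f)"


section \<open>Compact Hausdorff spaces and stochastic maps\<close>

definition borel_of :: "'x topology \<Rightarrow> 'x measure" where
  "borel_of X = sigma (topspace X) {U. openin X U}"

text \<open>Regularity is required on all Borel sets, inner by compact sets and outer by open sets.\<close>

definition prob_meas :: "'x topology \<Rightarrow> 'x measure set" where
  "prob_meas X =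
    {M. prob_space M \<and> space M = topspace X \<and> sets M = sets (borel_of X) \<and>
        (\<forall>E\<in>sets M.
          emeasure M E = (SUP K\<in>{K. compactin X K \<and> K \<subseteq> E}. emeasure M K) \<and>
          emeasure M E = (INF U\<in>{U. openin X U \<and> E \<subseteq> U}. emeasure M U))}"

definition vague_topology :: "'x topology \<Rightarrow> 'x measure topology" where
  "vague_topology X =
    topology_generated_by
      {{M \<in> prob_meas X. (LINT x|M. \<phi> x) \<in> V} | (\<phi> :: 'x \<Rightarrow> complex) V.
        continuous_map X euclidean \<phi> \<and> open V}"

text \<open>
  Maps are required to be \<^const>\<open>undefined\<close> outside their domain (\<^const>\<open>extensional\<close>), so that
  equality of arrows is equality on the domain.
\<close>

definition stoch_maps :: "'x topology \<Rightarrow> 'x topology \<Rightarrow> ('x \<Rightarrow> 'x measure) set" where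
  "stoch_maps X Y =
    {\<mu>. \<mu> \<in> extensional (topspace X) \<and> continuous_map X (vague_topology Y) \<mu>}"

definition stoch_comp ::
  "'x topology \<Rightarrow> 'x topology \<Rightarrow> 'x topology \<Rightarrow>
    ('x \<Rightarrow> 'x measure) \<Rightarrow> ('x \<Rightarrow> 'x measure) \<Rightarrow> 'x \<Rightarrow> 'x measure" where
  "stoch_comp X Y Z \<nu> \<mu> =
    (\<lambda>x\<in>topspace X. measure_of (topspace Z) (sets (borel_of Z))
      (\<lambda>E. \<integral>\<^sup>+ y. emeasure (\<nu> y) E \<partial>\<mu> x))"

definition cHausStoch :: "('x topology, 'x \<Rightarrow> 'x measure) cat" where
  "cHausStoch =
    \<lparr>Obj = {X. compact_space X \<and> Hausdorff_space X},
     Hom = stoch_maps,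
     Comp = stoch_comp,
     Ident = (\<lambda>X. \<lambda>x\<in>topspace X. return (borel_of X) x)\<rparr>"


section \<open>Commutative unital C*-algebras and positive unital maps\<close>

definition complex_ring :: "complex ring" where
  "complex_ring = \<lparr>carrier = UNIV, mult = (*), one = 1, zero = 0, add = (+)\<rparr>"

record 'a cstar = "(complex, 'a) module" +
  star :: "'a \<Rightarrow> 'a"
  anorm :: "'a \<Rightarrow> real"

text \<open>
  The value outside the carrier is chosen so that \<open>alg_dist A\<close> satisfies the axioms of
  \<^locale>\<open>Metric_space\<close>, which requires nonnegativity and symmetry on the whole type.
\<close>

definition alg_dist :: "'a cstar \<Rightarrow> 'a \<Rightarrow> 'a \<Rightarrow> real" where
  "alg_dist A x y =
    (if x \<in> carrier A \<and> y \<in> carrier A then anorm A (x \<ominus>\<^bsub>A\<^esub> y) else 0)"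

text \<open>
  \<open>Module.algebra\<close> (as opposed to the set algebras of \<open>HOL-Analysis\<close>) provides a commutative
  unital associative algebra over the field of complex numbers. The zero algebra,
  whose spectrum is empty, is not excluded.
\<close>

locale comm_cstar_algebra = Module.algebra complex_ring A for A :: "'a cstar" +
  assumes star_closed: "x \<in> carrier A \<Longrightarrow> star A x \<in> carrier A"
    and star_star: "x \<in> carrier A \<Longrightarrow> star A (star A x) = x"
    and star_add:
      "\<lbrakk>x \<in> carrier A; y \<in> carrier A\<rbrakk> \<Longrightarrow> star A (x \<oplus>\<^bsub>A\<^esub> y) = star A x \<oplus>\<^bsub>A\<^esub> star A y"
    and star_smult: "x \<in> carrier A \<Longrightarrow> star A (c \<odot>\<^bsub>A\<^esub> x) = cnj c \<odot>\<^bsub>A\<^esub> star A x"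
    and star_mult:
      "\<lbrakk>x \<in> carrier A; y \<in> carrier A\<rbrakk> \<Longrightarrow> star A (x \<otimes>\<^bsub>A\<^esub> y) = star A y \<otimes>\<^bsub>A\<^esub> star A x"
    and anorm_nonneg: "x \<in> carrier A \<Longrightarrow> 0 \<le> anorm A x"
    and anorm_eq_0: "x \<in> carrier A \<Longrightarrow> anorm A x = 0 \<longleftrightarrow> x = \<zero>\<^bsub>A\<^esub>"
    and anorm_triangle:
      "\<lbrakk>x \<in> carrier A; y \<in> carrier A\<rbrakk> \<Longrightarrow> anorm A (x \<oplus>\<^bsub>A\<^esub> y) \<le> anorm A x + anorm A y"
    and anorm_smult: "x \<in> carrier A \<Longrightarrow> anorm A (c \<odot>\<^bsub>A\<^esub> x) = cmod c * anorm A x"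
    and anorm_mult:
      "\<lbrakk>x \<in> carrier A; y \<in> carrier A\<rbrakk> \<Longrightarrow> anorm A (x \<otimes>\<^bsub>A\<^esub> y) \<le> anorm A x * anorm A y"
    and cstar_identity: "x \<in> carrier A \<Longrightarrow> anorm A (star A x \<otimes>\<^bsub>A\<^esub> x) = (anorm A x)\<^sup>2"
    and complete: "Metric_space.mcomplete (carrier A) (alg_dist A)"

text \<open>An element is \<open>\<ge> 0\<close> iff it is of the form \<open>a\<^sup>* a\<close>.\<close>

definition positive_elements :: "'a cstar \<Rightarrow> 'a set" where
  "positive_elements A = {star A a \<otimes>\<^bsub>A\<^esub> a | a. a \<in> carrier A}"

definition pos_unital_maps :: "'a cstar \<Rightarrow> 'a cstar \<Rightarrow> ('a \<Rightarrow> 'a) set" where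
  "pos_unital_maps B A =
    {f \<in> carrier B \<rightarrow>\<^sub>E carrier A.
       (\<forall>x\<in>carrier B. \<forall>y\<in>carrier B. f (x \<oplus>\<^bsub>B\<^esub> y) = f x \<oplus>\<^bsub>A\<^esub> f y) \<and>
       (\<forall>c. \<forall>x\<in>carrier B. f (c \<odot>\<^bsub>B\<^esub> x) = c \<odot>\<^bsub>A\<^esub> f x) \<and>
       (\<exists>K. \<forall>x\<in>carrier B. anorm A (f x) \<le> K * anorm B x) \<and>
       f \<one>\<^bsub>B\<^esub> = \<one>\<^bsub>A\<^esub> \<and>
       (\<forall>b\<in>carrier B. f (star B b \<otimes>\<^bsub>B\<^esub> b) \<in> positive_elements A)}"

text \<open>
  The objects are all commutative unital C*-algebras with carrier contained in the type \<open>'a\<close>, which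
  is arbitrary; likewise for \<open>cHausStoch\<close>, instantiated below at \<open>'a \<Rightarrow> complex\<close>, the type of
  functionals.
\<close>

definition cCstarAlgPos :: "('a cstar, 'a \<Rightarrow> 'a) cat" where
  "cCstarAlgPos =
    \<lparr>Obj = {A. comm_cstar_algebra A},
     Hom = pos_unital_maps,
     Comp = (\<lambda>A B C g f. compose (carrier A) g f),
     Ident = (\<lambda>A. \<lambda>x\<in>carrier A. x)\<rparr>"


section \<open>The spectrum\<close>

definition characters :: "'a cstar \<Rightarrow> ('a \<Rightarrow> complex) set" where
  "characters A =
    {\<omega> \<in> extensional (carrier A).
       (\<forall>x\<in>carrier A. \<forall>y\<in>carrier A. \<omega> (x \<oplus>\<^bsub>A\<^esub> y) = \<omega> x + \<omega> y) \<and>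
       (\<forall>c. \<forall>x\<in>carrier A. \<omega> (c \<odot>\<^bsub>A\<^esub> x) = c * \<omega> x) \<and>
       (\<forall>x\<in>carrier A. \<forall>y\<in>carrier A. \<omega> (x \<otimes>\<^bsub>A\<^esub> y) = \<omega> x * \<omega> y) \<and>
       continuous_map (Metric_space.mtopology (carrier A) (alg_dist A)) euclidean \<omega> \<and>
       (\<exists>x\<in>carrier A. \<omega> x \<noteq> 0)}"

text \<open>The weak* topology is the topology of pointwise convergence on the algebra.\<close>

definition spectrum :: "'a cstar \<Rightarrow> ('a \<Rightarrow> complex) topology" where
  "spectrum A = subtopology (product_topology (\<lambda>_. euclidean) (carrier A)) (characters A)"

text \<open>
  For a positive unital map \<open>f\<close> from \<open>B\<close> to \<open>A\<close>, \<open>spectrum_map A B f\<close> is the stochastic map from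
  \<open>spectrum A\<close> to \<open>spectrum B\<close>; the arguments \<open>A\<close>, \<open>B\<close> are in the order of the source and target
  of \<open>f\<close> in the opposite category.
\<close>

definition spectrum_map ::
  "'a cstar \<Rightarrow> 'a cstar \<Rightarrow> ('a \<Rightarrow> 'a) \<Rightarrow> ('a \<Rightarrow> complex) \<Rightarrow> ('a \<Rightarrow> complex) measure" where
  "spectrum_map A B f =
    (\<lambda>\<omega>\<in>characters A. THE M. M \<in> prob_meas (spectrum B) \<and>
      (\<forall>b\<in>carrier B. (LINT \<psi>|M. \<psi> b) = \<omega> (f b)))"

end

theory Submission
  imports Defs
begin

text \<open>
  The composite of stochastic maps is the bind of the Giry monad, which makes associativity and the unit
  laws available; what has to be shown is that \<open>y \<mapsto> \<nu> y U\<close> is lower semicontinuous for open \<open>U\<close>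
  and that a mixture of regular measures is regular.

  For a positive unital \<open>f\<close> from \<open>B\<close> to \<open>A\<close> and a character \<open>\<omega>\<close> of \<open>A\<close>, the functional \<open>\<omega> \<circ> f\<close> is
  a state of \<open>B\<close>, and the measure is obtained from it by the Riesz theorem on the spectrum of \<open>B\<close>. For this
  the state must be monotone with respect to the pointwise order of the functions \<open>\<psi> \<mapsto> \<psi> b\<close>. Instead of
  Gelfand--Mazur and maximal ideals, a Positivstellensatz is used: \<open>1 - h\<close> is a square for self-adjoint \<open>h\<close> of
  norm below 1, so the sums of elements \<open>a\<^sup>* a\<close> form an archimedean preordering, maximal proper preorderings
  yield characters, and a self-adjoint element that is strictly positive at every character is a sum of squares.
  By Stone--Weierstrass the state then extends to all continuous functions and the measure is unique;
  functoriality follows from uniqueness.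
\<close>

section \<open>Borel measures on compact Hausdorff spaces\<close>

text \<open>On a compact Hausdorff space the Borel sets need not be generated by the continuous
  functions, and a Borel probability measure need not be regular. So neither the measurability of a
  kernel nor the regularity of a mixture follows from integrals of continuous functions by a
  monotone class argument. Both go through open sets, whose mass under a regular measure is a
  supremum of such integrals. \<open>open_regular\<close> records just what these suprema need, and
  the Riesz theorem upgrades it to regularity on all Borel sets.

  On the algebraic side, positivity of a state is given only on elements
  \<open>star A a \<otimes> a\<close>, while the Riesz theorem asks for monotonicity in the
  pointwise order on characters. The Positivstellensatz bridges the two. It works with sums of such
  elements because closure of the single terms under addition is not visible from the C*-axioms, and
  with strict positivity, which a small scalar always provides at a cost that tends to 0.

  The zero algebra fits in: it has no characters, so there is no point at which a measure on an
  empty spectrum would be asked for.\<close>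

lemma space_borel_of [simp]: "space (borel_of X) = topspace X"
  unfolding borel_of_def by (rule space_measure_of) (auto dest: openin_subset)

lemma sets_borel_of: "sets (borel_of X) = sigma_sets (topspace X) {U. openin X U}"
  unfolding borel_of_def by (rule sets_measure_of) (auto dest: openin_subset)

lemma openin_sets_borel_of: "openin X U \<Longrightarrow> U \<in> sets (borel_of X)"
  by (auto simp: sets_borel_of)

lemma closedin_sets_borel_of: "closedin X K \<Longrightarrow> K \<in> sets (borel_of X)"
proof -
  assume K: "closedin X K"
  then have "topspace X - (topspace X - K) \<in> sets (borel_of X)"
    by (metis closedin_def openin_sets_borel_of sets.compl_sets space_borel_of)
  with K show ?thesis by (metis closedin_subset double_diff subset_refl)
qed

lemma continuous_map_borel_measurable:
  fixes f :: "'x \<Rightarrow> 'b::topological_space"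
  assumes "continuous_map X euclidean f"
  shows "f \<in> borel_measurable (borel_of X)"
proof (rule borel_measurableI)
  fix S :: "'b set" assume "open S"
  with assms have "openin X {x \<in> topspace X. f x \<in> S}"
    by (auto simp: continuous_map_def)
  moreover have "f -` S \<inter> space (borel_of X) = {x \<in> topspace X. f x \<in> S}" by auto
  ultimately show "f -` S \<inter> space (borel_of X) \<in> sets (borel_of X)"
    by (simp add: openin_sets_borel_of)
qed

lemma borel_measurable_continuous_map:
  fixes f :: "'x \<Rightarrow> 'b::topological_space"
  assumes "sets M = sets (borel_of X)" "continuous_map X euclidean f"
  shows "f \<in> borel_measurable M"
  using continuous_map_borel_measurable[OF assms(2)] measurable_cong_sets[OF assms(1) refl] by blast

lemma compact_space_continuous_bounded:
  fixes f :: "'x \<Rightarrow> 'b::real_normed_vector"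
  assumes "compact_space X" "continuous_map X euclidean f"
  obtains B where "0 \<le> B" "\<And>x. x \<in> topspace X \<Longrightarrow> norm (f x) \<le> B"
proof -
  have "compactin euclidean (f ` topspace X)"
    using assms compact_space_def image_compactin by blast
  then have "bounded (f ` topspace X)" by (simp add: compact_imp_bounded)
  then obtain B where "\<forall>y\<in>f ` topspace X. norm y \<le> B" by (auto simp: bounded_iff)
  then show ?thesis by (intro that[of "max 0 B"]) auto
qed

lemma integrable_continuous_map:
  fixes f :: "'x \<Rightarrow> 'b::{banach, second_countable_topology}"
  assumes "compact_space X" "prob_space M" "sets M = sets (borel_of X)" "continuous_map X euclidean f"
  shows "integrable M f"
proof -
  interpret prob_space M by fact
  have sp: "space M = topspace X" using sets_eq_imp_space_eq[OF assms(3)] by simp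
  obtain B where "\<And>x. x \<in> topspace X \<Longrightarrow> norm (f x) \<le> B"
    using compact_space_continuous_bounded[OF assms(1,4)] by blast
  then show ?thesis
    by (intro integrable_const_bound[of _ B] borel_measurable_continuous_map[OF assms(3,4)] AE_I2)
       (simp add: sp)
qed

text \<open>Inner regularity on open sets, which on a compact space already forces full regularity.\<close>

definition open_regular :: "'x topology \<Rightarrow> 'x measure \<Rightarrow> bool" where
  "open_regular X M \<longleftrightarrow> prob_space M \<and> sets M = sets (borel_of X) \<and>
    (\<forall>U e. openin X U \<longrightarrow> 0 < e \<longrightarrow>
      (\<exists>K. closedin X K \<and> K \<subseteq> U \<and> measure M U < measure M K + e))"

section \<open>Urysohn functions and open-regular measures\<close>

locale compact_hausdorff =
  fixes X :: "'x topology"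
  assumes compact_X: "compact_space X" and Hausdorff_X: "Hausdorff_space X"
begin

lemma normal_X: "normal_space X"
  using compact_Hausdorff_or_regular_imp_normal_space compact_X Hausdorff_X by blast

lemma Urysohn_function:
  assumes "closedin X S" "closedin X T" "S \<inter> T = {}"
  obtains f :: "'x \<Rightarrow> real" where "continuous_map X euclideanreal f"
    "\<And>x. x \<in> topspace X \<Longrightarrow> 0 \<le> f x" "\<And>x. x \<in> topspace X \<Longrightarrow> f x \<le> 1"
    "\<And>x. x \<in> S \<Longrightarrow> f x = 0" "\<And>x. x \<in> T \<Longrightarrow> f x = 1"
proof -
  obtain f :: "'x \<Rightarrow> real" where f: "continuous_map X (top_of_set {0..1}) f" "f ` S \<subseteq> {0}" "f ` T \<subseteq> {1}"
    using Urysohn_lemma[OF normal_X assms(1,2), of 0 1] assms(3) by (auto simp: disjnt_def)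
  from f(1) have "continuous_map X euclideanreal f" "f ` topspace X \<subseteq> {0..1}"
    by (auto simp: continuous_map_in_subtopology)
  with f that show ?thesis by (auto simp: image_subset_iff)
qed

text \<open>A weakening of the usual test functions of the Riesz theorem: f only vanishes off U, and
  its support may leave U. \<open>trim\<close> recovers a closed carrier inside U at an arbitrarily
  small cost.\<close>

definition subordinate :: "'x set \<Rightarrow> ('x \<Rightarrow> real) set" where
  "subordinate U = {f. continuous_map X euclideanreal f \<and>
    (\<forall>x\<in>topspace X. 0 \<le> f x \<and> f x \<le> 1) \<and> (\<forall>x\<in>topspace X - U. f x = 0)}"

lemma subordinate_zero: "(\<lambda>_. 0) \<in> subordinate U"
  by (simp add: subordinate_def)

lemma Urysohn_subordinate:
  assumes "closedin X K" "openin X U" "K \<subseteq> U"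
  obtains f where "f \<in> subordinate U" "\<And>x. x \<in> K \<Longrightarrow> f x = 1"
proof -
  obtain f :: "'x \<Rightarrow> real" where "continuous_map X euclideanreal f"
    "\<And>x. x \<in> topspace X \<Longrightarrow> 0 \<le> f x" "\<And>x. x \<in> topspace X \<Longrightarrow> f x \<le> 1"
    "\<And>x. x \<in> topspace X - U \<Longrightarrow> f x = 0" "\<And>x. x \<in> K \<Longrightarrow> f x = 1"
  proof (rule Urysohn_function[of "topspace X - U" K])
    show "closedin X (topspace X - U)" using assms(2) by blast
    show "(topspace X - U) \<inter> K = {}" using assms(3) by blast
  qed (use assms(1) in auto)
  then show ?thesis by (intro that[of f]) (auto simp: subordinate_def)
qed

lemma subordinate_integral_le:
  assumes "prob_space M" "sets M = sets (borel_of X)" "openin X U" "f \<in> subordinate U"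
  shows "(LINT x|M. f x) \<le> measure M U"
proof -
  interpret prob_space M by fact
  have sp: "space M = topspace X" using sets_eq_imp_space_eq[OF assms(2)] by simp
  have U: "U \<in> sets M" using assms by (simp add: openin_sets_borel_of)
  have "(LINT x|M. f x) \<le> (LINT x|M. indicator U x)"
  proof (rule integral_mono)
    show "integrable M f"
      using assms integrable_continuous_map[OF compact_X] by (auto simp: subordinate_def)
    show "integrable M (indicator U :: 'x \<Rightarrow> real)"
      using U by (intro integrable_real_indicator) (auto simp: emeasure_eq_measure)
    show "f x \<le> indicator U x" if "x \<in> space M" for x
      using that assms(4) by (auto simp: sp subordinate_def indicator_def)
  qed
  then show ?thesis using U by simp
qed

lemma measure_le_integral:
  assumes "prob_space M" "sets M = sets (borel_of X)" "closedin X K"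
    "continuous_map X euclideanreal f" "\<And>x. x \<in> topspace X \<Longrightarrow> 0 \<le> f x" "\<And>x. x \<in> K \<Longrightarrow> 1 \<le> f x"
  shows "measure M K \<le> (LINT x|M. f x)"
proof -
  interpret prob_space M by fact
  have sp: "space M = topspace X" using sets_eq_imp_space_eq[OF assms(2)] by simp
  have K: "K \<in> sets M" using assms by (simp add: closedin_sets_borel_of)
  have "(LINT x|M. indicator K x) \<le> (LINT x|M. f x)"
  proof (rule integral_mono)
    show "integrable M f" using integrable_continuous_map[OF compact_X assms(1,2,4)] .
    show "integrable M (indicator K :: 'x \<Rightarrow> real)"
      using K by (intro integrable_real_indicator) (auto simp: emeasure_eq_measure)
    show "indicator K x \<le> f x" if "x \<in> space M" for x
      using that assms(5,6) by (auto simp: sp indicator_def)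
  qed
  then show ?thesis using K by simp
qed

lemma open_regular_subordinate:
  assumes "open_regular X M" "openin X U" "0 < e"
  obtains f where "f \<in> subordinate U" "measure M U < (LINT x|M. f x) + e"
proof -
  obtain K where K: "closedin X K" "K \<subseteq> U" "measure M U < measure M K + e"
    using assms unfolding open_regular_def by blast
  obtain f where f: "f \<in> subordinate U" "\<And>x. x \<in> K \<Longrightarrow> f x = 1"
    using Urysohn_subordinate[OF K(1) assms(2) K(2)] by blast
  have "measure M K \<le> (LINT x|M. f x)"
    using f assms K by (intro measure_le_integral) (auto simp: open_regular_def subordinate_def)
  with K f show ?thesis by (intro that[of f]) auto
qed

text \<open>Under an open-regular measure the mass of an open set is the supremum of the integrals
  of its subordinate functions, so integrals determine it. The open sets form an intersection-stable
  generator of the Borel sets.\<close>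

lemma open_regular_eqI:
  assumes M: "open_regular X M" and N: "open_regular X N"
    and eq: "\<And>f. continuous_map X euclideanreal f \<Longrightarrow> (LINT x|M. f x) = (LINT x|N. f x)"
  shows "M = N"
proof -
  have le: "measure M' U \<le> measure N' U"
    if M': "open_regular X M'" and N': "open_regular X N'" and U: "openin X U"
      and eq': "\<And>f. continuous_map X euclideanreal f \<Longrightarrow> (LINT x|M'. f x) = (LINT x|N'. f x)" for M' N' U
  proof (rule field_le_epsilon)
    fix e :: real assume "0 < e"
    then obtain f where f: "f \<in> subordinate U" "measure M' U < (LINT x|M'. f x) + e"
      using open_regular_subordinate[OF M' U] by blast
    have "(LINT x|N'. f x) \<le> measure N' U"
      using N' f U by (intro subordinate_integral_le) (auto simp: open_regular_def)
    moreover have "(LINT x|M'. f x) = (LINT x|N'. f x)" using f eq' by (auto simp: subordinate_def)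
    ultimately show "measure M' U \<le> measure N' U + e" using f by simp
  qed
  interpret M: prob_space M using M by (simp add: open_regular_def)
  interpret N: prob_space N using N by (simp add: open_regular_def)
  show ?thesis
  proof (rule measure_eqI_generator_eq[of "{U. openin X U}" "topspace X" M N "\<lambda>_. topspace X"])
    show "Int_stable {U. openin X U}" by (auto simp: Int_stable_def)
    show "{U. openin X U} \<subseteq> Pow (topspace X)" by (auto dest: openin_subset)
    show "emeasure M U = emeasure N U" if "U \<in> {U. openin X U}" for U
      using that le[OF M N _ eq] le[OF N M _ eq[symmetric]]
      by (auto simp: M.emeasure_eq_measure N.emeasure_eq_measure intro!: antisym)
    show "sets M = sigma_sets (topspace X) {U. openin X U}" "sets N = sigma_sets (topspace X) {U. openin X U}"
      using M N by (auto simp: open_regular_def sets_borel_of)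
  qed auto
qed

lemma prob_meas_open_regular:
  assumes "M \<in> prob_meas X"
  shows "open_regular X M"
proof -
  interpret prob_space M using assms by (simp add: prob_meas_def)
  have "\<exists>K. closedin X K \<and> K \<subseteq> U \<and> measure M U < measure M K + e" if U: "openin X U" and e: "0 < e" for U e
  proof -
    have "U \<in> sets M" using assms U by (simp add: prob_meas_def openin_sets_borel_of)
    then have eq: "emeasure M U = (SUP K\<in>{K. compactin X K \<and> K \<subseteq> U}. emeasure M K)"
      using assms by (simp add: prob_meas_def)
    show ?thesis
    \<comment> \<open>If U has mass below e, the empty set serves as K. Otherwise
      \<open>measure M U - e\<close> is nonnegative and its coercion to \<open>ennreal\<close> loses
      nothing.\<close>
    proof (cases "measure M U < e")
      case True then show ?thesis by (intro exI[of _ "{}"]) auto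
    next
      case False
      have "ennreal (measure M U - e) < emeasure M U"
        using e False by (auto simp: emeasure_eq_measure ennreal_less_iff)
      then obtain K where K: "compactin X K" "K \<subseteq> U" "ennreal (measure M U - e) < emeasure M K"
        by (auto simp: eq less_SUP_iff)
      then have "measure M U - e < measure M K"
        using False by (auto simp: emeasure_eq_measure ennreal_less_iff)
      with K show ?thesis by (intro exI[of _ K]) (auto intro: compactin_imp_closedin[OF Hausdorff_X])
    qed
  qed
  with assms show ?thesis by (simp add: open_regular_def prob_meas_def prob_space_axioms)
qed

text \<open>Inner regularity comes by complementation: an open set around the complement of E with
  small excess has a compact complement inside E, since X is compact and M is finite.\<close>

lemma outer_regular_prob_meas:
  assumes "prob_space M" and sets: "sets M = sets (borel_of X)"
    and outer: "\<And>E. E \<in> sets M \<Longrightarrow> emeasure M E = (INF U\<in>{U. openin X U \<and> E \<subseteq> U}. emeasure M U)"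
  shows "M \<in> prob_meas X"
proof -
  interpret prob_space M by fact
  have sp: "space M = topspace X" using sets_eq_imp_space_eq[OF sets] by simp
  have "emeasure M E = (SUP K\<in>{K. compactin X K \<and> K \<subseteq> E}. emeasure M K)" if E: "E \<in> sets M" for E
  proof (rule antisym)
    show "(SUP K\<in>{K. compactin X K \<and> K \<subseteq> E}. emeasure M K) \<le> emeasure M E"
      using E by (auto intro!: SUP_least emeasure_mono)
    show "emeasure M E \<le> (SUP K\<in>{K. compactin X K \<and> K \<subseteq> E}. emeasure M K)"
    proof (rule ennreal_le_epsilon)
      fix e :: real assume e: "0 < e"
      have C: "topspace X - E \<in> sets M" using E by (metis sets.compl_sets sp)
      have "emeasure M (topspace X - E) < emeasure M (topspace X - E) + ennreal e"
        using e by (simp add: emeasure_eq_measure ennreal_less_iff flip: ennreal_plus)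
      then obtain U where U: "openin X U" "topspace X - E \<subseteq> U"
        "emeasure M U < emeasure M (topspace X - E) + ennreal e"
        by (subst (asm) (1) outer[OF C]) (auto simp: INF_less_iff)
      have UM: "U \<in> sets M" using U sets by (simp add: openin_sets_borel_of)
      let ?K = "topspace X - U"
      have K: "compactin X ?K" "?K \<subseteq> E"
        using U compact_X by (auto intro!: closedin_compact_space)
      have "measure M U < measure M (topspace X - E) + e"
        using U e by (simp add: emeasure_eq_measure ennreal_less_iff flip: ennreal_plus)
      moreover have "measure M ?K = 1 - measure M U" using prob_compl[OF UM] by (simp add: sp)
      moreover have "measure M (topspace X - E) = 1 - measure M E" using prob_compl[OF E] by (simp add: sp)
      ultimately have "measure M E \<le> measure M ?K + e" by simp
      then have "emeasure M E \<le> emeasure M ?K + ennreal e"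
        using e by (simp add: emeasure_eq_measure flip: ennreal_plus)
      also have "\<dots> \<le> (SUP K\<in>{K. compactin X K \<and> K \<subseteq> E}. emeasure M K) + ennreal e"
        using K by (intro add_right_mono SUP_upper) auto
      finally show "emeasure M E \<le> (SUP K\<in>{K. compactin X K \<and> K \<subseteq> E}. emeasure M K) + ennreal e" .
    qed
  qed
  with outer show ?thesis by (simp add: prob_meas_def assms(1) sets sp)
qed

end

section \<open>The Riesz representation theorem\<close>

text \<open>\<open>L\<close> is total on real functions, but the axioms bind it on continuous ones
  only. \<open>L_mono\<close> compares values on \<open>topspace X\<close> alone, so values off the
  space cannot influence \<open>L\<close>.\<close>

locale normalized_positive_functional = compact_hausdorff X for X :: "'x topology" +
  fixes L :: "('x \<Rightarrow> real) \<Rightarrow> real"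
  assumes L_add: "\<lbrakk>continuous_map X euclideanreal f; continuous_map X euclideanreal g\<rbrakk>
      \<Longrightarrow> L (\<lambda>x. f x + g x) = L f + L g"
    and L_cmult: "continuous_map X euclideanreal f \<Longrightarrow> L (\<lambda>x. c * f x) = c * L f"
    and L_mono: "\<lbrakk>continuous_map X euclideanreal f; continuous_map X euclideanreal g;
      \<And>x. x \<in> topspace X \<Longrightarrow> f x \<le> g x\<rbrakk> \<Longrightarrow> L f \<le> L g"
    and L_one: "L (\<lambda>_. 1) = 1"
begin

lemma L_const: "L (\<lambda>_. c) = c"
  using L_cmult[of "\<lambda>_. 1" c] L_one by simp

lemma L_le_const: "\<lbrakk>continuous_map X euclideanreal f; \<And>x. x \<in> topspace X \<Longrightarrow> f x \<le> c\<rbrakk> \<Longrightarrow> L f \<le> c"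
  using L_mono[of f "\<lambda>_. c"] by (simp add: L_const)

lemma L_ge_const: "\<lbrakk>continuous_map X euclideanreal f; \<And>x. x \<in> topspace X \<Longrightarrow> c \<le> f x\<rbrakk> \<Longrightarrow> c \<le> L f"
  using L_mono[of "\<lambda>_. c" f] by (simp add: L_const)

lemma subordinate_L_bounds: "f \<in> subordinate U \<Longrightarrow> 0 \<le> L f \<and> L f \<le> 1"
  by (auto simp: subordinate_def intro: L_le_const L_ge_const)

section \<open>The content of open sets\<close>

definition content :: "'x set \<Rightarrow> real" where
  "content U = (SUP f\<in>subordinate U. L f)"

lemma subordinate_bdd: "bdd_above (L ` subordinate U)"
  using subordinate_L_bounds by (auto intro!: bdd_aboveI[of _ 1])

lemma content_upper: "f \<in> subordinate U \<Longrightarrow> L f \<le> content U"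
  unfolding content_def by (rule cSUP_upper[OF _ subordinate_bdd])

lemma content_least: "(\<And>f. f \<in> subordinate U \<Longrightarrow> L f \<le> c) \<Longrightarrow> content U \<le> c"
  unfolding content_def by (rule cSUP_least) (use subordinate_zero in auto)

lemma content_approx:
  assumes "0 < e" obtains f where "f \<in> subordinate U" "content U < L f + e"
proof -
  have "content U - e < (SUP f\<in>subordinate U. L f)" using assms by (simp add: content_def)
  then obtain f where "f \<in> subordinate U" "content U - e < L f"
    using less_cSUP_iff[OF _ subordinate_bdd, of U "content U - e"] subordinate_zero by blast
  then show ?thesis by (intro that[of f]) auto
qed

lemma content_nonneg: "0 \<le> content U"
  using content_upper[OF subordinate_zero] by (simp add: L_const)

lemma content_mono: "U \<subseteq> V \<Longrightarrow> content U \<le> content V"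
  by (intro content_least content_upper) (auto simp: subordinate_def)

lemma content_empty: "content {} = 0"
proof (rule antisym[OF content_least content_nonneg])
  fix f assume "f \<in> subordinate {}"
  then show "L f \<le> 0" by (intro L_le_const) (auto simp: subordinate_def)
qed

lemma content_topspace: "content (topspace X) = 1"
proof (rule antisym)
  show "content (topspace X) \<le> 1" using subordinate_L_bounds by (intro content_least) auto
  show "1 \<le> content (topspace X)"
    using content_upper[of "\<lambda>_. 1" "topspace X"] by (simp add: L_one subordinate_def)
qed

text \<open>The witness is the positive part of f - e. Cutting off costs at most e because f is at
  most g + e and \<open>L\<close> sends the constant e to e. What remains lives on the superlevel
  set of f at height e, which is closed and, as f vanishes off U, contained in U.\<close>

lemma trim:
  assumes f: "f \<in> subordinate U" and e: "0 < e"
  obtains K g where "closedin X K" "K \<subseteq> U" "L f \<le> L g + e" "continuous_map X euclideanreal g"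
    "\<And>x. x \<in> topspace X \<Longrightarrow> 0 \<le> g x" "\<And>x. x \<in> topspace X \<Longrightarrow> g x \<le> f x"
    "\<And>x. x \<in> topspace X - K \<Longrightarrow> g x = 0"
proof
  let ?g = "\<lambda>x. max (f x - e) 0" and ?K = "{x \<in> topspace X. f x \<in> {e..}}"
  have cf: "continuous_map X euclideanreal f" using f by (simp add: subordinate_def)
  show "closedin X ?K" by (rule closedin_continuous_map_preimage[OF cf]) auto
  show "?K \<subseteq> U" using f e by (force simp: subordinate_def)
  show cg: "continuous_map X euclideanreal ?g"
    by (intro continuous_map_real_max continuous_map_diff cf) auto
  have "L f \<le> L (\<lambda>x. ?g x + e)"
    by (intro L_mono cf continuous_map_add cg) auto
  also have "\<dots> = L ?g + e" using L_add[OF cg, of "\<lambda>_. e"] by (simp add: L_const)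
  finally show "L f \<le> L ?g + e" .
qed (use f e in \<open>auto simp: subordinate_def\<close>)

text \<open>Cutting off at height \<open>e\<close> makes the support of \<open>f\<close> compact in \<open>U \<union> V\<close>; the Urysohn function
  then splits it into a part vanishing off \<open>U\<close> and a part vanishing off \<open>V\<close>.\<close>

lemma content_Un:
  assumes U: "openin X U" and V: "openin X V"
  shows "content (U \<union> V) \<le> content U + content V"
proof (rule content_least, rule field_le_epsilon)
  fix f and e :: real assume f: "f \<in> subordinate (U \<union> V)" and e: "0 < e"
  obtain K g where t: "closedin X K" "K \<subseteq> U \<union> V" "L f \<le> L g + e" "continuous_map X euclideanreal g"
    "\<And>x. x \<in> topspace X \<Longrightarrow> 0 \<le> g x" "\<And>x. x \<in> topspace X \<Longrightarrow> g x \<le> f x"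
    "\<And>x. x \<in> topspace X - K \<Longrightarrow> g x = 0"
    by (rule trim[OF f e]) (rule that)
  have f1: "f x \<le> 1" if "x \<in> topspace X" for x using f that by (simp add: subordinate_def)
  have KU: "closedin X (K - U)" and KV: "closedin X (K - V)" using t(1) U V by (auto intro: closedin_diff)
  have disj: "(K - U) \<inter> (K - V) = {}" using t(2) by blast
  obtain h :: "'x \<Rightarrow> real" where h: "continuous_map X euclideanreal h"
    "\<And>x. x \<in> topspace X \<Longrightarrow> 0 \<le> h x" "\<And>x. x \<in> topspace X \<Longrightarrow> h x \<le> 1"
    "\<And>x. x \<in> K - U \<Longrightarrow> h x = 0" "\<And>x. x \<in> K - V \<Longrightarrow> h x = 1"
    by (rule Urysohn_function[OF KU KV disj]) (rule that)
  have g1: "g x \<le> 1" if "x \<in> topspace X" for x using t(6)[OF that] f1[OF that] by simp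
  have "(\<lambda>x. g x * h x) \<in> subordinate U"
    unfolding subordinate_def
  proof (intro CollectI conjI ballI)
    show "continuous_map X euclideanreal (\<lambda>x. g x * h x)" by (intro continuous_map_real_mult t h)
    show "0 \<le> g x * h x" "g x * h x \<le> 1" if "x \<in> topspace X" for x
      using that t(5) h(2,3) g1 by (auto intro: mult_le_one)
    show "g x * h x = 0" if "x \<in> topspace X - U" for x
      using that t(7)[of x] h(4)[of x] by auto
  qed
  then have 1: "L (\<lambda>x. g x * h x) \<le> content U" by (rule content_upper)
  have "(\<lambda>x. g x * (1 - h x)) \<in> subordinate V"
    unfolding subordinate_def
  proof (intro CollectI conjI ballI)
    show "continuous_map X euclideanreal (\<lambda>x. g x * (1 - h x))"
      by (intro continuous_map_real_mult continuous_map_diff t h) auto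
    show "0 \<le> g x * (1 - h x)" "g x * (1 - h x) \<le> 1" if "x \<in> topspace X" for x
      using that t(5) h(2,3) g1 by (auto intro: mult_le_one)
    show "g x * (1 - h x) = 0" if "x \<in> topspace X - V" for x
      using that t(7)[of x] h(5)[of x] by auto
  qed
  then have 2: "L (\<lambda>x. g x * (1 - h x)) \<le> content V" by (rule content_upper)
  have "L g = L (\<lambda>x. g x * h x + g x * (1 - h x))" by (simp add: algebra_simps)
  also have "\<dots> = L (\<lambda>x. g x * h x) + L (\<lambda>x. g x * (1 - h x))"
    by (intro L_add continuous_map_real_mult continuous_map_diff t h) auto
  finally show "L f \<le> content U + content V + e" using 1 2 t(3) by simp
qed

lemma content_finite_UN:
  fixes U :: "nat \<Rightarrow> 'x set"
  assumes "\<And>i. openin X (U i)"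
  shows "content (\<Union>i<n. U i) \<le> (\<Sum>i<n. content (U i))"
proof (induction n)
  case 0 then show ?case by (simp add: content_empty)
next
  case (Suc n)
  have "content (\<Union>i<Suc n. U i) = content ((\<Union>i<n. U i) \<union> U n)"
    by (rule arg_cong[of _ _ content]) (auto simp: less_Suc_eq)
  also have "\<dots> \<le> content (\<Union>i<n. U i) + content (U n)" using assms by (intro content_Un) auto
  finally show ?case using Suc by simp
qed

text \<open>Once trimmed, a test function for the union lives on a compact set, so finitely many of
  the U i already cover it and finite subadditivity applies. Half of e pays for choosing the test
  function, half for trimming it.\<close>

lemma content_UN:
  fixes U :: "nat \<Rightarrow> 'x set"
  assumes U: "\<And>i. openin X (U i)"
  shows "ennreal (content (\<Union>i. U i)) \<le> (\<Sum>i. ennreal (content (U i)))"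
proof (rule ennreal_le_epsilon)
  fix e :: real assume "0 < e"
  then have e: "0 < e/2" by simp
  obtain f where f: "f \<in> subordinate (\<Union>i. U i)" "content (\<Union>i. U i) < L f + e/2"
    using content_approx[OF e] by blast
  obtain K g where t: "closedin X K" "K \<subseteq> (\<Union>i. U i)" "L f \<le> L g + e/2" "continuous_map X euclideanreal g"
    "\<And>x. x \<in> topspace X \<Longrightarrow> 0 \<le> g x" "\<And>x. x \<in> topspace X \<Longrightarrow> g x \<le> f x"
    "\<And>x. x \<in> topspace X - K \<Longrightarrow> g x = 0"
    by (rule trim[OF f(1) e]) (rule that)
  have "compactin X K" using t(1) compact_X by (simp add: closedin_compact_space)
  then obtain \<F> where F: "finite \<F>" "\<F> \<subseteq> range U" "K \<subseteq> \<Union>\<F>"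
    using compactinD[of X K "range U"] t(2) U by blast
  then obtain J where J: "finite J" "\<F> = U ` J" by (meson finite_subset_image)
  then obtain n where "J \<subseteq> {..<n}" using finite_nat_iff_bounded by blast
  with F J have K: "K \<subseteq> (\<Union>i<n. U i)" by blast
  have "g \<in> subordinate (\<Union>i<n. U i)"
    unfolding subordinate_def
  proof (intro CollectI conjI ballI t(4))
    show "0 \<le> g x" if "x \<in> topspace X" for x using t(5)[OF that] .
    show "g x \<le> 1" if "x \<in> topspace X" for x
    proof -
      have "f x \<le> 1" using f(1) that by (simp add: subordinate_def)
      with t(6)[OF that] show ?thesis by simp
    qed
    show "g x = 0" if "x \<in> topspace X - (\<Union>i<n. U i)" for x using t(7)[of x] K that by blast
  qed
  then have "L g \<le> content (\<Union>i<n. U i)" by (rule content_upper)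
  also have "\<dots> \<le> (\<Sum>i<n. content (U i))" by (rule content_finite_UN[OF U])
  finally have "content (\<Union>i. U i) \<le> (\<Sum>i<n. content (U i)) + e" using f t(3) by simp
  then have "ennreal (content (\<Union>i. U i)) \<le> (\<Sum>i<n. ennreal (content (U i))) + ennreal e"
    using \<open>0 < e\<close> content_nonneg by (simp add: sum_nonneg ennreal_leI flip: ennreal_plus)
  also have "\<dots> \<le> (\<Sum>i. ennreal (content (U i))) + ennreal e"
    by (intro add_right_mono sum_le_suminf) auto
  finally show "ennreal (content (\<Union>i. U i)) \<le> (\<Sum>i. ennreal (content (U i))) + ennreal e" .
qed

section \<open>The induced outer measure and its restriction to Borel sets\<close>

definition outer :: "'x set \<Rightarrow> ennreal" where
  "outer E = (INF U\<in>{U. openin X U \<and> E \<subseteq> U}. ennreal (content U))"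

lemma outer_open: "openin X U \<Longrightarrow> outer U = ennreal (content U)"
  unfolding outer_def
  by (rule antisym) (auto intro!: INF_lower INF_greatest ennreal_leI content_mono)

lemma outer_mono: "E \<subseteq> F \<Longrightarrow> outer E \<le> outer F"
  unfolding outer_def by (rule INF_superset_mono) auto

lemma outer_le_1: "E \<subseteq> topspace X \<Longrightarrow> outer E \<le> 1"
  using outer_mono[of E "topspace X"] by (simp add: outer_open content_topspace)

lemma outer_approx:
  assumes "E \<subseteq> topspace X" "0 < e"
  obtains U where "openin X U" "E \<subseteq> U" "ennreal (content U) \<le> outer E + ennreal e"
proof -
  have "outer E < \<infinity>" using outer_le_1[OF assms(1)] by (rule le_less_trans) simp
  then have "outer E < outer E + ennreal e"
    using assms(2) by (cases "outer E") (auto simp: ennreal_less_iff simp flip: ennreal_plus)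
  then obtain U where "openin X U" "E \<subseteq> U" "ennreal (content U) < outer E + ennreal e"
    unfolding outer_def by (auto simp: INF_less_iff)
  then show ?thesis by (intro that) auto
qed

lemma outer_countably_subadditive: "countably_subadditive (Pow (topspace X)) outer"
  unfolding countably_subadditive_def
proof (intro allI impI)
  fix A :: "nat \<Rightarrow> 'x set" assume A: "range A \<subseteq> Pow (topspace X)"
  show "outer (\<Union>i. A i) \<le> (\<Sum>i. outer (A i))"
  proof (rule ennreal_le_epsilon)
    fix e :: real assume e: "0 < e"
    have "\<exists>U. openin X U \<and> A i \<subseteq> U \<and> ennreal (content U) \<le> outer (A i) + ennreal (e * (1/2) ^ Suc i)" for i
    proof -
      have "A i \<subseteq> topspace X" "0 < e * (1/2) ^ Suc i" using A e by auto
      from outer_approx[OF this] show ?thesis by blast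
    qed
    then obtain U where U: "\<And>i. openin X (U i)" "\<And>i. A i \<subseteq> U i"
      "\<And>i. ennreal (content (U i)) \<le> outer (A i) + ennreal (e * (1/2) ^ Suc i)"
      by metis
    have "outer (\<Union>i. A i) \<le> outer (\<Union>i. U i)" using U(2) by (intro outer_mono) blast
    also have "\<dots> = ennreal (content (\<Union>i. U i))" using U(1) by (intro outer_open) auto
    also have "\<dots> \<le> (\<Sum>i. ennreal (content (U i)))" by (rule content_UN[OF U(1)])
    also have "\<dots> \<le> (\<Sum>i. outer (A i) + ennreal (e * (1/2) ^ Suc i))"
      by (intro suminf_le U(3)) auto
    also have "\<dots> = (\<Sum>i. outer (A i)) + (\<Sum>i. ennreal (e * (1/2) ^ Suc i))"
      by (rule suminf_add[symmetric]) auto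
    also have "(\<Sum>i. ennreal (e * (1/2) ^ Suc i)) = ennreal e"
      using sums_mult[OF power_half_series, of e] e
      by (intro sums_unique[symmetric]) (simp add: sums_ennreal)
    finally show "outer (\<Union>i. A i) \<le> (\<Sum>i. outer (A i)) + ennreal e" .
  qed
qed

lemma outer_measure_space_outer: "outer_measure_space (Pow (topspace X)) outer"
  unfolding outer_measure_space_def
proof (intro conjI outer_countably_subadditive)
  show "positive (Pow (topspace X)) outer" by (simp add: positive_def outer_open content_empty)
  show "increasing (Pow (topspace X)) outer" by (simp add: increasing_def outer_mono)
qed

text \<open>The hard half of the Caratheodory condition, for open V. Take g for
  \<open>V \<inter> U\<close>, trimmed to a closed K, and h for the open set \<open>V - K\<close>.
  Then g + h stays below 1, because h vanishes on K and g vanishes off K; so it is a test function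
  for V. Since \<open>V - U\<close> lies in \<open>V - K\<close>, h accounts for the second summand.
  The three approximations cost e/3 each.\<close>

lemma content_split:
  assumes U: "openin X U" and V: "openin X V"
  shows "ennreal (content (V \<inter> U)) + outer (V - U) \<le> ennreal (content V)"
proof (rule ennreal_le_epsilon)
  fix e :: real assume e: "0 < e"
  then have e3: "0 < e/3" by simp
  obtain f where f: "f \<in> subordinate (V \<inter> U)" "content (V \<inter> U) < L f + e/3"
    using content_approx[OF e3] by blast
  obtain K g where t: "closedin X K" "K \<subseteq> V \<inter> U" "L f \<le> L g + e/3" "continuous_map X euclideanreal g"
    "\<And>x. x \<in> topspace X \<Longrightarrow> 0 \<le> g x" "\<And>x. x \<in> topspace X \<Longrightarrow> g x \<le> f x"
    "\<And>x. x \<in> topspace X - K \<Longrightarrow> g x = 0"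
    by (rule trim[OF f(1) e3]) (rule that)
  have VK: "openin X (V - K)" using V t(1) by (intro openin_diff) auto
  obtain h where h: "h \<in> subordinate (V - K)" "content (V - K) < L h + e/3"
    using content_approx[OF e3] by blast
  have ch: "continuous_map X euclideanreal h" using h by (simp add: subordinate_def)
  have "(\<lambda>x. g x + h x) \<in> subordinate V"
    unfolding subordinate_def
  proof (intro CollectI conjI ballI continuous_map_add t(4) ch)
    fix x assume x: "x \<in> topspace X"
    have h01: "0 \<le> h x" "h x \<le> 1" using h(1) x by (auto simp: subordinate_def)
    show "0 \<le> g x + h x" using t(5)[OF x] h01 by simp
    show "g x + h x \<le> 1"
    proof (cases "x \<in> K")
      case True
      then have "h x = 0" using h(1) x by (simp add: subordinate_def)
      moreover have "f x \<le> 1" using f(1) x by (simp add: subordinate_def)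
      ultimately show ?thesis using t(6)[OF x] by simp
    next
      case False
      then show ?thesis using t(7)[of x] h01 x by simp
    qed
  next
    fix x assume x: "x \<in> topspace X - V"
    then have "h x = 0" using h by (simp add: subordinate_def)
    moreover have "g x = 0" using t(7)[of x] t(2) x by blast
    ultimately show "g x + h x = 0" by simp
  qed
  from content_upper[OF this] have "L g + L h \<le> content V" by (simp add: L_add[OF t(4) ch])
  then have le: "content (V \<inter> U) + content (V - K) \<le> content V + e" using f(2) h(2) t(3) by simp
  have "outer (V - U) \<le> outer (V - K)" using t(2) by (intro outer_mono) blast
  then have "ennreal (content (V \<inter> U)) + outer (V - U) \<le> ennreal (content (V \<inter> U)) + ennreal (content (V - K))"
    by (simp add: outer_open[OF VK] add_left_mono)
  also have "\<dots> \<le> ennreal (content V + e)"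
    using le content_nonneg by (simp add: ennreal_leI flip: ennreal_plus)
  finally show "ennreal (content (V \<inter> U)) + outer (V - U) \<le> ennreal (content V) + ennreal e"
    using e content_nonneg by simp
qed

text \<open>An arbitrary E is reduced to \<open>content_split\<close> by an open V around E whose
  content nearly equals \<open>outer E\<close>; the other inequality is subadditivity.\<close>

lemma open_in_lambda_system:
  assumes U: "openin X U"
  shows "U \<in> lambda_system (topspace X) (Pow (topspace X)) outer"
  unfolding algebra.lambda_system_eq[OF sigma_algebra.axioms(1)[OF sigma_algebra_Pow]]
proof (intro CollectI conjI ballI)
  show "U \<in> Pow (topspace X)" using U openin_subset by blast
  fix E assume E: "E \<in> Pow (topspace X)"
  have sub: "subadditive (Pow (topspace X)) outer"
    by (rule ring_of_sets.countably_subadditive_subadditive[OF Sigma_Algebra.algebra.axioms(1)[OF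
          sigma_algebra.axioms(1)[OF sigma_algebra_Pow]] _ outer_countably_subadditive])
       (simp add: positive_def outer_open content_empty)
  show "outer (E \<inter> U) + outer (E - U) = outer E"
  proof (rule antisym)
    show "outer (E \<inter> U) + outer (E - U) \<le> outer E"
    proof (rule ennreal_le_epsilon)
      fix e :: real assume "0 < e"
      then obtain V where V: "openin X V" "E \<subseteq> V" "ennreal (content V) \<le> outer E + ennreal e"
        using outer_approx E by blast
      have "outer (E \<inter> U) + outer (E - U) \<le> outer (V \<inter> U) + outer (V - U)"
        using V(2) by (intro add_mono outer_mono) auto
      also have "\<dots> \<le> ennreal (content V)"
        using content_split[OF U V(1)] by (simp add: outer_open[OF openin_Int[OF V(1) U]])
      finally show "outer (E \<inter> U) + outer (E - U) \<le> outer E + ennreal e" using V(3) by simp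
    qed
    have "outer ((E \<inter> U) \<union> (E - U)) \<le> outer (E \<inter> U) + outer (E - U)"
      using E by (intro subadditiveD[OF sub]) auto
    moreover have "(E \<inter> U) \<union> (E - U) = E" by blast
    ultimately show "outer E \<le> outer (E \<inter> U) + outer (E - U)" by simp
  qed
qed

definition rep_measure :: "'x measure" where
  "rep_measure = measure_of (topspace X) (sets (borel_of X)) outer"

lemma sets_rep_measure: "sets rep_measure = sets (borel_of X)"
  unfolding rep_measure_def using sets.space_closed[of "borel_of X"] sets.sigma_sets_eq[of "borel_of X"]
  by (simp add: sets_measure_of)

lemma space_rep_measure: "space rep_measure = topspace X"
  using sets_eq_imp_space_eq[OF sets_rep_measure] by simp

text \<open>The Caratheodory sets form a sigma-algebra on which \<open>outer\<close> is countably
  additive. It contains the open sets, hence the Borel sets, so \<open>measure_of\<close> keeps the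
  values of \<open>outer\<close> there.\<close>

lemma emeasure_rep_measure:
  assumes "E \<in> sets (borel_of X)"
  shows "emeasure rep_measure E = outer E"
proof -
  let ?ls = "lambda_system (topspace X) (Pow (topspace X)) outer"
  have mls: "measure_space (topspace X) ?ls outer"
    using sigma_algebra.caratheodory_lemma[OF sigma_algebra_Pow outer_measure_space_outer] .
  then have sls: "sigma_algebra (topspace X) ?ls" by (simp add: measure_space_def)
  have sub: "sets (borel_of X) \<subseteq> ?ls"
    unfolding sets_borel_of using open_in_lambda_system by (intro sigma_algebra.sigma_sets_subset[OF sls]) auto
  have "countably_additive (sets (borel_of X)) outer"
    using mls sub unfolding measure_space_def countably_additive_def by blast
  moreover have "positive (sets (borel_of X)) outer"
    by (simp add: positive_def outer_open content_empty)
  ultimately show ?thesis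
    using assms sets.sigma_sets_eq[of "borel_of X"] sets.space_closed[of "borel_of X"]
    unfolding rep_measure_def
    by (intro emeasure_measure_of_sigma) (auto intro: sets.sigma_algebra_axioms[of "borel_of X", simplified])
qed

lemma prob_space_rep_measure: "prob_space rep_measure"
  by (rule prob_spaceI)
     (simp add: space_rep_measure emeasure_rep_measure openin_sets_borel_of outer_open content_topspace)

lemma measure_rep_measure_open: "openin X U \<Longrightarrow> measure rep_measure U = content U"
  by (simp add: measure_def emeasure_rep_measure openin_sets_borel_of outer_open content_nonneg)

lemma rep_measure_prob_meas: "rep_measure \<in> prob_meas X"
proof (rule outer_regular_prob_meas[OF prob_space_rep_measure sets_rep_measure])
  fix E assume "E \<in> sets rep_measure"
  then have E: "E \<in> sets (borel_of X)" by (simp add: sets_rep_measure)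
  show "emeasure rep_measure E = (INF U\<in>{U. openin X U \<and> E \<subseteq> U}. emeasure rep_measure U)"
    unfolding emeasure_rep_measure[OF E]
    by (subst outer_def, rule INF_cong)
       (auto simp: emeasure_rep_measure openin_sets_borel_of outer_open)
qed

text \<open>Layer cake: \<open>f\<close> is the mean of the functions \<open>k i\<close>, and \<open>k i\<close> lies between the indicators
  of the superlevel sets of \<open>f\<close> at the heights \<open>(i + 1) / n\<close> and \<open>i / n\<close>.\<close>

lemma L_le_integral_unit:
  assumes cf: "continuous_map X euclideanreal f" and f01: "\<And>x. x \<in> topspace X \<Longrightarrow> 0 \<le> f x \<and> f x \<le> 1"
  shows "L f \<le> (LINT x|rep_measure. f x)"
proof (rule field_le_epsilon)
  fix e :: real assume "0 < e"
  then obtain n :: nat where n: "n \<noteq> 0" "inverse (real n) < e"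
    unfolding real_arch_inverse[of e] by blast
  interpret prob_space rep_measure by (rule prob_space_rep_measure)
  define k where "k i x = min 1 (max 0 (n * f x - real i))" for i x
  define U where "U i = {x \<in> topspace X. real i < n * f x}" for i
  have ck: "continuous_map X euclideanreal (k i)" for i
    unfolding k_def by (intro continuous_map_real_min continuous_map_real_max continuous_map_diff
      continuous_map_real_mult cf) auto
  have openU: "openin X (U i)" for i
  proof -
    have "continuous_map X euclideanreal (\<lambda>x. n * f x)" by (intro continuous_map_real_mult cf) auto
    then have "openin X {x \<in> topspace X. n * f x \<in> {real i<..}}"
      by (rule openin_continuous_map_preimage) auto
    then show ?thesis by (simp add: U_def)
  qed
  have sum_k: "(\<Sum>i<m. k i x) = min (real m) (n * f x)" if "x \<in> topspace X" for x m
    using f01[OF that] by (induction m) (auto simp: k_def min_def max_def)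
  have k_sub: "k i \<in> subordinate (U i)" for i
    using ck by (auto simp: subordinate_def U_def k_def)
  have integr: "integrable rep_measure (k i)" for i
    by (rule integrable_continuous_map[OF compact_X prob_space_rep_measure sets_rep_measure ck])
  have int_k: "measure rep_measure (U (Suc i)) \<le> (LINT x|rep_measure. k i x)" for i
  proof -
    have m: "U (Suc i) \<in> sets rep_measure" using openU by (simp add: sets_rep_measure openin_sets_borel_of)
    have "(LINT x|rep_measure. indicator (U (Suc i)) x) \<le> (LINT x|rep_measure. k i x)"
    proof (rule integral_mono[OF _ integr])
      show "integrable rep_measure (indicator (U (Suc i)) :: 'x \<Rightarrow> real)"
        using m by (intro integrable_real_indicator) (auto simp: emeasure_eq_measure)
      show "indicator (U (Suc i)) x \<le> k i x" for x
        by (auto simp: indicator_def U_def k_def)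
    qed
    then show ?thesis using m by simp
  qed
  have sumL: "L (\<lambda>x. \<Sum>i<m. k i x) = (\<Sum>i<m. L (k i))" for m
  proof (induction m)
    case 0 then show ?case by (simp add: L_const)
  next
    case (Suc m)
    have "L (\<lambda>x. (\<Sum>i<m. k i x) + k m x) = L (\<lambda>x. \<Sum>i<m. k i x) + L (k m)"
      by (intro L_add continuous_map_sum ck) auto
    with Suc show ?case by simp
  qed
  have "real n * L f = L (\<lambda>x. real n * f x)" by (simp add: L_cmult[OF cf])
  also have "\<dots> \<le> L (\<lambda>x. \<Sum>i<n. k i x)"
  proof (intro L_mono continuous_map_sum continuous_map_real_mult ck cf)
    fix x assume x: "x \<in> topspace X"
    then have "real n * f x \<le> real n * 1" using f01 by (intro mult_left_mono) auto
    then show "real n * f x \<le> (\<Sum>i<n. k i x)" by (simp add: sum_k[OF x])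
  qed auto
  also have "\<dots> = (\<Sum>i<n. L (k i))" by (rule sumL)
  also have "\<dots> \<le> (\<Sum>i<n. measure rep_measure (U i))"
    using content_upper[OF k_sub] by (intro sum_mono) (simp add: measure_rep_measure_open openU)
  \<comment> \<open>One more superlevel set is added so that the index can be shifted by one. The
    split-off set \<open>U 0\<close> has mass at most 1, which is the error 1/n after division by
    n.\<close>
  also have "\<dots> \<le> (\<Sum>i<Suc n. measure rep_measure (U i))" by simp
  also have "\<dots> = measure rep_measure (U 0) + (\<Sum>i<n. measure rep_measure (U (Suc i)))"
    by (rule sum.lessThan_Suc_shift)
  also have "\<dots> \<le> 1 + (\<Sum>i<n. (LINT x|rep_measure. k i x))"
    by (intro add_mono sum_mono int_k prob_le_1)
  also have "(\<Sum>i<n. (LINT x|rep_measure. k i x)) = (LINT x|rep_measure. (\<Sum>i<n. k i x))"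
    using integr by (subst Bochner_Integration.integral_sum) auto
  also have "\<dots> = (LINT x|rep_measure. n * f x)"
  proof (rule Bochner_Integration.integral_cong[OF refl])
    fix x assume "x \<in> space rep_measure"
    then have x: "x \<in> topspace X" by (simp add: space_rep_measure)
    then have "real n * f x \<le> real n * 1" using f01 by (intro mult_left_mono) auto
    then show "(\<Sum>i<n. k i x) = n * f x" by (simp add: sum_k[OF x])
  qed
  also have "\<dots> = n * (LINT x|rep_measure. f x)" by simp
  finally have "L f \<le> (LINT x|rep_measure. f x) + 1 / n" using n by (simp add: field_simps)
  with n show "L f \<le> (LINT x|rep_measure. f x) + e" by (simp add: inverse_eq_divide)
qed

lemma L_le_integral:
  assumes cf: "continuous_map X euclideanreal f"
  shows "L f \<le> (LINT x|rep_measure. f x)"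
proof -
  interpret prob_space rep_measure by (rule prob_space_rep_measure)
  obtain B where B: "0 \<le> B" "\<And>x. x \<in> topspace X \<Longrightarrow> norm (f x) \<le> B"
    using compact_space_continuous_bounded[OF compact_X cf] by blast
  \<comment> \<open>Scaling by c squeezes f into the interval from -1/2 to 1/2, and g shifts it into
    the unit interval. B + 1 instead of B keeps the denominator positive when B = 0.\<close>
  define c where "c = 1 / (2 * (B + 1))"
  have c: "0 < c" using B by (simp add: c_def)
  define g where "g x = c * f x + 1/2" for x
  have cg: "continuous_map X euclideanreal g"
    unfolding g_def by (intro continuous_map_add continuous_map_real_mult cf) auto
  have "\<bar>c * f x\<bar> \<le> 1/2" if "x \<in> topspace X" for x
  proof -
    have "\<bar>c * f x\<bar> \<le> c * (B + 1)" using B(2)[OF that] c by (simp add: abs_mult)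
    also have "\<dots> = 1/2" using B by (simp add: c_def field_simps)
    finally show ?thesis .
  qed
  then have "0 \<le> g x \<and> g x \<le> 1" if "x \<in> topspace X" for x
    using that by (force simp: g_def abs_le_iff)
  then have "L g \<le> (LINT x|rep_measure. g x)" by (rule L_le_integral_unit[OF cg])
  moreover have "L g = c * L f + 1/2"
  proof -
    have "L g = L (\<lambda>x. c * f x) + L (\<lambda>_. 1/2)"
      unfolding g_def by (intro L_add continuous_map_real_mult cf) auto
    then show ?thesis by (simp add: L_cmult[OF cf] L_const)
  qed
  moreover have "(LINT x|rep_measure. g x) = c * (LINT x|rep_measure. f x) + 1/2"
    unfolding g_def
    using integrable_continuous_map[OF compact_X prob_space_rep_measure sets_rep_measure cf]
    by (simp add: prob_space)
  ultimately show ?thesis using c by simp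
qed

theorem integral_rep_measure:
  assumes cf: "continuous_map X euclideanreal f"
  shows "(LINT x|rep_measure. f x) = L f"
proof (rule antisym[OF _ L_le_integral[OF cf]])
  \<comment> \<open>The inequality just proved holds for every continuous function; for -f it is the
    reverse one.\<close>
  have "L (\<lambda>x. - 1 * f x) \<le> (LINT x|rep_measure. - 1 * f x)"
    by (intro L_le_integral continuous_map_real_mult cf) auto
  then show "(LINT x|rep_measure. f x) \<le> L f" using L_cmult[OF cf, of "-1"] by simp
qed

end

section \<open>Full regularity from inner regularity on open sets\<close>

context compact_hausdorff
begin

text \<open>Integration against M is itself a normalized positive functional. Its Riesz measure is
  regular and has the same integrals, so \<open>open_regular_eqI\<close> identifies it with
  M.\<close>

lemma open_regular_prob_meas:
  assumes M: "open_regular X M"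
  shows "M \<in> prob_meas X"
proof -
  interpret prob_space M using M by (simp add: open_regular_def)
  have sets: "sets M = sets (borel_of X)" using M by (simp add: open_regular_def)
  have sp: "space M = topspace X" using sets_eq_imp_space_eq[OF sets] by simp
  note integr = integrable_continuous_map[OF compact_X prob_space_axioms sets]
  interpret R: normalized_positive_functional X "\<lambda>f. LINT x|M. f x"
  proof
    show "(LINT x|M. f x) \<le> (LINT x|M. g x)"
      if "continuous_map X euclideanreal f" "continuous_map X euclideanreal g"
        "\<And>x. x \<in> topspace X \<Longrightarrow> f x \<le> g x" for f g
      using that by (intro integral_mono integr) (auto simp: sp)
  qed (auto simp: integr prob_space)
  have "M = R.rep_measure"
    by (rule open_regular_eqI[OF M prob_meas_open_regular[OF R.rep_measure_prob_meas]])
       (simp add: R.integral_rep_measure)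
  then show ?thesis using R.rep_measure_prob_meas by simp
qed

end

section \<open>The category of stochastic maps\<close>

lemma continuous_map_of_real:
  "continuous_map X euclideanreal f \<Longrightarrow> continuous_map X euclidean (\<lambda>x. complex_of_real (f x))"
  using continuous_map_compose[of X euclideanreal f euclidean complex_of_real]
  by (simp add: o_def continuous_on_of_real_id)

lemma continuous_map_Re: "continuous_map X euclidean f \<Longrightarrow> continuous_map X euclideanreal (\<lambda>x. Re (f x))"
  using continuous_map_compose[of X euclidean f euclideanreal Re]
  by (simp add: o_def continuous_on_Re continuous_on_id)

lemma continuous_map_Im: "continuous_map X euclidean f \<Longrightarrow> continuous_map X euclideanreal (\<lambda>x. Im (f x))"
  using continuous_map_compose[of X euclidean f euclideanreal Im]
  by (simp add: o_def continuous_on_Im continuous_on_id)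

lemma continuous_map_complexI:
  assumes "continuous_map X euclideanreal (\<lambda>x. Re (f x))" "continuous_map X euclideanreal (\<lambda>x. Im (f x))"
  shows "continuous_map X euclidean f"
proof -
  have "continuous_map X euclidean (\<lambda>x. \<i> * complex_of_real (Im (f x)))"
    using continuous_map_compose[OF continuous_map_of_real[OF assms(2)], of euclidean "\<lambda>z. \<i> * z"]
    by (simp add: o_def continuous_on_mult continuous_on_id continuous_on_const)
  from continuous_map_add[OF continuous_map_of_real[OF assms(1)] this]
  have "continuous_map X euclidean (\<lambda>x. complex_of_real (Re (f x)) + \<i> * complex_of_real (Im (f x)))" .
  then show ?thesis by (simp flip: complex_eq)
qed

lemma topspace_vague_topology [simp]: "topspace (vague_topology X) = prob_meas X"
proof -
  \<comment> \<open>The zero test function together with the open set \<open>UNIV\<close> exhibits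
    the whole space as one of the generating sets.\<close>
  have "prob_meas X = {M \<in> prob_meas X. (LINT x|M. 0 :: complex) \<in> UNIV}" by simp
  then have "prob_meas X \<in> {{M \<in> prob_meas X. (LINT x|M. \<phi> x) \<in> V} | (\<phi> :: 'a \<Rightarrow> complex) V.
        continuous_map X euclidean \<phi> \<and> open V}"
    by (intro CollectI exI[of _ "\<lambda>_. 0"] exI[of _ UNIV]) auto
  then show ?thesis unfolding vague_topology_def topology_generated_by_topspace by auto
qed

lemma continuous_map_vague_topology:
  "continuous_map X (vague_topology Y) \<mu> \<longleftrightarrow> (\<forall>x\<in>topspace X. \<mu> x \<in> prob_meas Y) \<and>
    (\<forall>\<phi> :: 'y \<Rightarrow> complex. continuous_map Y euclidean \<phi> \<longrightarrow>
      continuous_map X euclidean (\<lambda>x. LINT y|\<mu> x. \<phi> y))" (is "?lhs \<longleftrightarrow> ?A \<and> ?B")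
proof
  assume lhs: ?lhs
  then have A: ?A using continuous_map_image_subset_topspace[OF lhs] by auto
  moreover have ?B
  proof (intro allI impI)
    fix \<phi> :: "'y \<Rightarrow> complex" assume \<phi>: "continuous_map Y euclidean \<phi>"
    have "openin X {x \<in> topspace X. (LINT y|\<mu> x. \<phi> y) \<in> V}" if "open V" for V
    proof -
      have "openin (vague_topology Y) {M \<in> prob_meas Y. (LINT x|M. \<phi> x) \<in> V}"
        unfolding vague_topology_def by (rule topology_generated_by_Basis) (use \<phi> that in blast)
      from openin_continuous_map_preimage[OF lhs this]
      have "openin X {x \<in> topspace X. \<mu> x \<in> {M \<in> prob_meas Y. (LINT x|M. \<phi> x) \<in> V}}" .
      moreover have "{x \<in> topspace X. \<mu> x \<in> {M \<in> prob_meas Y. (LINT x|M. \<phi> x) \<in> V}} =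
          {x \<in> topspace X. (LINT y|\<mu> x. \<phi> y) \<in> V}" using A by auto
      ultimately show ?thesis by simp
    qed
    then show "continuous_map X euclidean (\<lambda>x. LINT y|\<mu> x. \<phi> y)"
      by (simp add: continuous_map_def)
  qed
  ultimately show "?A \<and> ?B" ..
next
  assume AB: "?A \<and> ?B"
  show ?lhs
    unfolding vague_topology_def
  proof (rule continuous_on_generated_topo)
    fix U assume "U \<in> {{M \<in> prob_meas Y. (LINT x|M. \<phi> x) \<in> V} | (\<phi> :: 'y \<Rightarrow> complex) V.
        continuous_map Y euclidean \<phi> \<and> open V}"
    then obtain \<phi> :: "'y \<Rightarrow> complex" and V where U: "U = {M \<in> prob_meas Y. (LINT x|M. \<phi> x) \<in> V}"
      "continuous_map Y euclidean \<phi>" "open V" by blast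
    then have "openin X {x \<in> topspace X. (LINT y|\<mu> x. \<phi> y) \<in> V}"
      using AB openin_continuous_map_preimage[of X euclidean "\<lambda>x. LINT y|\<mu> x. \<phi> y" V] by simp
    moreover have "\<mu> -` U \<inter> topspace X = {x \<in> topspace X. (LINT y|\<mu> x. \<phi> y) \<in> V}" using U AB by auto
    ultimately show "openin X (\<mu> -` U \<inter> topspace X)" by simp
  next
    have "topspace (vague_topology Y) = prob_meas Y" by simp
    with AB show "\<mu> ` topspace X \<subseteq> \<Union> {{M \<in> prob_meas Y. (LINT x|M. \<phi> x) \<in> V} | (\<phi> :: 'y \<Rightarrow> complex) V.
        continuous_map Y euclidean \<phi> \<and> open V}"
      unfolding vague_topology_def topology_generated_by_topspace by auto
  qed
qed

text \<open>Real test functions suffice, which is what the Urysohn, Riesz and Stone-Weierstrass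
  arguments supply. Compactness of Y makes complex test functions integrable, so real and imaginary
  parts may be taken inside the integral.\<close>

lemma stoch_maps_iff:
  assumes "compact_space Y"
  shows "\<mu> \<in> stoch_maps X Y \<longleftrightarrow> \<mu> \<in> extensional (topspace X) \<and> (\<forall>x\<in>topspace X. \<mu> x \<in> prob_meas Y) \<and>
    (\<forall>\<phi>. continuous_map Y euclideanreal \<phi> \<longrightarrow> continuous_map X euclideanreal (\<lambda>x. LINT y|\<mu> x. \<phi> y))"
proof -
  have "(\<forall>\<phi> :: _ \<Rightarrow> complex. continuous_map Y euclidean \<phi> \<longrightarrow> continuous_map X euclidean (\<lambda>x. LINT y|\<mu> x. \<phi> y)) \<longleftrightarrow>
    (\<forall>\<phi>. continuous_map Y euclideanreal \<phi> \<longrightarrow> continuous_map X euclideanreal (\<lambda>x. LINT y|\<mu> x. \<phi> y))"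
    (is "?C \<longleftrightarrow> ?R") if \<mu>: "\<forall>x\<in>topspace X. \<mu> x \<in> prob_meas Y"
  proof (intro iffI allI impI)
    fix \<phi> :: "'a \<Rightarrow> real" assume ?C and "continuous_map Y euclideanreal \<phi>"
    then have "continuous_map X euclidean (\<lambda>x. LINT y|\<mu> x. complex_of_real (\<phi> y))"
      using continuous_map_of_real by blast
    from continuous_map_Re[OF this] show "continuous_map X euclideanreal (\<lambda>x. LINT y|\<mu> x. \<phi> y)" by simp
  next
    fix \<phi> :: "'a \<Rightarrow> complex" assume R: ?R and \<phi>: "continuous_map Y euclidean \<phi>"
    have integr: "integrable (\<mu> x) \<phi>" if "x \<in> topspace X" for x
      using \<mu> that by (intro integrable_continuous_map[OF assms _ _ \<phi>]) (auto simp: prob_meas_def)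
    show "continuous_map X euclidean (\<lambda>x. LINT y|\<mu> x. \<phi> y)"
    proof (rule continuous_map_complexI)
      show "continuous_map X euclideanreal (\<lambda>x. Re (LINT y|\<mu> x. \<phi> y))"
        by (rule continuous_map_eq[OF R[rule_format, OF continuous_map_Re[OF \<phi>]]]) (simp add: integr)
      show "continuous_map X euclideanreal (\<lambda>x. Im (LINT y|\<mu> x. \<phi> y))"
        by (rule continuous_map_eq[OF R[rule_format, OF continuous_map_Im[OF \<phi>]]]) (simp add: integr)
    qed
  qed
  then show ?thesis
    unfolding stoch_maps_def continuous_map_vague_topology mem_Collect_eq by (intro conj_cong refl)
qed

lemma stoch_maps_prob_meas: "\<lbrakk>\<mu> \<in> stoch_maps X Y; x \<in> topspace X\<rbrakk> \<Longrightarrow> \<mu> x \<in> prob_meas Y"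
  using continuous_map_vague_topology[of X Y \<mu>] by (simp add: stoch_maps_def)

lemma prob_measD:
  assumes "M \<in> prob_meas X"
  shows "prob_space M" "sets M = sets (borel_of X)" "space M = topspace X"
  using assms by (auto simp: prob_meas_def)

section \<open>Semicontinuity and measurability of kernels\<close>

locale stoch_map = target: compact_hausdorff Y for Y :: "'y topology" +
  fixes X :: "'x topology" and \<mu> :: "'x \<Rightarrow> 'y measure"
  assumes prob_meas: "x \<in> topspace X \<Longrightarrow> \<mu> x \<in> prob_meas Y"
    and continuous_integral:
      "continuous_map Y euclideanreal \<phi> \<Longrightarrow> continuous_map X euclideanreal (\<lambda>x. LINT y|\<mu> x. \<phi> y)"
begin

text \<open>Lower semicontinuity: the mass of an open W is a supremum of integrals of functions
  subordinate to W, and each of these integrals is continuous in x.\<close>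

lemma openin_measure_gt:
  assumes W: "openin Y W"
  shows "openin X {x \<in> topspace X. c < measure (\<mu> x) W}"
proof (subst openin_subopen, intro ballI)
  fix x assume "x \<in> {x \<in> topspace X. c < measure (\<mu> x) W}"
  then have x: "x \<in> topspace X" "0 < measure (\<mu> x) W - c" by auto
  obtain \<phi> where \<phi>: "\<phi> \<in> target.subordinate W" "measure (\<mu> x) W < (LINT y|\<mu> x. \<phi> y) + (measure (\<mu> x) W - c)"
    using target.open_regular_subordinate[OF target.prob_meas_open_regular[OF prob_meas[OF x(1)]] W x(2)] by blast
  let ?T = "{x' \<in> topspace X. (LINT y|\<mu> x'. \<phi> y) \<in> {c<..}}"
  have "openin X ?T"
    using \<phi> by (intro openin_continuous_map_preimage[OF continuous_integral]) (auto simp: target.subordinate_def)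
  moreover have "x \<in> ?T" using x \<phi> by auto
  moreover have "?T \<subseteq> {x \<in> topspace X. c < measure (\<mu> x) W}"
  proof safe
    fix x' assume x': "x' \<in> topspace X" "c < (LINT y|\<mu> x'. \<phi> y)"
    have "(LINT y|\<mu> x'. \<phi> y) \<le> measure (\<mu> x') W"
      using prob_measD[OF prob_meas[OF x'(1)]] W \<phi> by (intro target.subordinate_integral_le) auto
    with x' show "c < measure (\<mu> x') W" by simp
  qed
  ultimately show "\<exists>T. openin X T \<and> x \<in> T \<and> T \<subseteq> {x \<in> topspace X. c < measure (\<mu> x) W}" by blast
qed

text \<open>Measurability need only be tested on an intersection-stable generator. On open sets the
  mass is lower semicontinuous in x, hence Borel.\<close>

lemma measurable_subprob: "\<mu> \<in> measurable (borel_of X) (subprob_algebra (borel_of Y))"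
proof (rule measurable_prob_algebraD, rule measurable_prob_algebra_generated[OF sets_borel_of])
  show "Int_stable {U. openin Y U}" by (auto simp: Int_stable_def)
  show "{U. openin Y U} \<subseteq> Pow (topspace Y)" by (auto dest: openin_subset)
  show "prob_space (\<mu> x)" "sets (\<mu> x) = sets (borel_of Y)" if "x \<in> space (borel_of X)" for x
    using that prob_meas[of x] by (auto simp: prob_meas_def)
  fix W assume "W \<in> {U. openin Y U}"
  then have W: "openin Y W" by simp
  have "(\<lambda>x. measure (\<mu> x) W) \<in> borel_measurable (borel_of X)"
    unfolding borel_measurable_iff_greater
    using openin_sets_borel_of[OF openin_measure_gt[OF W]] by simp
  then have "(\<lambda>x. ennreal (measure (\<mu> x) W)) \<in> borel_measurable (borel_of X)" by simp
  then show "(\<lambda>x. emeasure (\<mu> x) W) \<in> borel_measurable (borel_of X)"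
  proof (rule measurable_cong[THEN iffD1, rotated])
    fix x assume "x \<in> space (borel_of X)"
    then interpret prob_space "\<mu> x" using prob_meas[of x] by (simp add: prob_meas_def)
    show "ennreal (measure (\<mu> x) W) = emeasure (\<mu> x) W" by (simp add: emeasure_eq_measure)
  qed
qed

lemma measurable_subprob': "sets M = sets (borel_of X) \<Longrightarrow> \<mu> \<in> measurable M (subprob_algebra (borel_of Y))"
  using measurable_subprob by (simp add: measurable_cong_sets[OF _ refl, of M "borel_of X"])

text \<open>Lower semicontinuity and a finite subcover make inner approximation of \<open>U\<close> uniform over \<open>K\<close>.\<close>

lemma compact_uniform_inner:
  assumes K: "compactin X K" and U: "openin Y U" and gt: "\<And>x. x \<in> K \<Longrightarrow> c < measure (\<mu> x) U"
  obtains C where "closedin Y C" "C \<subseteq> U" "\<And>x. x \<in> K \<Longrightarrow> c < measure (\<mu> x) C"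
proof -
  have KX: "K \<subseteq> topspace X" using K compactin_subset_topspace by blast
  have "\<exists>W C. openin Y W \<and> closedin Y C \<and> W \<subseteq> C \<and> C \<subseteq> U \<and> c < measure (\<mu> x) W" if x: "x \<in> K" for x
  proof -
    have xX: "x \<in> topspace X" using x KX by blast
    interpret prob_space "\<mu> x" using prob_measD[OF prob_meas[OF xX]] by simp
    obtain D where D: "closedin Y D" "D \<subseteq> U" "measure (\<mu> x) U < measure (\<mu> x) D + (measure (\<mu> x) U - c)"
      using target.prob_meas_open_regular[OF prob_meas[OF xX]] U gt[OF x] unfolding open_regular_def
      by (metis diff_gt_0_iff_gt)
    \<comment> \<open>Normality puts an open set and its closure between D and U. The open W has the
      mass function to which lower semicontinuity applies; its closure becomes the closed set
      C.\<close>
    obtain W where W: "openin Y W" "D \<subseteq> W" "Y closure_of W \<subseteq> U"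
      using normal_space_alt[THEN iffD1, OF target.normal_X, rule_format, of D U] D U by auto
    have "W \<in> sets (\<mu> x)" using W prob_measD[OF prob_meas[OF xX]] by (simp add: openin_sets_borel_of)
    then have "measure (\<mu> x) D \<le> measure (\<mu> x) W" using W by (intro finite_measure_mono) auto
    moreover have "W \<subseteq> Y closure_of W" using W by (simp add: closure_of_subset openin_subset)
    ultimately show ?thesis using W D by (intro exI[of _ W] exI[of _ "Y closure_of W"]) auto
  qed
  then obtain W C where WC: "\<And>x. x \<in> K \<Longrightarrow> openin Y (W x)" "\<And>x. x \<in> K \<Longrightarrow> closedin Y (C x)"
    "\<And>x. x \<in> K \<Longrightarrow> W x \<subseteq> C x" "\<And>x. x \<in> K \<Longrightarrow> C x \<subseteq> U" "\<And>x. x \<in> K \<Longrightarrow> c < measure (\<mu> x) (W x)"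
    by metis
  define N where "N x = {x' \<in> topspace X. c < measure (\<mu> x') (W x)}" for x
  have "openin X V" if "V \<in> N ` K" for V
    using that WC(1) openin_measure_gt by (auto simp: N_def)
  moreover have "K \<subseteq> \<Union>(N ` K)"
    using WC(5) KX by (auto simp: N_def)
  ultimately have "\<exists>\<F>. finite \<F> \<and> \<F> \<subseteq> N ` K \<and> K \<subseteq> \<Union>\<F>"
    using compactinD[OF K] by blast
  then obtain J where J: "finite J" "J \<subseteq> K" "K \<subseteq> \<Union>(N ` J)" by (metis finite_subset_image)
  show thesis
  proof (rule that[of "\<Union>(C ` J)"])
    show "closedin Y (\<Union>(C ` J))" using J WC(2) by (intro closedin_Union) auto
    then have CU: "\<Union>(C ` J) \<in> sets (borel_of Y)" by (rule closedin_sets_borel_of)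
    show "\<Union>(C ` J) \<subseteq> U" using J WC(4) by blast
    fix x assume "x \<in> K"
    then obtain j where j: "j \<in> J" "x \<in> topspace X" "c < measure (\<mu> x) (W j)"
      using J unfolding N_def by blast
    interpret prob_space "\<mu> x" using prob_measD[OF prob_meas[OF j(2)]] by simp
    have "W j \<subseteq> \<Union>(C ` J)" using J j(1) WC(3) by blast
    then have "measure (\<mu> x) (W j) \<le> measure (\<mu> x) (\<Union>(C ` J))"
      using CU prob_measD[OF prob_meas[OF j(2)]] by (intro finite_measure_mono) auto
    with j show "c < measure (\<mu> x) (\<Union>(C ` J))" by simp
  qed
qed

end

text \<open>The sum counts the naturals below both m and t, so it is the smaller of m and the
  ceiling of t. This bound and the next one allow a nonnegative function to be replaced by a sum of
  indicators of its superlevel sets.\<close>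

lemma sum_of_bool_less_lower: "0 \<le> t \<Longrightarrow> min (real m) t \<le> (\<Sum>i<m. of_bool (real i < t))"
proof (induction m)
  case (Suc m)
  then show ?case by (cases "real m < t") (simp_all del: sum_of_bool_eq)
qed simp

lemma sum_of_bool_less_upper: "0 \<le> t \<Longrightarrow> (\<Sum>i<m. of_bool (real i < t)) \<le> min (real m) (t + 1)"
proof (induction m)
  case (Suc m)
  then show ?case by (cases "real m < t") (simp_all del: sum_of_bool_eq)
qed simp

section \<open>Mixtures of regular measures\<close>

locale stoch_map_bind = stoch_map Z Y \<nu> + Y: compact_hausdorff Y
  for Z :: "'z topology" and Y :: "'y topology" and \<nu> +
  fixes M :: "'y measure"
  assumes M: "M \<in> prob_meas Y"
begin

lemma measurable_M: "\<nu> \<in> measurable M (subprob_algebra (borel_of Z))"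
  using prob_measD(2)[OF M] by (rule measurable_subprob')

lemma space_nonempty: "space M \<noteq> {}"
  using prob_measD(1)[OF M] by (rule prob_space.not_empty)

lemma sets_bind_M: "sets (M \<bind> \<nu>) = sets (borel_of Z)"
  by (rule sets_bind_measurable[OF measurable_M space_nonempty])

lemma prob_space_bind_M: "prob_space (M \<bind> \<nu>)"
  using prob_measD[OF M] prob_meas
  by (intro prob_space.prob_space_bind[OF _ _ measurable_M]) (auto intro!: AE_I2 dest: prob_measD(1))

lemma measure_bind_M: "E \<in> sets (borel_of Z) \<Longrightarrow> measure (M \<bind> \<nu>) E = (LINT y|M. measure (\<nu> y) E)"
  using subprob_space.measure_bind[OF prob_space_imp_subprob_space[OF prob_measD(1)[OF M]] measurable_M] .

lemma integrable_kernel_measure: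
  assumes "E \<in> sets (borel_of Z)"
  shows "integrable M (\<lambda>y. measure (\<nu> y) E)"
proof -
  interpret prob_space M using M by (simp add: prob_meas_def)
  show ?thesis
  proof (rule integrable_const_bound[of _ 1])
    show "AE y in M. norm (measure (\<nu> y) E) \<le> 1"
      using prob_measD(3)[OF M] prob_meas by (auto intro!: AE_I2 dest: prob_measD(1) prob_space.prob_le_1)
    show "(\<lambda>y. measure (\<nu> y) E) \<in> borel_measurable M"
      using measure_measurable_subprob_algebra2[OF _ measurable_M] assms by simp
  qed
qed

text \<open>Inner regularity of the mixture on an open \<open>U\<close>: approximate the superlevel sets \<open>V i\<close> of the
  lower semicontinuous function \<open>y \<mapsto> \<nu> y U\<close> from inside by compact \<open>K i\<close>, and \<open>U\<close> uniformly
  over each \<open>K i\<close>.\<close>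

lemma bind_open_regular: "open_regular Z (M \<bind> \<nu>)"
  unfolding open_regular_def
proof (intro conjI allI impI prob_space_bind_M sets_bind_M)
  fix U and e :: real assume U: "openin Z U" and "0 < e"
  interpret prob_space M using M by (simp add: prob_meas_def)
  have sp: "space M = topspace Y" and sM: "sets M = sets (borel_of Y)" using prob_measD[OF M] by auto
  \<comment> \<open>Two losses occur below, each adding 1 to n times the mass of U: passing from V i
    to K i costs 1/n for each of n indices, and rounding up to a count of superlevel sets costs 1.
    In total this is 2/n.\<close>
  obtain n :: nat where n: "n \<noteq> 0" "inverse (real n) < e / 2"
    using \<open>0 < e\<close> real_arch_inverse[of "e / 2"] by auto
  have UZ: "U \<in> sets (borel_of Z)" using U by (rule openin_sets_borel_of)
  define V where "V i = {y \<in> topspace Y. real i / n < measure (\<nu> y) U}" for i :: nat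
  have V: "openin Y (V i)" for i unfolding V_def by (rule openin_measure_gt[OF U])
  have "\<exists>K. closedin Y K \<and> K \<subseteq> V i \<and> measure M (V i) < measure M K + 1 / n" for i
    using Y.prob_meas_open_regular[OF M] V n unfolding open_regular_def by auto
  then obtain K where K: "\<And>i. closedin Y (K i)" "\<And>i. K i \<subseteq> V i"
    "\<And>i. measure M (V i) < measure M (K i) + 1 / n" by metis
  have "\<exists>C. closedin Z C \<and> C \<subseteq> U \<and> (\<forall>y\<in>K i. real i / n < measure (\<nu> y) C)" for i
  proof -
    have Kc: "compactin Y (K i)" using K(1) Y.compact_X by (simp add: closedin_compact_space)
    have "real i / n < measure (\<nu> y) U" if "y \<in> K i" for y using that K(2)[of i] by (auto simp: V_def)
    from compact_uniform_inner[OF Kc U this] show ?thesis by metis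
  qed
  then obtain C where C: "\<And>i. closedin Z (C i)" "\<And>i. C i \<subseteq> U"
    "\<And>i y. y \<in> K i \<Longrightarrow> real i / n < measure (\<nu> y) (C i)" by metis
  \<comment> \<open>One closed set for all levels: enlarging C i to D keeps the lower bound i/n on K
    i, so on K i the value \<open>n * measure (\<nu> y) D\<close> exceeds i.\<close>
  define D where "D = (\<Union>i<n. C i)"
  have D: "closedin Z D" "D \<subseteq> U" unfolding D_def using C by (auto intro!: closedin_Union)
  have DZ: "D \<in> sets (borel_of Z)" using D by (intro closedin_sets_borel_of)
  have VM: "V i \<in> sets M" and KM: "K i \<in> sets M" for i
    using V K by (auto simp: sM intro: openin_sets_borel_of closedin_sets_borel_of)
  have integr: "integrable M (\<lambda>y. \<Sum>i<n. indicator (A i) y :: real)" if "\<And>i. A i \<in> sets M" for A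
    using that by (intro Bochner_Integration.integrable_sum integrable_real_indicator)
      (auto simp: emeasure_eq_measure)
  have int_sum: "(LINT y|M. (\<Sum>i<n. indicator (A i) y)) = (\<Sum>i<n. measure M (A i))"
    if A: "\<And>i. A i \<in> sets M" for A
  proof -
    have "(LINT y|M. (\<Sum>i<n. indicator (A i) y :: real)) = (\<Sum>i<n. (LINT y|M. indicator (A i) y))"
      using A by (intro Bochner_Integration.integral_sum integrable_real_indicator) (auto simp: emeasure_eq_measure)
    then show ?thesis using A by simp
  qed
  have \<nu>_bounds: "0 \<le> measure (\<nu> y) E" "measure (\<nu> y) E \<le> 1" if "y \<in> topspace Y" for y E
    using prob_space.prob_le_1[OF prob_measD(1)[OF prob_meas[OF that]]] by auto
  have "n * measure (M \<bind> \<nu>) U = (LINT y|M. n * measure (\<nu> y) U)"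
    by (simp add: measure_bind_M[OF UZ])
  also have "\<dots> \<le> (LINT y|M. (\<Sum>i<n. indicator (V i) y))"
  proof (rule integral_mono)
    show "integrable M (\<lambda>y. n * measure (\<nu> y) U)" using integrable_kernel_measure[OF UZ] by simp
    show "integrable M (\<lambda>y. \<Sum>i<n. indicator (V i) y :: real)" by (rule integr[OF VM])
    fix y assume "y \<in> space M"
    then have y: "y \<in> topspace Y" by (simp add: sp)
    have "n * measure (\<nu> y) U \<le> real n * 1" using \<nu>_bounds[OF y] by (intro mult_left_mono) auto
    then have "n * measure (\<nu> y) U \<le> (\<Sum>i<n. of_bool (real i < n * measure (\<nu> y) U))"
      using sum_of_bool_less_lower[of "n * measure (\<nu> y) U" n] by simp
    also have "\<dots> = (\<Sum>i<n. indicator (V i) y)"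
      using n y by (intro sum.cong) (auto simp: V_def indicator_def field_simps)
    finally show "n * measure (\<nu> y) U \<le> (\<Sum>i<n. indicator (V i) y)" .
  qed
  also have "\<dots> = (\<Sum>i<n. measure M (V i))" by (rule int_sum[OF VM])
  also have "\<dots> \<le> (\<Sum>i<n. measure M (K i) + 1 / n)" using K(3) by (intro sum_mono) (simp add: less_imp_le)
  also have "\<dots> = (LINT y|M. (\<Sum>i<n. indicator (K i) y)) + 1"
    using n by (simp add: int_sum[OF KM] sum.distrib)
  also have "(LINT y|M. (\<Sum>i<n. indicator (K i) y)) \<le> (LINT y|M. n * measure (\<nu> y) D + 1)"
  proof (rule integral_mono)
    show "integrable M (\<lambda>y. \<Sum>i<n. indicator (K i) y :: real)" by (rule integr[OF KM])
    show "integrable M (\<lambda>y. n * measure (\<nu> y) D + 1)" using integrable_kernel_measure[OF DZ] by simp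
    fix y assume "y \<in> space M"
    then have y: "y \<in> topspace Y" by (simp add: sp)
    interpret \<nu>y: prob_space "\<nu> y" using prob_measD(1)[OF prob_meas[OF y]] .
    have "(\<Sum>i<n. indicator (K i) y :: real) \<le> (\<Sum>i<n. of_bool (real i < n * measure (\<nu> y) D))"
    proof (rule sum_mono)
      fix i assume i: "i \<in> {..<n}"
      show "indicator (K i) y \<le> (of_bool (real i < n * measure (\<nu> y) D) :: real)"
      proof (cases "y \<in> K i")
        case True
        have *: "measure (\<nu> y) (C i) \<le> measure (\<nu> y) D"
          using i DZ prob_measD(2)[OF prob_meas[OF y]]
          by (intro \<nu>y.finite_measure_mono) (auto simp: D_def)
        have "real i < n * measure (\<nu> y) (C i)" using C(3)[OF True] n by (simp add: field_simps)
        also have "\<dots> \<le> n * measure (\<nu> y) D" using * by (intro mult_left_mono) auto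
        finally have "real i < n * measure (\<nu> y) D" .
        with True show ?thesis by simp
      qed simp
    qed
    also have "\<dots> \<le> n * measure (\<nu> y) D + 1"
      using sum_of_bool_less_upper[of "n * measure (\<nu> y) D" n] by simp
    finally show "(\<Sum>i<n. indicator (K i) y) \<le> n * measure (\<nu> y) D + 1" .
  qed
  also have "(LINT y|M. n * measure (\<nu> y) D + 1) = n * measure (M \<bind> \<nu>) D + 1"
    using integrable_kernel_measure[OF DZ] by (simp add: measure_bind_M[OF DZ] prob_space)
  finally have "measure (M \<bind> \<nu>) U \<le> measure (M \<bind> \<nu>) D + 2 * inverse n"
    using n by (simp add: field_simps)
  with n have "measure (M \<bind> \<nu>) U < measure (M \<bind> \<nu>) D + e" by simp
  with D show "\<exists>K. closedin Z K \<and> K \<subseteq> U \<and> measure (M \<bind> \<nu>) U < measure (M \<bind> \<nu>) K + e" by blast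
qed

lemma bind_prob_meas: "M \<bind> \<nu> \<in> prob_meas Z"
  by (rule target.open_regular_prob_meas[OF bind_open_regular])

lemma integral_bind_M:
  assumes \<phi>: "continuous_map Z euclideanreal \<phi>"
  shows "(LINT z|(M \<bind> \<nu>). \<phi> z) = (LINT y|M. (LINT z|\<nu> y. \<phi> z))"
proof -
  obtain B where "\<And>z. z \<in> topspace Z \<Longrightarrow> norm (\<phi> z) \<le> B"
    using compact_space_continuous_bounded[OF target.compact_X \<phi>] by blast
  then show ?thesis
    using prob_measD[OF M] prob_meas
    by (intro integral_bind[where K="borel_of Z" and B=B and B'=1] measurable_M continuous_map_borel_measurable \<phi>)
       (auto intro!: AE_I2 prob_space.emeasure_space_1[THEN eq_refl] prob_space.finite_measure
         prob_measD(1)[OF prob_meas])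
qed

end

lemma return_prob_meas:
  assumes "compact_space X" "Hausdorff_space X" and x: "x \<in> topspace X"
  shows "return (borel_of X) x \<in> prob_meas X"
proof -
  interpret compact_hausdorff X using assms by unfold_locales
  have ps: "prob_space (return (borel_of X) x)" using x by (intro prob_space_return) simp
  show ?thesis
  proof (rule open_regular_prob_meas, unfold open_regular_def, intro conjI allI impI)
    fix U and e :: real assume U: "openin X U" and e: "0 < e"
    show "\<exists>K. closedin X K \<and> K \<subseteq> U \<and>
      measure (return (borel_of X) x) U < measure (return (borel_of X) x) K + e"
    proof (cases "x \<in> U")
      case True
      have cl: "closedin X {x}" using closedin_Hausdorff_singleton[OF Hausdorff_X x] .
      with True U e show ?thesis
        by (intro exI[of _ "{x}"])
           (simp add: measure_return closedin_sets_borel_of openin_sets_borel_of)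
    next
      case False
      with U e show ?thesis
        by (intro exI[of _ "{}"]) (simp add: measure_return openin_sets_borel_of)
    qed
  qed (use ps in auto)
qed

section \<open>The laws of the category of stochastic maps\<close>

lemma stoch_map_of_stoch_maps:
  assumes "compact_space Y" "Hausdorff_space Y" "\<mu> \<in> stoch_maps X Y"
  shows "stoch_map Y X \<mu>"
  using assms by unfold_locales (auto simp: stoch_maps_iff)

lemma stoch_map_bind_of_stoch_maps:
  assumes "compact_space Y" "Hausdorff_space Y" "compact_space Z" "Hausdorff_space Z"
    "\<nu> \<in> stoch_maps Y Z" "M \<in> prob_meas Y"
  shows "stoch_map_bind Z Y \<nu> M"
proof -
  interpret stoch_map Z Y \<nu> using assms by (intro stoch_map_of_stoch_maps)
  show ?thesis using assms by unfold_locales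
qed

text \<open>\<open>measure_of\<close> returns the zero measure for a set function that is not
  countably additive. Agreement with \<open>emeasure\<close> of the bind supplies this additivity
  for the integral formula.\<close>

lemma stoch_comp_eq_bind:
  assumes Y: "compact_space Y" "Hausdorff_space Y" and Z: "compact_space Z" "Hausdorff_space Z"
    and \<mu>: "\<mu> \<in> stoch_maps X Y" and \<nu>: "\<nu> \<in> stoch_maps Y Z" and x: "x \<in> topspace X"
  shows "stoch_comp X Y Z \<nu> \<mu> x = \<mu> x \<bind> \<nu>"
proof -
  interpret stoch_map_bind Z Y \<nu> "\<mu> x"
    using stoch_maps_prob_meas[OF \<mu> x] by (rule stoch_map_bind_of_stoch_maps[OF Y Z \<nu>])
  have "stoch_comp X Y Z \<nu> \<mu> x =
      measure_of (topspace Z) (sets (borel_of Z)) (\<lambda>E. \<integral>\<^sup>+ y. emeasure (\<nu> y) E \<partial>\<mu> x)"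
    using x by (simp add: stoch_comp_def)
  also have "\<dots> = measure_of (topspace Z) (sets (borel_of Z)) (emeasure (\<mu> x \<bind> \<nu>))"
  proof (rule measure_of_eq)
    show "sets (borel_of Z) \<subseteq> Pow (topspace Z)" using sets.space_closed[of "borel_of Z"] by simp
    fix E assume "E \<in> sigma_sets (topspace Z) (sets (borel_of Z))"
    then have "E \<in> sets (borel_of Z)" using sets.sigma_sets_eq[of "borel_of Z"] by simp
    then show "(\<integral>\<^sup>+ y. emeasure (\<nu> y) E \<partial>\<mu> x) = emeasure (\<mu> x \<bind> \<nu>) E"
      by (rule emeasure_bind[OF space_nonempty measurable_M, symmetric])
  qed
  also have "\<dots> = \<mu> x \<bind> \<nu>"
    using measure_of_of_measure[of "\<mu> x \<bind> \<nu>"] sets_bind_M sets_eq_imp_space_eq[OF sets_bind_M] by simp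
  finally show ?thesis .
qed

text \<open>Continuity holds in two stages: integrating a test function on Z against \<nu> gives a
  continuous function on Y, which is then a test function for \<mu>.\<close>

lemma stoch_comp_in_stoch_maps:
  assumes Y: "compact_space Y" "Hausdorff_space Y" and Z: "compact_space Z" "Hausdorff_space Z"
    and \<mu>: "\<mu> \<in> stoch_maps X Y" and \<nu>: "\<nu> \<in> stoch_maps Y Z"
  shows "stoch_comp X Y Z \<nu> \<mu> \<in> stoch_maps X Z"
  unfolding stoch_maps_iff[OF Z(1)]
proof (intro conjI ballI allI impI)
  note bind = stoch_map_bind_of_stoch_maps[OF Y Z \<nu> stoch_maps_prob_meas[OF \<mu>]]
  show "stoch_comp X Y Z \<nu> \<mu> \<in> extensional (topspace X)" by (simp add: stoch_comp_def)
  show "stoch_comp X Y Z \<nu> \<mu> x \<in> prob_meas Z" if "x \<in> topspace X" for x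
    using stoch_map_bind.bind_prob_meas[OF bind[OF that]]
    by (simp add: stoch_comp_eq_bind[OF Y Z \<mu> \<nu> that])
  fix \<phi> assume \<phi>: "continuous_map Z euclideanreal \<phi>"
  have "continuous_map Y euclideanreal (\<lambda>y. LINT z|\<nu> y. \<phi> z)" using \<nu> \<phi> by (simp add: stoch_maps_iff Z)
  then have "continuous_map X euclideanreal (\<lambda>x. LINT y|\<mu> x. (LINT z|\<nu> y. \<phi> z))"
    using \<mu> by (simp add: stoch_maps_iff Y)
  then show "continuous_map X euclideanreal (\<lambda>x. LINT z|stoch_comp X Y Z \<nu> \<mu> x. \<phi> z)"
    by (rule continuous_map_eq)
       (simp add: stoch_comp_eq_bind[OF Y Z \<mu> \<nu>] stoch_map_bind.integral_bind_M[OF bind \<phi>])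
qed

lemma return_stoch_maps:
  assumes X: "compact_space X" "Hausdorff_space X"
  shows "(\<lambda>x\<in>topspace X. return (borel_of X) x) \<in> stoch_maps X X"
  unfolding stoch_maps_iff[OF X(1)]
proof (intro conjI ballI allI impI)
  fix \<phi> assume \<phi>: "continuous_map X euclideanreal \<phi>"
  then show "continuous_map X euclideanreal (\<lambda>x. LINT y|(\<lambda>x\<in>topspace X. return (borel_of X) x) x. \<phi> y)"
    by (rule continuous_map_eq) (simp add: integral_return continuous_map_borel_measurable[OF \<phi>])
qed (use return_prob_meas[OF X] in auto)

lemma category_cHausStoch: "category cHausStoch"
proof
  fix X :: "'a topology" assume "X \<in> Obj cHausStoch"
  then have X: "compact_space X" "Hausdorff_space X" by (auto simp: cHausStoch_def)
  from return_stoch_maps[OF X] show "Ident cHausStoch X \<in> Hom cHausStoch X X" by (simp add: cHausStoch_def)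
next
  fix X Y Z :: "'a topology" and \<mu> \<nu>
  assume "X \<in> Obj cHausStoch" "Y \<in> Obj cHausStoch" "Z \<in> Obj cHausStoch"
    "\<mu> \<in> Hom cHausStoch X Y" "\<nu> \<in> Hom cHausStoch Y Z"
  then show "Comp cHausStoch X Y Z \<nu> \<mu> \<in> Hom cHausStoch X Z"
    by (auto simp: cHausStoch_def intro: stoch_comp_in_stoch_maps)
next
  fix X Y :: "'a topology" and \<mu>
  assume "X \<in> Obj cHausStoch" "Y \<in> Obj cHausStoch" "\<mu> \<in> Hom cHausStoch X Y"
  then have X: "compact_space X" "Hausdorff_space X" and Y: "compact_space Y" "Hausdorff_space Y"
    and \<mu>: "\<mu> \<in> stoch_maps X Y" by (auto simp: cHausStoch_def)
  have ext_\<mu>: "\<mu> \<in> extensional (topspace X)" using \<mu> by (simp add: stoch_maps_def)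
  show "Comp cHausStoch X Y Y (Ident cHausStoch Y) \<mu> = \<mu>"
  proof (rule ext)
    fix x
    show "Comp cHausStoch X Y Y (Ident cHausStoch Y) \<mu> x = \<mu> x"
    proof (cases "x \<in> topspace X")
      case True
      have sp: "space (\<mu> x) = topspace Y" and se: "sets (\<mu> x) = sets (borel_of Y)"
        using prob_measD[OF stoch_maps_prob_meas[OF \<mu> True]] by auto
      have "stoch_comp X Y Y (\<lambda>x\<in>topspace Y. return (borel_of Y) x) \<mu> x
          = \<mu> x \<bind> (\<lambda>x\<in>topspace Y. return (borel_of Y) x)"
        by (rule stoch_comp_eq_bind[OF Y Y \<mu> return_stoch_maps[OF Y] True])
      also have "\<dots> = \<mu> x \<bind> return (borel_of Y)" by (rule bind_cong) (simp_all add: sp)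
      also have "\<dots> = \<mu> x" by (rule bind_return''[OF se])
      finally show ?thesis by (simp add: cHausStoch_def)
    next
      case False
      then show ?thesis by (simp add: cHausStoch_def stoch_comp_def extensional_arb[OF ext_\<mu> False])
    qed
  qed
  show "Comp cHausStoch X X Y \<mu> (Ident cHausStoch X) = \<mu>"
  proof (rule ext)
    fix x
    interpret stoch_map Y X \<mu> by (rule stoch_map_of_stoch_maps[OF Y \<mu>])
    show "Comp cHausStoch X X Y \<mu> (Ident cHausStoch X) x = \<mu> x"
    proof (cases "x \<in> topspace X")
      case True
      have "stoch_comp X X Y \<mu> (\<lambda>x\<in>topspace X. return (borel_of X) x) x = return (borel_of X) x \<bind> \<mu>"
        using True by (simp add: stoch_comp_eq_bind[OF X Y return_stoch_maps[OF X] \<mu> True])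
      also have "\<dots> = \<mu> x" using True by (intro bind_return[OF measurable_subprob]) simp
      finally show ?thesis by (simp add: cHausStoch_def)
    next
      case False
      then show ?thesis by (simp add: cHausStoch_def stoch_comp_def extensional_arb[OF ext_\<mu> False])
    qed
  qed
next
  fix X Y Z W :: "'a topology" and \<mu> \<nu> \<kappa>
  assume "X \<in> Obj cHausStoch" "Y \<in> Obj cHausStoch" "Z \<in> Obj cHausStoch" "W \<in> Obj cHausStoch"
    "\<mu> \<in> Hom cHausStoch X Y" "\<nu> \<in> Hom cHausStoch Y Z" "\<kappa> \<in> Hom cHausStoch Z W"
  then have Y: "compact_space Y" "Hausdorff_space Y"
    and Z: "compact_space Z" "Hausdorff_space Z" and W: "compact_space W" "Hausdorff_space W"
    and \<mu>: "\<mu> \<in> stoch_maps X Y" and \<nu>: "\<nu> \<in> stoch_maps Y Z" and \<kappa>: "\<kappa> \<in> stoch_maps Z W"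
    by (auto simp: cHausStoch_def)
  interpret \<kappa>: stoch_map W Z \<kappa> by (rule stoch_map_of_stoch_maps[OF W \<kappa>])
  have "stoch_comp X Y W (stoch_comp Y Z W \<kappa> \<nu>) \<mu> x = stoch_comp X Z W \<kappa> (stoch_comp X Y Z \<nu> \<mu>) x" for x
  proof (cases "x \<in> topspace X")
    case x: True
    interpret stoch_map_bind Z Y \<nu> "\<mu> x"
      by (rule stoch_map_bind_of_stoch_maps[OF Y Z \<nu> stoch_maps_prob_meas[OF \<mu> x]])
    have sp: "space (\<mu> x) = topspace Y" using prob_measD[OF stoch_maps_prob_meas[OF \<mu> x]] by simp
    have "stoch_comp X Y W (stoch_comp Y Z W \<kappa> \<nu>) \<mu> x = \<mu> x \<bind> stoch_comp Y Z W \<kappa> \<nu>"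
      by (rule stoch_comp_eq_bind[OF Y W \<mu> stoch_comp_in_stoch_maps[OF Z W \<nu> \<kappa>] x])
    also have "\<dots> = \<mu> x \<bind> (\<lambda>y. \<nu> y \<bind> \<kappa>)"
      by (rule bind_cong[OF refl]) (simp add: sp stoch_comp_eq_bind[OF Z W \<nu> \<kappa>])
    also have "\<dots> = (\<mu> x \<bind> \<nu>) \<bind> \<kappa>"
      by (rule bind_assoc[OF measurable_M \<kappa>.measurable_subprob, symmetric])
    also have "\<dots> = stoch_comp X Z W \<kappa> (stoch_comp X Y Z \<nu> \<mu>) x"
      by (simp add: stoch_comp_eq_bind[OF Z W stoch_comp_in_stoch_maps[OF Y Z \<mu> \<nu>] \<kappa> x]
          stoch_comp_eq_bind[OF Y Z \<mu> \<nu> x])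
    finally show ?thesis .
  qed (simp add: stoch_comp_def)
  then show "Comp cHausStoch X Y W (Comp cHausStoch Y Z W \<kappa> \<nu>) \<mu> =
      Comp cHausStoch X Z W \<kappa> (Comp cHausStoch X Y Z \<nu> \<mu>)"
    by (auto simp: cHausStoch_def)
qed

section \<open>Square roots in commutative C*-algebras\<close>

lemma complex_ring_simps [simp]:
  "carrier complex_ring = UNIV" "mult complex_ring = (*)" "one complex_ring = 1"
  "zero complex_ring = 0" "add complex_ring = (+)"
  by (simp_all add: complex_ring_def)

locale cstar = comm_cstar_algebra A for A :: "'a cstar" (structure)
begin

lemma smult_carrier: "x \<in> carrier A \<Longrightarrow> c \<odot> x \<in> carrier A"
  by (rule smult_closed) simp_all

lemma smult_add_left: "x \<in> carrier A \<Longrightarrow> (c + d) \<odot> x = c \<odot> x \<oplus> d \<odot> x"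
  using smult_l_distr[of c d x] by simp

lemma smult_add_right: "x \<in> carrier A \<Longrightarrow> y \<in> carrier A \<Longrightarrow> c \<odot> (x \<oplus> y) = c \<odot> x \<oplus> c \<odot> y"
  using smult_r_distr[of c x y] by simp

lemma smult_smult: "x \<in> carrier A \<Longrightarrow> c \<odot> (d \<odot> x) = (c * d) \<odot> x"
  using smult_assoc1[of c d x] by simp

lemma smult_1: "x \<in> carrier A \<Longrightarrow> 1 \<odot> x = x"
  using smult_one[of x] by simp

lemma smult_0: "x \<in> carrier A \<Longrightarrow> 0 \<odot> x = \<zero>"
  using smult_l_null[of x] by simp

lemma smult_mult: "x \<in> carrier A \<Longrightarrow> y \<in> carrier A \<Longrightarrow> (c \<odot> x) \<otimes> y = c \<odot> (x \<otimes> y)"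
  using smult_assoc2[of c x y] by simp

lemma mult_smult: "x \<in> carrier A \<Longrightarrow> y \<in> carrier A \<Longrightarrow> x \<otimes> (c \<odot> y) = c \<odot> (x \<otimes> y)"
  using smult_mult[of y x c] by (simp add: m_comm smult_carrier)

lemma neg_eq_smult: "x \<in> carrier A \<Longrightarrow> \<ominus> x = (-1) \<odot> x"
proof -
  assume x: "x \<in> carrier A"
  have "(-1) \<odot> x \<oplus> x = (-1) \<odot> x \<oplus> 1 \<odot> x" using x by (simp add: smult_1)
  also have "\<dots> = \<zero>" using smult_add_left[OF x, of "-1" 1] x by (simp add: smult_0)
  finally show ?thesis using x by (simp add: minus_equality smult_carrier)
qed

lemma neg_smult: "x \<in> carrier A \<Longrightarrow> \<ominus> (c \<odot> x) = (- c) \<odot> x"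
  by (simp add: neg_eq_smult smult_carrier smult_smult)

lemma diff_carrier: "x \<in> carrier A \<Longrightarrow> y \<in> carrier A \<Longrightarrow> x \<ominus> y \<in> carrier A"
  by simp

abbreviation scalar :: "complex \<Rightarrow> 'a" where "scalar c \<equiv> c \<odot> \<one>"

lemma scalar_carrier: "scalar c \<in> carrier A"
  by (simp add: smult_carrier)

lemma scalar_add: "scalar c \<oplus> scalar d = scalar (c + d)"
  by (simp add: smult_add_left)

lemma scalar_diff: "scalar c \<ominus> scalar d = scalar (c - d)"
  using scalar_add[of c "- d"] by (simp add: minus_eq neg_smult)

lemma scalar_mult: "x \<in> carrier A \<Longrightarrow> scalar c \<otimes> x = c \<odot> x"
  by (simp add: smult_mult)

lemma star_one: "star A \<one> = \<one>"
proof -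
  have "star A (star A \<one> \<otimes> \<one>) = star A \<one> \<otimes> star A (star A \<one>)"
    by (rule star_mult) (auto simp: star_closed)
  then show ?thesis by (simp add: star_closed star_star)
qed

lemma star_scalar: "star A (scalar c) = scalar (cnj c)"
  by (simp add: star_smult star_one)

lemma star_neg: "x \<in> carrier A \<Longrightarrow> star A (\<ominus> x) = \<ominus> star A x"
  by (simp add: neg_eq_smult star_smult star_closed)

lemma star_diff: "x \<in> carrier A \<Longrightarrow> y \<in> carrier A \<Longrightarrow> star A (x \<ominus> y) = star A x \<ominus> star A y"
  by (simp add: minus_eq star_add star_neg)

lemma star_mult': "x \<in> carrier A \<Longrightarrow> y \<in> carrier A \<Longrightarrow> star A (x \<otimes> y) = star A x \<otimes> star A y"
  by (simp add: star_mult m_comm star_closed)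

lemma anorm_neg: "x \<in> carrier A \<Longrightarrow> anorm A (\<ominus> x) = anorm A x"
  by (simp add: neg_eq_smult anorm_smult)

lemma anorm_zero: "anorm A \<zero> = 0"
  by (simp add: anorm_eq_0)

lemma anorm_diff_commute: "x \<in> carrier A \<Longrightarrow> y \<in> carrier A \<Longrightarrow> anorm A (x \<ominus> y) = anorm A (y \<ominus> x)"
  using anorm_neg[of "x \<ominus> y"] by (simp add: minus_eq minus_add add.m_comm)

lemma anorm_star_le: "x \<in> carrier A \<Longrightarrow> anorm A x \<le> anorm A (star A x)"
proof (cases "anorm A x = 0")
  case False
  assume x: "x \<in> carrier A"
  have "anorm A x * anorm A x \<le> anorm A (star A x) * anorm A x"
    using anorm_mult[of "star A x" x] cstar_identity[OF x] x by (simp add: star_closed power2_eq_square)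
  moreover have "0 < anorm A x" using False anorm_nonneg[OF x] by simp
  ultimately show ?thesis by simp
qed (simp add: anorm_nonneg star_closed)

lemma anorm_star: "x \<in> carrier A \<Longrightarrow> anorm A (star A x) = anorm A x"
  using anorm_star_le[of x] anorm_star_le[of "star A x"] by (simp add: star_closed star_star)

text \<open>By the C*-identity the norm of the unit equals its own square. The value 0 occurs in the
  zero algebra, so an inequality is stated.\<close>

lemma anorm_one_le: "anorm A \<one> \<le> 1"
proof -
  have "anorm A \<one> = (anorm A \<one>)\<^sup>2" using cstar_identity[of \<one>] by (simp add: star_one)
  then have "anorm A \<one> = 0 \<or> anorm A \<one> = 1" by (simp add: power2_eq_square)
  then show ?thesis by auto
qed

lemma diff_add_diff: "\<lbrakk>x \<in> carrier A; y \<in> carrier A; z \<in> carrier A\<rbrakk> \<Longrightarrow> (x \<ominus> y) \<oplus> (y \<ominus> z) = x \<ominus> z"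
  by algebra

lemma diff_eq_zero: "\<lbrakk>x \<in> carrier A; y \<in> carrier A\<rbrakk> \<Longrightarrow> x \<ominus> y = \<zero> \<longleftrightarrow> x = y"
proof
  assume x: "x \<in> carrier A" and y: "y \<in> carrier A" and "x \<ominus> y = \<zero>"
  have "x = (x \<ominus> y) \<oplus> y" using x y by algebra
  also have "\<dots> = y" using \<open>x \<ominus> y = \<zero>\<close> y by simp
  finally show "x = y" .
qed (simp add: minus_eq r_neg)

lemma Metric_space_alg_dist: "Metric_space (carrier A) (alg_dist A)"
proof
  fix x y z
  show "0 \<le> alg_dist A x y" by (simp add: alg_dist_def anorm_nonneg)
  show "alg_dist A x y = alg_dist A y x" by (simp add: alg_dist_def anorm_diff_commute)
  assume x: "x \<in> carrier A" and y: "y \<in> carrier A"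
  show "(alg_dist A x y = 0) = (x = y)" using x y by (simp add: alg_dist_def anorm_eq_0 diff_eq_zero)
  assume z: "z \<in> carrier A"
  show "alg_dist A x z \<le> alg_dist A x y + alg_dist A y z"
    using anorm_triangle[of "x \<ominus> y" "y \<ominus> z"] x y z by (simp add: alg_dist_def diff_add_diff)
qed

sublocale metric: Metric_space "carrier A" "alg_dist A"
  by (rule Metric_space_alg_dist)

definition selfadjoint :: "'a set" where
  "selfadjoint = {x \<in> carrier A. star A x = x}"

lemma selfadjointD: "x \<in> selfadjoint \<Longrightarrow> x \<in> carrier A" "x \<in> selfadjoint \<Longrightarrow> star A x = x"
  by (auto simp: selfadjoint_def)

lemma selfadjoint_add: "x \<in> selfadjoint \<Longrightarrow> y \<in> selfadjoint \<Longrightarrow> x \<oplus> y \<in> selfadjoint"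
  by (simp add: selfadjoint_def star_add)

lemma selfadjoint_mult: "x \<in> selfadjoint \<Longrightarrow> y \<in> selfadjoint \<Longrightarrow> x \<otimes> y \<in> selfadjoint"
  by (simp add: selfadjoint_def star_mult')

lemma selfadjoint_neg: "x \<in> selfadjoint \<Longrightarrow> \<ominus> x \<in> selfadjoint"
  by (simp add: selfadjoint_def star_neg)

lemma selfadjoint_diff: "x \<in> selfadjoint \<Longrightarrow> y \<in> selfadjoint \<Longrightarrow> x \<ominus> y \<in> selfadjoint"
  by (simp add: selfadjoint_def star_diff)

lemma selfadjoint_smult: "x \<in> selfadjoint \<Longrightarrow> complex_of_real r \<odot> x \<in> selfadjoint"
  by (simp add: selfadjoint_def star_smult smult_carrier)

lemma selfadjoint_scalar: "scalar (complex_of_real r) \<in> selfadjoint"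
  by (simp add: selfadjoint_def star_scalar smult_carrier)

definition real_scalar :: "real \<Rightarrow> 'a" where
  "real_scalar r = scalar (complex_of_real r)"

lemma real_scalar_carrier: "real_scalar r \<in> carrier A"
  by (simp add: real_scalar_def scalar_carrier)

lemma real_scalar_selfadjoint: "real_scalar r \<in> selfadjoint"
  by (simp add: real_scalar_def selfadjoint_scalar)

lemma real_scalar_add: "real_scalar r \<oplus> real_scalar s = real_scalar (r + s)"
  by (simp add: real_scalar_def scalar_add)

lemma real_scalar_diff: "real_scalar r \<ominus> real_scalar s = real_scalar (r - s)"
  by (simp add: real_scalar_def scalar_diff)

lemma real_scalar_mult: "x \<in> carrier A \<Longrightarrow> real_scalar r \<otimes> x = complex_of_real r \<odot> x"
  by (simp add: real_scalar_def scalar_mult)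

lemma real_scalar_smult: "complex_of_real r \<odot> real_scalar s = real_scalar (r * s)"
  by (simp add: real_scalar_def smult_smult)

lemma real_scalar_1: "real_scalar 1 = \<one>"
  by (simp add: real_scalar_def smult_1)

lemma real_scalar_0: "real_scalar 0 = \<zero>"
  by (simp add: real_scalar_def smult_0)

lemma neg_real_scalar: "\<ominus> real_scalar r = real_scalar (- r)"
  by (simp add: real_scalar_def neg_smult)

lemma selfadjoint_one: "\<one> \<in> selfadjoint"
  by (simp add: selfadjoint_def star_one)

lemma selfadjoint_star_mult: "x \<in> carrier A \<Longrightarrow> star A x \<otimes> x \<in> selfadjoint"
  by (simp add: selfadjoint_def star_mult star_star star_closed)

text \<open>The fixed point \<open>x\<close> of the contraction \<open>x \<mapsto> (h + x\<^sup>2) / 2\<close> satisfies \<open>(1 - x)\<^sup>2 = 1 - h\<close>.\<close>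

lemma square_root_one_minus:
  assumes h: "h \<in> selfadjoint" and small: "anorm A h < 1"
  obtains y where "y \<in> selfadjoint" "star A y \<otimes> y = \<one> \<ominus> h"
proof -
  define q where "q = anorm A h"
  have hc: "h \<in> carrier A" using h by (rule selfadjointD)
  have q: "0 \<le> q" "q < 1" using anorm_nonneg[OF hc] small by (auto simp: q_def)
  define F where "F x = complex_of_real (1/2) \<odot> (h \<oplus> x \<otimes> x)" for x
  have F_carrier: "F x \<in> carrier A" if "x \<in> carrier A" for x
    using that hc by (simp add: F_def smult_carrier)
  have F_diff: "F x \<ominus> F y = complex_of_real (1/2) \<odot> ((x \<ominus> y) \<otimes> (x \<oplus> y))"
    if "x \<in> carrier A" "y \<in> carrier A" for x y
  proof -
    have "F x \<ominus> F y = complex_of_real (1/2) \<odot> ((h \<oplus> x \<otimes> x) \<ominus> (h \<oplus> y \<otimes> y))"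
      using that hc by (simp add: F_def minus_eq smult_add_right neg_eq_smult smult_carrier smult_smult)
    also have "(h \<oplus> x \<otimes> x) \<ominus> (h \<oplus> y \<otimes> y) = (x \<ominus> y) \<otimes> (x \<oplus> y)" using that hc by algebra
    finally show ?thesis .
  qed
  have F_contr: "anorm A (F x \<ominus> F y) \<le> (1/2) * (anorm A (x \<ominus> y) * (anorm A x + anorm A y))"
    if x: "x \<in> carrier A" and y: "y \<in> carrier A" for x y
  proof -
    have "anorm A (F x \<ominus> F y) = (1/2) * anorm A ((x \<ominus> y) \<otimes> (x \<oplus> y))"
      unfolding F_diff[OF x y] using x y by (subst anorm_smult) auto
    also have "anorm A ((x \<ominus> y) \<otimes> (x \<oplus> y)) \<le> anorm A (x \<ominus> y) * anorm A (x \<oplus> y)"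
      using x y by (intro anorm_mult) auto
    also have "\<dots> \<le> anorm A (x \<ominus> y) * (anorm A x + anorm A y)"
      using x y by (intro mult_left_mono anorm_triangle anorm_nonneg) auto
    finally show ?thesis by simp
  qed
  define s where "s n = (F ^^ n) \<zero>" for n
  have s_Suc: "s (Suc n) = F (s n)" for n by (simp add: s_def)
  have s_carrier: "s n \<in> carrier A" for n
    by (induction n) (simp_all add: s_Suc F_carrier, simp add: s_def)
  have s_star: "star A (s n) = s n" for n
  proof (induction n)
    case 0
    have "star A \<zero> = \<zero>" using star_smult[of \<one> 0] by (simp add: smult_0 star_closed)
    then show ?case by (simp add: s_def)
  next
    case (Suc n)
    then show ?case using s_carrier[of n] h
      by (simp add: s_Suc F_def star_smult star_add star_mult selfadjointD hc)
  qed
  \<comment> \<open>The iterates never leave the ball of radius q, since (q + q^2)/2 is at most q.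
    On this ball \<open>F_contr\<close> gives the Lipschitz factor (q + q)/2 = q, which is below
    1.\<close>
  have s_norm: "anorm A (s n) \<le> q" for n
  proof (induction n)
    case 0 then show ?case using q by (simp add: s_def anorm_zero)
  next
    case (Suc n)
    have "anorm A (s (Suc n)) = (1/2) * anorm A (h \<oplus> s n \<otimes> s n)"
      unfolding s_Suc F_def using s_carrier[of n] hc by (subst anorm_smult) auto
    also have "anorm A (h \<oplus> s n \<otimes> s n) \<le> anorm A h + anorm A (s n \<otimes> s n)"
      using s_carrier[of n] hc by (intro anorm_triangle) auto
    also have "anorm A (s n \<otimes> s n) \<le> anorm A (s n) * anorm A (s n)"
      using s_carrier[of n] by (intro anorm_mult)
    also have "\<dots> \<le> q * 1"
      using Suc q anorm_nonneg[OF s_carrier[of n]] by (intro mult_mono) auto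
    finally show ?case by (simp add: q_def)
  qed
  have s_step: "anorm A (s (Suc n) \<ominus> s n) \<le> q ^ n" for n
  proof (induction n)
    case 0
    have "s (Suc 0) \<ominus> s 0 = s (Suc 0)" using s_carrier[of "Suc 0"] by (simp add: s_def minus_eq)
    then show ?case using s_norm[of "Suc 0"] q by simp
  next
    case (Suc n)
    have "anorm A (s (Suc (Suc n)) \<ominus> s (Suc n)) \<le>
        (1/2) * (anorm A (s (Suc n) \<ominus> s n) * (anorm A (s (Suc n)) + anorm A (s n)))"
      unfolding s_Suc[of "Suc n"] s_Suc[of n] by (intro F_contr F_carrier s_carrier)
    also have "\<dots> \<le> (1/2) * (q ^ n * (q + q))"
      using Suc q s_norm s_carrier by (intro mult_left_mono mult_mono add_mono anorm_nonneg add_nonneg_nonneg) auto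
    finally show ?case by (simp add: mult.commute)
  qed
  have s_dist: "anorm A (s (m + k) \<ominus> s m) \<le> q ^ m * (\<Sum>i<k. q ^ i)" for m k
  proof (induction k)
    case 0 then show ?case using s_carrier[of m] by (simp add: anorm_zero minus_eq r_neg)
  next
    case (Suc k)
    have "s (m + Suc k) \<ominus> s m = (s (Suc (m + k)) \<ominus> s (m + k)) \<oplus> (s (m + k) \<ominus> s m)"
      using diff_add_diff[OF s_carrier s_carrier s_carrier] by simp
    then have "anorm A (s (m + Suc k) \<ominus> s m) \<le> anorm A (s (Suc (m + k)) \<ominus> s (m + k)) + anorm A (s (m + k) \<ominus> s m)"
      using anorm_triangle[of "s (Suc (m + k)) \<ominus> s (m + k)" "s (m + k) \<ominus> s m"] s_carrier by simp
    with Suc s_step[of "m + k"] show ?case by (simp add: power_add algebra_simps)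
  qed
  have s_tail: "anorm A (s n \<ominus> s m) \<le> q ^ m / (1 - q)" if "m \<le> n" for m n
  proof -
    have "(\<Sum>i<n - m. q ^ i) = (1 - q ^ (n - m)) / (1 - q)"
      using q sum_gp_strict[of q "n - m"] by simp
    also have "\<dots> \<le> 1 / (1 - q)" using q by (intro divide_right_mono) auto
    finally have "q ^ m * (\<Sum>i<n - m. q ^ i) \<le> q ^ m * (1 / (1 - q))"
      using q by (intro mult_left_mono) auto
    with s_dist[of m "n - m"] that show ?thesis by simp
  qed
  have "metric.MCauchy s"
    unfolding metric.MCauchy_def
  proof (intro conjI allI impI)
    show "range s \<subseteq> carrier A" using s_carrier by auto
    fix e :: real assume e: "0 < e"
    have "(\<lambda>m. q ^ m / (1 - q)) \<longlonglongrightarrow> 0 / (1 - q)"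
      using q by (intro tendsto_divide LIMSEQ_power_zero) auto
    then have "eventually (\<lambda>m. q ^ m / (1 - q) < e) sequentially"
      using e by (intro order_tendstoD) auto
    then obtain N where N: "\<And>m. N \<le> m \<Longrightarrow> q ^ m / (1 - q) < e"
      by (auto simp: eventually_sequentially)
    have "alg_dist A (s n) (s n') < e" if "N \<le> n" "N \<le> n'" for n n'
    proof (cases "n \<le> n'")
      case True
      with s_tail[OF True] N[OF that(1)] show ?thesis
        using anorm_diff_commute[OF s_carrier s_carrier, of n n'] s_carrier by (simp add: alg_dist_def)
    next
      case False
      with s_tail[of n' n] N[OF that(2)] show ?thesis using s_carrier by (simp add: alg_dist_def)
    qed
    then show "\<exists>N. \<forall>n n'. N \<le> n \<longrightarrow> N \<le> n' \<longrightarrow> alg_dist A (s n) (s n') < e" by blast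
  qed
  then obtain x where lim: "limitin metric.mtopology s x sequentially"
    using complete unfolding metric.mcomplete_def by blast
  have x: "x \<in> carrier A" using lim by (simp add: metric.limitin_metric)
  have lim': "(\<lambda>n. anorm A (x \<ominus> s n)) \<longlonglongrightarrow> 0"
  proof (rule LIMSEQ_I)
    fix r :: real assume "0 < r"
    then have "\<forall>\<^sub>F n in sequentially. s n \<in> carrier A \<and> alg_dist A (s n) x < r"
      using lim by (simp add: metric.limitin_metric)
    then obtain N where "\<And>n. N \<le> n \<Longrightarrow> alg_dist A (s n) x < r" by (auto simp: eventually_sequentially)
    then have "\<forall>n\<ge>N. norm (anorm A (x \<ominus> s n) - 0) < r"
      using x s_carrier by (simp add: alg_dist_def anorm_diff_commute[OF x s_carrier] anorm_nonneg)
    then show "\<exists>N. \<forall>n\<ge>N. norm (anorm A (x \<ominus> s n) - 0) < r" by blast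
  qed
  have "star A x = x"
  proof -
    have "anorm A (star A x \<ominus> x) \<le> anorm A (x \<ominus> s n) + anorm A (x \<ominus> s n)" for n
    proof -
      have "star A x \<ominus> s n = star A (x \<ominus> s n)" using x s_carrier[of n] by (simp add: star_diff s_star)
      then have "anorm A (star A x \<ominus> s n) = anorm A (x \<ominus> s n)" using x s_carrier[of n] by (simp add: anorm_star)
      then show ?thesis
        using anorm_triangle[of "star A x \<ominus> s n" "s n \<ominus> x"] x s_carrier[of n]
        by (simp add: star_closed diff_add_diff anorm_diff_commute[OF x s_carrier[of n]])
    qed
    then have "anorm A (star A x \<ominus> x) \<le> 0"
      using LIMSEQ_le_const[OF tendsto_add[OF lim' lim']] by fastforce
    then have "anorm A (star A x \<ominus> x) = 0" using x anorm_nonneg[of "star A x \<ominus> x"] by (simp add: star_closed)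
    then show ?thesis using x by (simp add: star_closed anorm_eq_0 diff_eq_zero)
  qed
  with x have x_sa: "x \<in> selfadjoint" by (simp add: selfadjoint_def)
  have fix_point: "F x = x"
  proof (rule ccontr)
    assume "F x \<noteq> x"
    then have pos: "0 < anorm A (F x \<ominus> x)"
      using x anorm_nonneg[of "F x \<ominus> x"] anorm_eq_0[of "F x \<ominus> x"]
      by (simp add: F_carrier diff_eq_zero less_le)
    \<comment> \<open>The norm of the limit x is not estimated by q here. The factor
      \<open>anorm A x + q\<close> does not depend on n, and that is enough for the right-hand side
      to tend to 0.\<close>
    have bound: "anorm A (F x \<ominus> x) \<le> (anorm A x + q) * anorm A (x \<ominus> s n) + q ^ n + anorm A (x \<ominus> s n)" for n
    proof -
      have "anorm A (F x \<ominus> x) \<le> anorm A (F x \<ominus> s (Suc n)) + anorm A (s (Suc n) \<ominus> x)"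
        using anorm_triangle[of "F x \<ominus> s (Suc n)" "s (Suc n) \<ominus> x"] x s_carrier[of "Suc n"]
        by (simp add: F_carrier diff_add_diff)
      moreover have "anorm A (s (Suc n) \<ominus> x) \<le> anorm A (s (Suc n) \<ominus> s n) + anorm A (s n \<ominus> x)"
        using anorm_triangle[of "s (Suc n) \<ominus> s n" "s n \<ominus> x"] x s_carrier[of "Suc n"] s_carrier[of n]
        by (simp add: diff_add_diff)
      moreover have "anorm A (F x \<ominus> s (Suc n)) \<le> (1/2) * (anorm A (x \<ominus> s n) * (anorm A x + anorm A (s n)))"
        unfolding s_Suc by (rule F_contr[OF x s_carrier])
      moreover have "anorm A (x \<ominus> s n) * (anorm A x + anorm A (s n)) \<le> anorm A (x \<ominus> s n) * (anorm A x + q)"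
        using x s_carrier[of n] s_norm[of n] by (intro mult_left_mono anorm_nonneg) auto
      moreover have "0 \<le> anorm A (x \<ominus> s n) * (anorm A x + q)"
        using x s_carrier[of n] q by (intro mult_nonneg_nonneg add_nonneg_nonneg anorm_nonneg) auto
      ultimately show ?thesis
        using s_step[of n] anorm_diff_commute[OF x s_carrier[of n]] by (simp add: mult.commute)
    qed
    have "(\<lambda>n. (anorm A x + q) * anorm A (x \<ominus> s n) + q ^ n + anorm A (x \<ominus> s n)) \<longlonglongrightarrow> (anorm A x + q) * 0 + 0 + 0"
      using q by (intro tendsto_add tendsto_mult tendsto_const lim' LIMSEQ_power_zero) auto
    then have "anorm A (F x \<ominus> x) \<le> (anorm A x + q) * 0 + 0 + 0"
      by (rule LIMSEQ_le_const) (use bound in blast)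
    with pos show False by simp
  qed
  have two: "x \<oplus> x = h \<oplus> x \<otimes> x"
  proof -
    have "x \<oplus> x = 2 \<odot> F x" using smult_add_left[OF x, of 1 1] x by (simp add: fix_point smult_1)
    also have "\<dots> = h \<oplus> x \<otimes> x" using x hc by (simp add: F_def smult_smult smult_1)
    finally show ?thesis .
  qed
  show thesis
  proof (rule that)
    show sa: "\<one> \<ominus> x \<in> selfadjoint" by (rule selfadjoint_diff[OF selfadjoint_one x_sa])
    have "(\<one> \<ominus> x) \<otimes> (\<one> \<ominus> x) = (\<one> \<oplus> x \<otimes> x) \<ominus> (x \<oplus> x)" using x by algebra
    also have "\<dots> = \<one> \<ominus> h" unfolding two using x hc by algebra
    finally show "star A (\<one> \<ominus> x) \<otimes> (\<one> \<ominus> x) = \<one> \<ominus> h" using selfadjointD(2)[OF sa] by simp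
  qed
qed

end

section \<open>Sums of squares and characters\<close>

context cstar
begin

inductive_set squares_cone :: "'a set" where
  square: "a \<in> carrier A \<Longrightarrow> star A a \<otimes> a \<in> squares_cone"
| add: "s \<in> squares_cone \<Longrightarrow> t \<in> squares_cone \<Longrightarrow> s \<oplus> t \<in> squares_cone"

text \<open>Preorderings in the sense of real algebra, on the real ring of self-adjoint elements; properness,
  i.e. \<open>-1\<close> not being a member, is stated separately.\<close>

definition preordering :: "'a set \<Rightarrow> bool" where
  "preordering M \<longleftrightarrow> M \<subseteq> selfadjoint \<and> (\<forall>a\<in>carrier A. star A a \<otimes> a \<in> M) \<and>
    (\<forall>s\<in>M. \<forall>t\<in>M. s \<oplus> t \<in> M) \<and> (\<forall>s\<in>M. \<forall>t\<in>M. s \<otimes> t \<in> M)"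

lemma preorderingD:
  assumes "preordering M"
  shows "s \<in> M \<Longrightarrow> s \<in> selfadjoint" "s \<in> M \<Longrightarrow> s \<in> carrier A" "a \<in> carrier A \<Longrightarrow> star A a \<otimes> a \<in> M"
    "\<lbrakk>s \<in> M; t \<in> M\<rbrakk> \<Longrightarrow> s \<oplus> t \<in> M" "\<lbrakk>s \<in> M; t \<in> M\<rbrakk> \<Longrightarrow> s \<otimes> t \<in> M"
  using assms by (auto simp: preordering_def selfadjoint_def)

lemma squares_cone_selfadjoint: "t \<in> squares_cone \<Longrightarrow> t \<in> selfadjoint"
  by (induction rule: squares_cone.induct) (auto intro: selfadjoint_star_mult selfadjoint_add)

lemma squares_cone_carrier: "t \<in> squares_cone \<Longrightarrow> t \<in> carrier A"
  using squares_cone_selfadjoint selfadjointD by blast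

text \<open>Commutativity turns a product of two squares into the square of
  \<open>a \<otimes> b\<close>; sums follow by distributivity.\<close>

lemma squares_cone_mult:
  assumes "s \<in> squares_cone" "t \<in> squares_cone"
  shows "s \<otimes> t \<in> squares_cone"
  using assms(1)
proof (induction rule: squares_cone.induct)
  case (square a)
  from assms(2) show ?case
  proof (induction rule: squares_cone.induct)
    case (square b)
    have "star A (a \<otimes> b) \<otimes> (a \<otimes> b) = (star A a \<otimes> a) \<otimes> (star A b \<otimes> b)"
      using \<open>a \<in> carrier A\<close> square by (simp add: star_mult' star_closed m_ac)
    with \<open>a \<in> carrier A\<close> square show ?case by (metis squares_cone.square m_closed)
  next
    case (add u v)
    then show ?case using \<open>a \<in> carrier A\<close>
      by (simp add: r_distr squares_cone_carrier star_closed squares_cone.add)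
  qed
next
  case (add u v)
  then show ?case using assms(2) by (simp add: l_distr squares_cone_carrier squares_cone.add)
qed

lemma preordering_squares_cone: "preordering squares_cone"
  unfolding preordering_def
  using squares_cone_selfadjoint squares_cone.intros squares_cone_mult by blast

lemma squares_cone_subset: "preordering M \<Longrightarrow> squares_cone \<subseteq> M"
proof
  fix t assume M: "preordering M" and "t \<in> squares_cone"
  from this(2) show "t \<in> M" by (induction rule: squares_cone.induct) (auto intro: preorderingD[OF M])
qed

lemma preordering_scalar:
  assumes M: "preordering M" and r: "0 \<le> r"
  shows "real_scalar r \<in> M"
proof -
  have "star A (scalar (complex_of_real (sqrt r))) \<otimes> scalar (complex_of_real (sqrt r)) = scalar (complex_of_real r)"
    using r by (simp add: star_scalar scalar_mult smult_carrier smult_smult flip: of_real_mult)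
  then show ?thesis unfolding real_scalar_def using preorderingD(3)[OF M scalar_carrier] by metis
qed

lemma preordering_smult:
  assumes M: "preordering M" and "0 \<le> r" "s \<in> M"
  shows "complex_of_real r \<odot> s \<in> M"
  using preorderingD(5)[OF M preordering_scalar[OF M assms(2)] assms(3)] preorderingD(2)[OF M assms(3)]
  by (simp add: real_scalar_mult)

text \<open>h/N has norm below 1, so 1 - h/N is a square by \<open>square_root_one_minus\<close>;
  multiplication by N keeps it in the cone.\<close>

lemma squares_cone_archimedean:
  assumes h: "h \<in> selfadjoint" and N: "anorm A h < N"
  shows "real_scalar N \<ominus> h \<in> squares_cone"
proof -
  have hc: "h \<in> carrier A" using h by (rule selfadjointD)
  have N0: "0 < N" using N anorm_nonneg[OF hc] by simp
  let ?g = "complex_of_real (1 / N) \<odot> h"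
  have "anorm A ?g = anorm A h / N" using N0 by (simp add: anorm_smult[OF hc] del: of_real_divide)
  then have "anorm A ?g < 1" using N N0 by simp
  then obtain y where y: "y \<in> selfadjoint" "star A y \<otimes> y = \<one> \<ominus> ?g"
    using square_root_one_minus[OF selfadjoint_smult[OF h]] by metis
  have "complex_of_real N \<odot> (\<one> \<ominus> ?g) = real_scalar N \<ominus> h"
    unfolding real_scalar_def using N0 hc by (simp add: minus_eq smult_add_right neg_smult smult_carrier smult_smult)
      (simp add: neg_eq_smult)
  moreover have "complex_of_real N \<odot> (\<one> \<ominus> ?g) \<in> squares_cone"
    using squares_cone.square[OF selfadjointD(1)[OF y(1)]] N0 y
    by (intro preordering_smult[OF preordering_squares_cone]) auto
  ultimately show ?thesis by simp
qed

lemma selfadjoint_bounded: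
  assumes h: "h \<in> selfadjoint"
  obtains N where "0 < N" "real_scalar N \<ominus> h \<in> squares_cone"
    "real_scalar N \<oplus> h \<in> squares_cone"
proof
  have hc: "h \<in> carrier A" using h by (rule selfadjointD)
  show "0 < anorm A h + 1" using anorm_nonneg[OF hc] by simp
  show "real_scalar (anorm A h + 1) \<ominus> h \<in> squares_cone"
    by (rule squares_cone_archimedean[OF h]) simp
  have "real_scalar (anorm A h + 1) \<ominus> (\<ominus> h) \<in> squares_cone"
    by (rule squares_cone_archimedean[OF selfadjoint_neg[OF h]]) (simp add: anorm_neg hc)
  then show "real_scalar (anorm A h + 1) \<oplus> h \<in> squares_cone"
    using hc by (simp add: minus_eq)
qed

text \<open>The preordering generated by M and a. Terms linear in a suffice: a is self-adjoint, so
  \<open>a \<otimes> a\<close> is a square in M and the quadratic term of a product is absorbed into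
  the part without a.\<close>

lemma preordering_extend:
  assumes M: "preordering M" and a: "a \<in> selfadjoint"
  shows "preordering {m \<oplus> a \<otimes> n | m n. m \<in> M \<and> n \<in> M}" (is "preordering ?E")
    and "M \<subseteq> {m \<oplus> a \<otimes> n | m n. m \<in> M \<and> n \<in> M}"
    and "a \<in> {m \<oplus> a \<otimes> n | m n. m \<in> M \<and> n \<in> M}"
proof -
  note D = preorderingD[OF M]
  have ac: "a \<in> carrier A" using a by (rule selfadjointD)
  have zero: "\<zero> \<in> M" using preordering_scalar[OF M, of 0] by (simp add: real_scalar_0)
  have one: "\<one> \<in> M" using preordering_scalar[OF M, of 1] by (simp add: real_scalar_1)
  show sub: "M \<subseteq> ?E"
  proof
    fix m assume m: "m \<in> M"
    then have "m = m \<oplus> a \<otimes> \<zero>" using ac D(2) by simp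
    with m zero show "m \<in> ?E" by blast
  qed
  have "a = \<zero> \<oplus> a \<otimes> \<one>" using ac by simp
  with zero one show "a \<in> ?E" by blast
  have aa: "a \<otimes> a \<in> M" using D(3)[OF ac] selfadjointD(2)[OF a] by simp
  show "preordering ?E"
    unfolding preordering_def
  proof (intro conjI ballI)
    show "?E \<subseteq> selfadjoint" using a D(1) by (auto intro!: selfadjoint_add selfadjoint_mult)
    show "star A x \<otimes> x \<in> ?E" if "x \<in> carrier A" for x using sub D(3)[OF that] by blast
    fix s t assume "s \<in> ?E" "t \<in> ?E"
    then obtain m n m' n' where mn: "m \<in> M" "n \<in> M" "m' \<in> M" "n' \<in> M"
      and s: "s = m \<oplus> a \<otimes> n" and t: "t = m' \<oplus> a \<otimes> n'" by blast
    note c = D(2)[OF mn(1)] D(2)[OF mn(2)] D(2)[OF mn(3)] D(2)[OF mn(4)]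
    have "s \<oplus> t = (m \<oplus> m') \<oplus> a \<otimes> (n \<oplus> n')" unfolding s t using c ac by algebra
    with mn show "s \<oplus> t \<in> ?E" using D(4) by blast
    have "s \<otimes> t = (m \<otimes> m' \<oplus> (a \<otimes> a) \<otimes> (n \<otimes> n')) \<oplus> a \<otimes> (m \<otimes> n' \<oplus> m' \<otimes> n)"
      unfolding s t using c ac by algebra
    moreover have "m \<otimes> m' \<oplus> (a \<otimes> a) \<otimes> (n \<otimes> n') \<in> M" "m \<otimes> n' \<oplus> m' \<otimes> n \<in> M"
      using mn aa by (auto intro!: D(4,5))
    ultimately show "s \<otimes> t \<in> ?E" by blast
  qed
qed

lemma preordering_maximal:
  assumes M0: "preordering M0" "\<ominus> \<one> \<notin> M0"
  obtains M where "preordering M" "\<ominus> \<one> \<notin> M" "M0 \<subseteq> M"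
    "\<And>a. a \<in> selfadjoint \<Longrightarrow> a \<in> M \<or> \<ominus> a \<in> M"
proof -
  define \<M> where "\<M> = {M. preordering M \<and> \<ominus> \<one> \<notin> M \<and> M0 \<subseteq> M}"
  have "\<exists>M\<in>\<M>. \<forall>X\<in>\<M>. M \<subseteq> X \<longrightarrow> X = M"
  proof (rule subset_Zorn_nonempty)
    show "\<M> \<noteq> {}" using M0 by (auto simp: \<M>_def)
    fix \<C> assume ne: "\<C> \<noteq> {}" and chain: "subset.chain \<M> \<C>"
    have in_M: "X \<in> \<M>" if "X \<in> \<C>" for X using that chain by (auto simp: subset_chain_def)
    have pre: "preordering X" if "X \<in> \<C>" for X using in_M[OF that] by (simp add: \<M>_def)
    have pick: "\<exists>X. X \<in> \<C>" using ne by blast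
    have common: "\<exists>X\<in>\<C>. s \<in> X \<and> t \<in> X" if "s \<in> \<Union>\<C>" "t \<in> \<Union>\<C>" for s t
    proof -
      from that obtain X Y where XY: "X \<in> \<C>" "Y \<in> \<C>" "s \<in> X" "t \<in> Y" by blast
      then have "X \<subseteq> Y \<or> Y \<subseteq> X" using chain by (auto simp: subset_chain_def)
      with XY show ?thesis by blast
    qed
    have "preordering (\<Union>\<C>)"
      unfolding preordering_def
    proof (intro conjI ballI)
      show "\<Union>\<C> \<subseteq> selfadjoint" using preorderingD(1)[OF pre] by (meson Union_iff subsetI)
      show "star A a \<otimes> a \<in> \<Union>\<C>" if "a \<in> carrier A" for a
        using pick preorderingD(3)[OF pre that] by (meson UnionI)
      show "s \<oplus> t \<in> \<Union>\<C>" if "s \<in> \<Union>\<C>" "t \<in> \<Union>\<C>" for s t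
        using common[OF that] preorderingD(4)[OF pre] by (meson UnionI)
      show "s \<otimes> t \<in> \<Union>\<C>" if "s \<in> \<Union>\<C>" "t \<in> \<Union>\<C>" for s t
        using common[OF that] preorderingD(5)[OF pre] by (meson UnionI)
    qed
    moreover have "\<ominus> \<one> \<notin> \<Union>\<C>" using in_M by (auto simp: \<M>_def)
    moreover have "M0 \<subseteq> \<Union>\<C>" using pick in_M unfolding \<M>_def by blast
    ultimately show "\<Union>\<C> \<in> \<M>" by (simp add: \<M>_def)
  qed
  then obtain M where M: "M \<in> \<M>" and max: "\<And>X. X \<in> \<M> \<Longrightarrow> M \<subseteq> X \<Longrightarrow> X = M" by blast
  have pre: "preordering M" and proper: "\<ominus> \<one> \<notin> M" and sub: "M0 \<subseteq> M" using M by (auto simp: \<M>_def)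
  note D = preorderingD[OF pre]
  \<comment> \<open>By maximality, adjoining an a outside M must produce an improper preordering,
    that is, a representation of -1.\<close>
  have witness: "\<exists>m n. m \<in> M \<and> n \<in> M \<and> \<ominus> \<one> = m \<oplus> a \<otimes> n" if a: "a \<in> selfadjoint" "a \<notin> M" for a
  proof (rule ccontr)
    assume contr: "\<not> ?thesis"
    let ?E = "{m \<oplus> a \<otimes> n | m n. m \<in> M \<and> n \<in> M}"
    have "?E \<in> \<M>" using preordering_extend(1,2)[OF pre a(1)] sub contr by (auto simp: \<M>_def)
    with max preordering_extend(2,3)[OF pre a(1)] a(2) show False by blast
  qed
  have "a \<in> M \<or> \<ominus> a \<in> M" if a: "a \<in> selfadjoint" for a
  proof (rule ccontr)
    assume "\<not> (a \<in> M \<or> \<ominus> a \<in> M)"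
    with witness[OF a] witness[OF selfadjoint_neg[OF a]] obtain m n m' n'
      where mn: "m \<in> M" "n \<in> M" "m' \<in> M" "n' \<in> M"
        and e: "\<ominus> \<one> = m \<oplus> a \<otimes> n" and e': "\<ominus> \<one> = m' \<oplus> (\<ominus> a) \<otimes> n'" by blast
    note c = D(2)[OF mn(1)] D(2)[OF mn(2)] D(2)[OF mn(3)] D(2)[OF mn(4)]
    have ac: "a \<in> carrier A" using a by (rule selfadjointD)
    \<comment> \<open>The two representations read a n = -(1 + m) and a n' = 1 + m'. Multiplying
      them gives a^2 n n' = -(1 + m)(1 + m'), which expresses -1 by members of M alone.\<close>
    have "m \<oplus> m' \<oplus> m \<otimes> m' \<oplus> (a \<otimes> a) \<otimes> (n \<otimes> n') = \<ominus> \<one>"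
    proof -
      have 1: "a \<otimes> n = \<ominus> \<one> \<ominus> m" unfolding e using c ac by algebra
      have 2: "a \<otimes> n' = \<one> \<oplus> m'"
      proof -
        have "a \<otimes> n' = m' \<ominus> (m' \<oplus> (\<ominus> a) \<otimes> n')" using c ac by algebra
        also have "\<dots> = \<one> \<oplus> m'" unfolding e'[symmetric] using c by algebra
        finally show ?thesis .
      qed
      have "(a \<otimes> a) \<otimes> (n \<otimes> n') = (a \<otimes> n) \<otimes> (a \<otimes> n')" using c ac by algebra
      also have "\<dots> = (\<ominus> \<one> \<ominus> m) \<otimes> (\<one> \<oplus> m')" by (simp only: 1 2)
      finally show ?thesis using c by (simp only:) algebra
    qed
    moreover have "m \<oplus> m' \<oplus> m \<otimes> m' \<oplus> (a \<otimes> a) \<otimes> (n \<otimes> n') \<in> M"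
    proof -
      have aa: "a \<otimes> a \<in> M" using D(3)[OF ac] selfadjointD(2)[OF a] by simp
      show ?thesis
        using D(4)[OF D(4)[OF D(4)[OF mn(1,3)] D(5)[OF mn(1,3)]] D(5)[OF aa D(5)[OF mn(2,4)]]] .
    qed
    ultimately show False using proper by simp
  qed
  with pre proper sub show thesis by (rule that)
qed

end

section \<open>Characters are contractive and respect the involution\<close>

context cstar
begin

lemma charactersD:
  assumes "\<psi> \<in> characters A"
  shows "\<psi> \<in> extensional (carrier A)"
    "\<lbrakk>x \<in> carrier A; y \<in> carrier A\<rbrakk> \<Longrightarrow> \<psi> (x \<oplus> y) = \<psi> x + \<psi> y"
    "x \<in> carrier A \<Longrightarrow> \<psi> (c \<odot> x) = c * \<psi> x"
    "\<lbrakk>x \<in> carrier A; y \<in> carrier A\<rbrakk> \<Longrightarrow> \<psi> (x \<otimes> y) = \<psi> x * \<psi> y"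
  using assms by (auto simp: characters_def)

lemma character_one:
  assumes "\<psi> \<in> characters A"
  shows "\<psi> \<one> = 1"
proof -
  obtain x where "x \<in> carrier A" "\<psi> x \<noteq> 0" using assms by (auto simp: characters_def)
  then show ?thesis using charactersD(4)[OF assms, of x \<one>] by simp
qed

lemma character_scalar: "\<psi> \<in> characters A \<Longrightarrow> \<psi> (scalar c) = c"
  by (simp add: charactersD(3) character_one)

text \<open>If \<open>\<psi> y = 1\<close> and \<open>y\<close> had norm below 1, then \<open>\<psi> (y\<^sup>n) = 1\<close> although \<open>y\<^sup>n \<rightarrow> 0\<close>.\<close>

lemma character_bound:
  assumes \<psi>: "\<psi> \<in> characters A" and x: "x \<in> carrier A"
  shows "cmod (\<psi> x) \<le> anorm A x"
proof (rule ccontr)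
  assume "\<not> ?thesis"
  then have less: "anorm A x < cmod (\<psi> x)" by simp
  then have nz: "\<psi> x \<noteq> 0" using anorm_nonneg[OF x] by auto
  define y where "y = (1 / \<psi> x) \<odot> x"
  have y: "y \<in> carrier A" using x by (simp add: y_def smult_carrier)
  have \<psi>y: "\<psi> y = 1" using nz x by (simp add: y_def charactersD(3)[OF \<psi>])
  have norm_y: "anorm A y < 1"
    using less nz anorm_nonneg[OF x] x by (simp add: y_def anorm_smult norm_divide field_simps)
  define p where "p n = ((\<otimes>) y ^^ n) \<one>" for n
  have p_carrier: "p n \<in> carrier A" for n by (induction n) (simp_all add: p_def y)
  have \<psi>p: "\<psi> (p n) = 1" for n
  proof (induction n)
    case 0 then show ?case by (simp add: p_def character_one[OF \<psi>])
  next
    case (Suc n)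
    have "p (Suc n) = y \<otimes> p n" by (simp add: p_def)
    then show ?case using charactersD(4)[OF \<psi> y p_carrier[of n]] Suc \<psi>y by simp
  qed
  have norm_p: "anorm A (p n) \<le> anorm A y ^ n" for n
  proof (induction n)
    case 0 then show ?case by (simp add: p_def anorm_one_le)
  next
    case (Suc n)
    have "anorm A (p (Suc n)) \<le> anorm A y * anorm A (p n)"
      using anorm_mult[OF y p_carrier[of n]] by (simp add: p_def)
    also have "\<dots> \<le> anorm A y * anorm A y ^ n" using Suc anorm_nonneg[OF y] by (rule mult_left_mono)
    finally show ?case by simp
  qed
  have "continuous_map metric.mtopology euclidean \<psi>" using \<psi> by (simp add: characters_def)
  then have "openin metric.mtopology {x \<in> topspace metric.mtopology. \<psi> x \<in> ball 0 1}"
    by (rule openin_continuous_map_preimage) auto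
  moreover have "\<psi> \<zero> = 0" using charactersD(3)[OF \<psi>, of \<one> 0] by (simp add: smult_0)
  ultimately obtain r where r: "0 < r" "metric.mball \<zero> r \<subseteq> {x \<in> carrier A. \<psi> x \<in> ball 0 1}"
    by (auto simp: metric.openin_mtopology)
  obtain n where n: "anorm A y ^ n < r"
    using real_arch_pow_inv[OF r(1) norm_y] by blast
  have "anorm A (\<zero> \<ominus> p n) < r"
    using norm_p[of n] n p_carrier[of n] by (simp add: minus_eq anorm_neg)
  then have "p n \<in> metric.mball \<zero> r" using p_carrier[of n] by (simp add: metric.in_mball alg_dist_def)
  then show False using r(2) \<psi>p[of n] by auto
qed

text \<open>Compare \<open>\<bar>\<psi> (h + i t)\<bar>\<^sup>2 \<le> \<parallel>h\<^sup>2 + t\<^sup>2\<parallel>\<close> for large real \<open>t\<close> of either sign.\<close>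

lemma character_selfadjoint_real:
  assumes \<psi>: "\<psi> \<in> characters A" and h: "h \<in> selfadjoint"
  shows "Im (\<psi> h) = 0"
proof -
  have hc: "h \<in> carrier A" and hs: "star A h = h" using h by (auto simp: selfadjoint_def)
  have key: "2 * t * Im (\<psi> h) \<le> (anorm A h)\<^sup>2" for t :: real
  proof -
    define x where "x = h \<oplus> scalar (\<i> * complex_of_real t)"
    have x: "x \<in> carrier A" using hc by (simp add: x_def scalar_carrier)
    have "star A x \<otimes> x = (h \<ominus> scalar (\<i> * complex_of_real t)) \<otimes> (h \<oplus> scalar (\<i> * complex_of_real t))"
      using hc hs by (simp add: x_def star_add star_scalar scalar_carrier minus_eq neg_smult)
    also have "\<dots> = h \<otimes> h \<ominus> scalar (\<i> * complex_of_real t) \<otimes> scalar (\<i> * complex_of_real t)"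
      using hc scalar_carrier[of "\<i> * complex_of_real t"] by algebra
    also have "\<dots> = h \<otimes> h \<oplus> scalar (complex_of_real (t\<^sup>2))"
      by (simp add: scalar_mult scalar_carrier smult_smult minus_eq neg_smult power2_eq_square algebra_simps)
    finally have eq: "star A x \<otimes> x = h \<otimes> h \<oplus> scalar (complex_of_real (t\<^sup>2))" .
    have "(cmod (\<psi> x))\<^sup>2 \<le> (anorm A x)\<^sup>2"
      using character_bound[OF \<psi> x] by (intro power_mono) auto
    also have "\<dots> = anorm A (h \<otimes> h \<oplus> scalar (complex_of_real (t\<^sup>2)))" using cstar_identity[OF x] eq by simp
    also have "\<dots> \<le> anorm A (h \<otimes> h) + anorm A (scalar (complex_of_real (t\<^sup>2)))"
      using hc by (intro anorm_triangle scalar_carrier) auto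
    also have "\<dots> \<le> (anorm A h)\<^sup>2 + t\<^sup>2"
    proof (rule add_mono)
      show "anorm A (h \<otimes> h) \<le> (anorm A h)\<^sup>2" using anorm_mult[OF hc hc] by (simp add: power2_eq_square)
      have "anorm A (scalar (complex_of_real (t\<^sup>2))) = t\<^sup>2 * anorm A \<one>"
        by (subst anorm_smult) (auto simp: norm_power)
      also have "\<dots> \<le> t\<^sup>2 * 1" by (intro mult_left_mono anorm_one_le) auto
      finally show "anorm A (scalar (complex_of_real (t\<^sup>2))) \<le> t\<^sup>2" by simp
    qed
    finally have "(cmod (\<psi> x))\<^sup>2 \<le> (anorm A h)\<^sup>2 + t\<^sup>2" .
    moreover have "\<psi> x = \<psi> h + \<i> * complex_of_real t"
      unfolding x_def by (simp add: charactersD(2)[OF \<psi> hc scalar_carrier] character_scalar[OF \<psi>])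
    then have "(cmod (\<psi> x))\<^sup>2 = (Re (\<psi> h))\<^sup>2 + (Im (\<psi> h) + t)\<^sup>2" by (simp add: cmod_power2)
    ultimately have "(Re (\<psi> h))\<^sup>2 + (Im (\<psi> h) + t)\<^sup>2 \<le> (anorm A h)\<^sup>2 + t\<^sup>2" by simp
    moreover have "(Im (\<psi> h) + t)\<^sup>2 = (Im (\<psi> h))\<^sup>2 + 2 * t * Im (\<psi> h) + t\<^sup>2"
      by (simp add: power2_eq_square algebra_simps)
    ultimately show ?thesis using zero_le_power2[of "Re (\<psi> h)"] zero_le_power2[of "Im (\<psi> h)"] by linarith
  qed
  show ?thesis
  proof (rule ccontr)
    assume nz: "Im (\<psi> h) \<noteq> 0"
    \<comment> \<open>This t makes the left side of \<open>key\<close> equal to the square of the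
      norm plus 1.\<close>
    with key[of "((anorm A h)\<^sup>2 + 1) / (2 * Im (\<psi> h))"] show False by simp
  qed
qed

lemma selfadjoint_decomposition:
  assumes x: "x \<in> carrier A"
  obtains h k where "h \<in> selfadjoint" "k \<in> selfadjoint" "x = h \<oplus> \<i> \<odot> k" "star A x = h \<ominus> \<i> \<odot> k"
proof
  let ?h = "(1/2) \<odot> (x \<oplus> star A x)" and ?k = "(- \<i>/2) \<odot> (x \<ominus> star A x)"
  note s = star_closed[OF x] star_star[OF x]
  show "?h \<in> selfadjoint"
    using x s by (simp add: selfadjoint_def star_smult star_add smult_carrier a_comm)
  show "?k \<in> selfadjoint"
    using x s by (simp add: selfadjoint_def star_smult star_add smult_carrier minus_eq smult_add_right
        neg_eq_smult smult_smult a_comm)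
  have split: "y = (1/2) \<odot> y \<oplus> (1/2) \<odot> y" if "y \<in> carrier A" for y
    using smult_add_left[OF that, of "1/2" "1/2"] that by (simp add: smult_1)
  have ik: "\<i> \<odot> ?k = (1/2) \<odot> x \<ominus> (1/2) \<odot> star A x"
    using x s by (simp add: minus_eq smult_add_right smult_carrier smult_smult neg_eq_smult)
  have hh: "?h = (1/2) \<odot> x \<oplus> (1/2) \<odot> star A x" using x s by (simp add: smult_add_right)
  note c = smult_carrier[OF x, of "1/2"] smult_carrier[OF s(1), of "1/2"]
  have "?h \<oplus> \<i> \<odot> ?k = (1/2) \<odot> x \<oplus> (1/2) \<odot> x" unfolding ik hh using c by algebra
  with split[OF x] show "x = ?h \<oplus> \<i> \<odot> ?k" by simp
  have "?h \<ominus> \<i> \<odot> ?k = (1/2) \<odot> star A x \<oplus> (1/2) \<odot> star A x" unfolding ik hh using c by algebra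
  with split[OF s(1)] show "star A x = ?h \<ominus> \<i> \<odot> ?k" by simp
qed

lemma character_diff:
  "\<lbrakk>\<psi> \<in> characters A; x \<in> carrier A; y \<in> carrier A\<rbrakk> \<Longrightarrow> \<psi> (x \<ominus> y) = \<psi> x - \<psi> y"
  by (simp add: minus_eq charactersD(2,3) neg_eq_smult smult_carrier)

lemma character_star:
  assumes \<psi>: "\<psi> \<in> characters A" and x: "x \<in> carrier A"
  shows "\<psi> (star A x) = cnj (\<psi> x)"
proof -
  obtain h k where hk: "h \<in> selfadjoint" "k \<in> selfadjoint" "x = h \<oplus> \<i> \<odot> k" "star A x = h \<ominus> \<i> \<odot> k"
    using selfadjoint_decomposition[OF x] by blast
  have c: "h \<in> carrier A" "k \<in> carrier A" using hk selfadjointD by auto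
  have "\<psi> (star A x) = \<psi> h - \<i> * \<psi> k"
    unfolding hk(4) using c by (simp add: character_diff[OF \<psi>] charactersD(3)[OF \<psi>] smult_carrier)
  moreover have "\<psi> x = \<psi> h + \<i> * \<psi> k"
    unfolding hk(3) using c by (simp add: charactersD(2,3)[OF \<psi>] smult_carrier)
  ultimately show ?thesis
    using character_selfadjoint_real[OF \<psi> hk(1)] character_selfadjoint_real[OF \<psi> hk(2)]
    by (simp add: complex_eq_iff)
qed

end

text \<open>A maximal proper preordering is total, hence has an ideal of infinitesimals \<open>Z\<close> with quotient the
  reals. The ideal \<open>I\<close> of those \<open>x\<close> with \<open>x\<^sup>* x \<in> Z\<close> is the kernel of the associated character.\<close>

locale cstar_ordering = cstar A for A :: "'a cstar" (structure) +
  fixes M :: "'a set"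
  assumes preordering_M: "preordering M" and proper_M: "\<ominus> \<one> \<notin> M"
    and total_M: "a \<in> selfadjoint \<Longrightarrow> a \<in> M \<or> \<ominus> a \<in> M"
begin

lemmas M_simps = preorderingD[OF preordering_M]

lemma real_scalar_in_M_iff: "real_scalar r \<in> M \<longleftrightarrow> 0 \<le> r"
proof
  assume r: "real_scalar r \<in> M"
  show "0 \<le> r"
  proof (rule ccontr)
    assume neg: "\<not> 0 \<le> r"
    then have "complex_of_real (1 / (- r)) \<odot> real_scalar r \<in> M"
      using r by (intro preordering_smult[OF preordering_M]) auto
    moreover have "complex_of_real (1 / (- r)) \<odot> real_scalar r = \<ominus> \<one>"
      using neg real_scalar_smult[of "1 / (- r)" r] neg_real_scalar[of 1] by (simp add: real_scalar_1)
    ultimately show False using proper_M by simp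
  qed
qed (rule preordering_scalar[OF preordering_M])

definition infinitesimals :: "'a set" where
  "infinitesimals = {z \<in> selfadjoint. \<forall>e>0. real_scalar e \<ominus> z \<in> M \<and> real_scalar e \<oplus> z \<in> M}"

lemma infinitesimals_selfadjoint: "z \<in> infinitesimals \<Longrightarrow> z \<in> selfadjoint"
  by (simp add: infinitesimals_def)

lemma infinitesimals_carrier: "z \<in> infinitesimals \<Longrightarrow> z \<in> carrier A"
  using infinitesimals_selfadjoint selfadjointD by blast

lemma infinitesimals_add:
  assumes z: "z \<in> infinitesimals" and w: "w \<in> infinitesimals"
  shows "z \<oplus> w \<in> infinitesimals"
proof -
  note c = infinitesimals_carrier[OF z] infinitesimals_carrier[OF w]
  have "real_scalar e \<ominus> (z \<oplus> w) \<in> M \<and> real_scalar e \<oplus> (z \<oplus> w) \<in> M" if "0 < e" for e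
  proof -
    have half: "real_scalar e = real_scalar (e/2) \<oplus> real_scalar (e/2)" by (simp add: real_scalar_add)
    have in_M: "real_scalar (e/2) \<ominus> z \<in> M" "real_scalar (e/2) \<ominus> w \<in> M"
      "real_scalar (e/2) \<oplus> z \<in> M" "real_scalar (e/2) \<oplus> w \<in> M"
      using z w that by (auto simp: infinitesimals_def)
    have "(real_scalar (e/2) \<ominus> z) \<oplus> (real_scalar (e/2) \<ominus> w) \<in> M"
      "(real_scalar (e/2) \<oplus> z) \<oplus> (real_scalar (e/2) \<oplus> w) \<in> M"
      using M_simps(4)[OF in_M(1,2)] M_simps(4)[OF in_M(3,4)] .
    moreover have "(real_scalar (e/2) \<ominus> z) \<oplus> (real_scalar (e/2) \<ominus> w) = real_scalar e \<ominus> (z \<oplus> w)"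
      "(real_scalar (e/2) \<oplus> z) \<oplus> (real_scalar (e/2) \<oplus> w) = real_scalar e \<oplus> (z \<oplus> w)"
      unfolding half using c real_scalar_carrier[of "e/2"] by algebra+
    ultimately show ?thesis by simp
  qed
  then show ?thesis
    using selfadjoint_add[OF infinitesimals_selfadjoint[OF z] infinitesimals_selfadjoint[OF w]]
    by (simp add: infinitesimals_def)
qed

text \<open>From -d \<le> z \<le> d and -N \<le> b \<le> N, the product (d - z)(N + b) + (d + z)(N -
  b) is nonnegative; its mixed terms cancel and leave 2(dN - z b). Exchanging the signs of z gives
  2(dN + z b). The choice d = e/N makes dN equal to e.\<close>

lemma infinitesimals_mult:
  assumes z: "z \<in> infinitesimals" and b: "b \<in> selfadjoint"
  shows "z \<otimes> b \<in> infinitesimals"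
proof -
  have zc: "z \<in> carrier A" and bc: "b \<in> carrier A"
    using infinitesimals_carrier[OF z] selfadjointD[OF b] by auto
  obtain N where N: "0 < N" "real_scalar N \<ominus> b \<in> squares_cone" "real_scalar N \<oplus> b \<in> squares_cone"
    using selfadjoint_bounded[OF b] by blast
  have NM: "real_scalar N \<ominus> b \<in> M" "real_scalar N \<oplus> b \<in> M"
    using N squares_cone_subset[OF preordering_M] by auto
  have halve: "u \<in> M" if "u \<oplus> u \<in> M" "u \<in> carrier A" for u
  proof -
    have "complex_of_real (1/2) \<odot> (u \<oplus> u) \<in> M" by (rule preordering_smult[OF preordering_M _ that(1)]) simp
    moreover have "complex_of_real (1/2) \<odot> (u \<oplus> u) = u"
      using that(2) smult_add_left[of u "1/2" "1/2"] by (simp add: smult_add_right smult_1)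
    ultimately show ?thesis by simp
  qed
  have "real_scalar e \<ominus> z \<otimes> b \<in> M \<and> real_scalar e \<oplus> z \<otimes> b \<in> M" if e: "0 < e" for e
  proof -
    define d n where "d = real_scalar (e / N)" and "n = real_scalar N"
    have dn: "d \<otimes> n = real_scalar e" using N(1)
      by (simp add: d_def n_def real_scalar_mult real_scalar_carrier real_scalar_smult del: of_real_divide)
    have c: "d \<in> carrier A" "n \<in> carrier A" by (simp_all add: d_def n_def real_scalar_carrier)
    have d: "d \<ominus> z \<in> M" "d \<oplus> z \<in> M"
      using z e N(1) unfolding d_def infinitesimals_def by auto
    note NM' = NM[folded n_def]
    have "(d \<ominus> z) \<otimes> (n \<oplus> b) \<oplus> (d \<oplus> z) \<otimes> (n \<ominus> b) \<in> M" by (intro M_simps(4,5) d NM')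
    moreover have "(d \<ominus> z) \<otimes> (n \<oplus> b) \<oplus> (d \<oplus> z) \<otimes> (n \<ominus> b) = (d \<otimes> n \<ominus> z \<otimes> b) \<oplus> (d \<otimes> n \<ominus> z \<otimes> b)"
      using zc bc c by algebra
    moreover have "(d \<oplus> z) \<otimes> (n \<oplus> b) \<oplus> (d \<ominus> z) \<otimes> (n \<ominus> b) \<in> M" by (intro M_simps(4,5) d NM')
    moreover have "(d \<oplus> z) \<otimes> (n \<oplus> b) \<oplus> (d \<ominus> z) \<otimes> (n \<ominus> b) = (d \<otimes> n \<oplus> z \<otimes> b) \<oplus> (d \<otimes> n \<oplus> z \<otimes> b)"
      using zc bc c by algebra
    ultimately have "d \<otimes> n \<ominus> z \<otimes> b \<in> M" "d \<otimes> n \<oplus> z \<otimes> b \<in> M"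
      using zc bc c by (auto intro!: halve)
    then show ?thesis unfolding dn ..
  qed
  then show ?thesis
    using selfadjoint_mult[OF infinitesimals_selfadjoint[OF z] b] by (simp add: infinitesimals_def)
qed

lemma infinitesimals_dominated:
  assumes q: "q \<in> infinitesimals" and p: "p \<in> M" and le: "q \<ominus> p \<in> M"
  shows "p \<in> infinitesimals"
proof -
  note c = infinitesimals_carrier[OF q] M_simps(2)[OF p]
  have "real_scalar e \<ominus> p \<in> M \<and> real_scalar e \<oplus> p \<in> M" if e: "0 < e" for e
  proof
    have "(real_scalar e \<ominus> q) \<oplus> (q \<ominus> p) \<in> M"
      using q e le by (auto simp: infinitesimals_def intro!: M_simps(4))
    then show "real_scalar e \<ominus> p \<in> M" using c by (simp add: diff_add_diff real_scalar_carrier)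
    show "real_scalar e \<oplus> p \<in> M" using e p by (intro M_simps(4)) (auto simp: real_scalar_in_M_iff)
  qed
  then show ?thesis using M_simps(1)[OF p] by (simp add: infinitesimals_def)
qed

lemma infinitesimals_scalar:
  assumes "real_scalar r \<in> infinitesimals"
  shows "r = 0"
proof -
  have bound: "r \<le> e \<and> - e \<le> r" if e: "0 < e" for e
  proof -
    have "real_scalar (e - r) \<in> M" "real_scalar (e + r) \<in> M"
      using assms e by (auto simp: infinitesimals_def real_scalar_add real_scalar_diff)
    then show ?thesis by (simp add: real_scalar_in_M_iff)
  qed
  show ?thesis
  proof (rule ccontr)
    assume "r \<noteq> 0"
    with bound[of "\<bar>r\<bar> / 2"] show False by linarith
  qed
qed

text \<open>A Dedekind cut: \<alpha> is the supremum of the reals r with r \<le> h. The archimedean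
  bounds make the set nonempty and bounded. Totality of M turns the failure of Sup S + e \<le> h
  into the opposite inequality, so h lies within e of the supremum from above as well as from
  below.\<close>

lemma infinitesimals_standard_part:
  assumes h: "h \<in> selfadjoint"
  obtains \<alpha> where "h \<ominus> real_scalar \<alpha> \<in> infinitesimals"
proof -
  have hc: "h \<in> carrier A" using h by (rule selfadjointD)
  note rc = real_scalar_carrier
  obtain N where "0 < N" "real_scalar N \<ominus> h \<in> squares_cone" "real_scalar N \<oplus> h \<in> squares_cone"
    using selfadjoint_bounded[OF h] by blast
  then have N: "real_scalar N \<ominus> h \<in> M" "real_scalar N \<oplus> h \<in> M"
    using squares_cone_subset[OF preordering_M] by auto
  define S where "S = {r. h \<ominus> real_scalar r \<in> M}"
  have "h \<ominus> real_scalar (- N) = real_scalar N \<oplus> h"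
    using hc by (simp add: minus_eq neg_real_scalar a_comm rc)
  then have ne: "- N \<in> S" using N by (simp add: S_def)
  have bdd: "bdd_above S"
  proof (rule bdd_aboveI)
    fix r assume "r \<in> S"
    then have "(real_scalar N \<ominus> h) \<oplus> (h \<ominus> real_scalar r) \<in> M" using N by (auto simp: S_def intro: M_simps(4))
    then have "real_scalar (N - r) \<in> M" using hc by (simp add: diff_add_diff rc real_scalar_diff)
    then show "r \<le> N" by (simp add: real_scalar_in_M_iff)
  qed
  show thesis
  proof (rule that[of "Sup S"])
    have "real_scalar e \<ominus> (h \<ominus> real_scalar (Sup S)) \<in> M \<and> real_scalar e \<oplus> (h \<ominus> real_scalar (Sup S)) \<in> M"
      if e: "0 < e" for e
    proof
      have "Sup S + e \<notin> S" using cSup_upper[OF _ bdd, of "Sup S + e"] e by auto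
      then have "\<ominus> (h \<ominus> real_scalar (Sup S + e)) \<in> M"
        using total_M[OF selfadjoint_diff[OF h real_scalar_selfadjoint]] unfolding S_def by blast
      moreover have "\<ominus> (h \<ominus> (real_scalar (Sup S) \<oplus> real_scalar e)) = real_scalar e \<ominus> (h \<ominus> real_scalar (Sup S))"
        using hc rc[of "Sup S"] rc[of e] by algebra
      ultimately show "real_scalar e \<ominus> (h \<ominus> real_scalar (Sup S)) \<in> M" by (simp add: real_scalar_add)
      obtain r where r: "r \<in> S" "Sup S - e < r"
        using less_cSupE[of "Sup S - e" S] e ne by auto
      have "real_scalar (e - Sup S + r) \<oplus> (h \<ominus> real_scalar r) \<in> M"
        using r by (intro M_simps(4)) (auto simp: S_def real_scalar_in_M_iff)
      moreover have "real_scalar (e - Sup S + r) = (real_scalar e \<ominus> real_scalar (Sup S)) \<oplus> real_scalar r"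
        by (simp add: real_scalar_diff real_scalar_add)
      moreover have "((real_scalar e \<ominus> real_scalar (Sup S)) \<oplus> real_scalar r) \<oplus> (h \<ominus> real_scalar r)
          = real_scalar e \<oplus> (h \<ominus> real_scalar (Sup S))"
        using hc rc[of "Sup S"] rc[of e] rc[of r] by algebra
      ultimately show "real_scalar e \<oplus> (h \<ominus> real_scalar (Sup S)) \<in> M" by simp
    qed
    then show "h \<ominus> real_scalar (Sup S) \<in> infinitesimals"
      using selfadjoint_diff[OF h real_scalar_selfadjoint] by (simp add: infinitesimals_def)
  qed
qed

definition kernel :: "'a set" where
  "kernel = {x \<in> carrier A. star A x \<otimes> x \<in> infinitesimals}"

lemma kernel_carrier: "x \<in> kernel \<Longrightarrow> x \<in> carrier A"
  by (simp add: kernel_def)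

text \<open>By the parallelogram law 2(x* x + y* y) - (x + y)*(x + y) equals (x - y)*(x - y), a
  member of M. So the square of x + y is dominated by an infinitesimal.\<close>

lemma kernel_add:
  assumes x: "x \<in> kernel" and y: "y \<in> kernel"
  shows "x \<oplus> y \<in> kernel"
proof -
  have c: "x \<in> carrier A" "y \<in> carrier A" "star A x \<in> carrier A" "star A y \<in> carrier A"
    using x y by (auto simp: kernel_def star_closed)
  let ?q = "(star A x \<otimes> x \<oplus> star A y \<otimes> y) \<oplus> (star A x \<otimes> x \<oplus> star A y \<otimes> y)"
  have "?q \<in> infinitesimals" using x y by (auto simp: kernel_def intro!: infinitesimals_add)
  moreover have "star A (x \<oplus> y) \<otimes> (x \<oplus> y) \<in> M" using c by (intro M_simps(3)) auto
  moreover have "?q \<ominus> star A (x \<oplus> y) \<otimes> (x \<oplus> y) = star A (x \<ominus> y) \<otimes> (x \<ominus> y)"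
    unfolding star_add[OF c(1,2)] star_diff[OF c(1,2)] using c by algebra
  then have "?q \<ominus> star A (x \<oplus> y) \<otimes> (x \<oplus> y) \<in> M" using M_simps(3)[of "x \<ominus> y"] c by simp
  ultimately have "star A (x \<oplus> y) \<otimes> (x \<oplus> y) \<in> infinitesimals" by (rule infinitesimals_dominated)
  then show ?thesis using c by (simp add: kernel_def)
qed

lemma kernel_mult:
  assumes x: "x \<in> kernel" and y: "y \<in> carrier A"
  shows "x \<otimes> y \<in> kernel"
proof -
  have xc: "x \<in> carrier A" using x by (rule kernel_carrier)
  have "star A (x \<otimes> y) \<otimes> (x \<otimes> y) = (star A x \<otimes> x) \<otimes> (star A y \<otimes> y)"
    using xc y by (simp add: star_mult' star_closed m_ac)
  moreover have "(star A x \<otimes> x) \<otimes> (star A y \<otimes> y) \<in> infinitesimals"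
    using x by (intro infinitesimals_mult[OF _ selfadjoint_star_mult[OF y]]) (simp add: kernel_def)
  ultimately show ?thesis using xc y by (simp add: kernel_def)
qed

lemma kernel_smult: "x \<in> kernel \<Longrightarrow> c \<odot> x \<in> kernel"
  using kernel_mult[of x "scalar c"] by (simp add: kernel_carrier scalar_carrier mult_smult)

lemma infinitesimals_kernel: "z \<in> infinitesimals \<Longrightarrow> z \<in> kernel"
  using infinitesimals_mult[of z z] infinitesimals_selfadjoint[of z]
  by (simp add: kernel_def selfadjoint_def)

lemma kernel_scalar:
  assumes "scalar w \<in> kernel"
  shows "w = 0"
proof -
  have "star A (scalar w) \<otimes> scalar w = real_scalar ((cmod w)\<^sup>2)"
    by (simp add: real_scalar_def star_scalar scalar_mult scalar_carrier smult_smult complex_norm_square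
        mult.commute del: of_real_power)
  then have "(cmod w)\<^sup>2 = 0" using assms infinitesimals_scalar[of "(cmod w)\<^sup>2"] by (simp add: kernel_def)
  then show ?thesis by simp
qed

text \<open>The quotient by \<open>kernel\<close> is the field of complex numbers: the standard
  parts of the real and imaginary parts of x give w, and \<open>kernel_scalar\<close> gives
  uniqueness.\<close>

lemma kernel_decomposition:
  assumes x: "x \<in> carrier A"
  shows "\<exists>!w. x \<ominus> scalar w \<in> kernel"
proof (rule ex_ex1I)
  obtain h k where hk: "h \<in> selfadjoint" "k \<in> selfadjoint" "x = h \<oplus> \<i> \<odot> k"
    using selfadjoint_decomposition[OF x] by metis
  obtain \<alpha> where \<alpha>: "h \<ominus> real_scalar \<alpha> \<in> infinitesimals" using infinitesimals_standard_part[OF hk(1)] .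
  obtain \<beta> where \<beta>: "k \<ominus> real_scalar \<beta> \<in> infinitesimals" using infinitesimals_standard_part[OF hk(2)] .
  have c: "h \<in> carrier A" "\<i> \<odot> k \<in> carrier A" "k \<in> carrier A" using hk selfadjointD by (auto simp: smult_carrier)
  have "(h \<ominus> real_scalar \<alpha>) \<oplus> \<i> \<odot> (k \<ominus> real_scalar \<beta>) \<in> kernel"
    using \<alpha> \<beta> by (intro kernel_add kernel_smult infinitesimals_kernel)
  moreover have "\<i> \<odot> (k \<ominus> real_scalar \<beta>) = \<i> \<odot> k \<ominus> scalar (\<i> * \<beta>)"
    using c by (simp add: real_scalar_def minus_eq smult_add_right smult_carrier neg_smult smult_smult)
  moreover have "(h \<ominus> real_scalar \<alpha>) \<oplus> (\<i> \<odot> k \<ominus> scalar (\<i> * \<beta>)) = x \<ominus> (real_scalar \<alpha> \<oplus> scalar (\<i> * \<beta>))"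
    unfolding hk(3) using c real_scalar_carrier[of \<alpha>] scalar_carrier[of "\<i> * \<beta>"] by algebra
  ultimately have "x \<ominus> scalar (\<alpha> + \<i> * \<beta>) \<in> kernel" by (simp add: real_scalar_def scalar_add)
  then show "\<exists>w. x \<ominus> scalar w \<in> kernel" ..
next
  fix w v assume w: "x \<ominus> scalar w \<in> kernel" and v: "x \<ominus> scalar v \<in> kernel"
  have "(x \<ominus> scalar w) \<oplus> (-1) \<odot> (x \<ominus> scalar v) \<in> kernel" by (intro kernel_add kernel_smult w v)
  moreover have "(x \<ominus> scalar w) \<oplus> (-1) \<odot> (x \<ominus> scalar v) = scalar v \<ominus> scalar w"
    using x scalar_carrier[of v] scalar_carrier[of w]
    unfolding neg_eq_smult[OF diff_carrier[OF x scalar_carrier], symmetric] by algebra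
  ultimately have "scalar (v - w) \<in> kernel" by (simp add: scalar_diff)
  then show "w = v" using kernel_scalar by force
qed

definition ordering_character :: "'a \<Rightarrow> complex" where
  "ordering_character = (\<lambda>x\<in>carrier A. THE w. x \<ominus> scalar w \<in> kernel)"

lemma ordering_character_eqI:
  "x \<in> carrier A \<Longrightarrow> x \<ominus> scalar w \<in> kernel \<Longrightarrow> ordering_character x = w"
  using kernel_decomposition[of x] by (auto simp: ordering_character_def intro: the1_equality)

lemma ordering_character_kernel: "x \<in> carrier A \<Longrightarrow> x \<ominus> scalar (ordering_character x) \<in> kernel"
  using theI'[OF kernel_decomposition[of x]] by (simp add: ordering_character_def)

lemma ordering_character_add:
  assumes x: "x \<in> carrier A" and y: "y \<in> carrier A"
  shows "ordering_character (x \<oplus> y) = ordering_character x + ordering_character y"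
proof (rule ordering_character_eqI)
  let ?w = "ordering_character x" and ?v = "ordering_character y"
  have "(x \<ominus> scalar ?w) \<oplus> (y \<ominus> scalar ?v) \<in> kernel"
    using x y by (intro kernel_add ordering_character_kernel)
  moreover have "(x \<ominus> scalar ?w) \<oplus> (y \<ominus> scalar ?v) = (x \<oplus> y) \<ominus> (scalar ?w \<oplus> scalar ?v)"
    using x y scalar_carrier[of ?w] scalar_carrier[of ?v] by algebra
  ultimately show "(x \<oplus> y) \<ominus> scalar (?w + ?v) \<in> kernel" by (simp add: scalar_add)
qed (use x y in simp)

lemma ordering_character_mult:
  assumes x: "x \<in> carrier A" and y: "y \<in> carrier A"
  shows "ordering_character (x \<otimes> y) = ordering_character x * ordering_character y"
proof (rule ordering_character_eqI)
  let ?w = "ordering_character x" and ?v = "ordering_character y"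
  \<comment> \<open>The telescoping x y - w v = (x - w) y + (y - v) w uses only that
    \<open>kernel\<close> is an ideal.\<close>
  have "(x \<ominus> scalar ?w) \<otimes> y \<oplus> (y \<ominus> scalar ?v) \<otimes> scalar ?w \<in> kernel"
    using x y by (intro kernel_add kernel_mult ordering_character_kernel scalar_carrier)
  moreover have "(x \<ominus> scalar ?w) \<otimes> y \<oplus> (y \<ominus> scalar ?v) \<otimes> scalar ?w = (x \<otimes> y) \<ominus> (scalar ?w \<otimes> scalar ?v)"
    using x y scalar_carrier[of ?w] scalar_carrier[of ?v] by algebra
  ultimately show "(x \<otimes> y) \<ominus> scalar (?w * ?v) \<in> kernel" by (simp add: scalar_mult scalar_carrier smult_smult)
qed (use x y in simp)

lemma ordering_character_scalar: "ordering_character (scalar c) = c"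
proof (rule ordering_character_eqI[OF scalar_carrier])
  have "real_scalar 0 \<in> infinitesimals"
    using real_scalar_selfadjoint[of 0]
    by (simp add: infinitesimals_def real_scalar_diff real_scalar_add real_scalar_in_M_iff)
  then show "scalar c \<ominus> scalar c \<in> kernel" by (simp add: scalar_diff infinitesimals_kernel real_scalar_def)
qed

lemma ordering_character_real_scalar: "ordering_character (real_scalar r) = complex_of_real r"
  by (simp add: real_scalar_def ordering_character_scalar)

lemma ordering_character_smult: "x \<in> carrier A \<Longrightarrow> ordering_character (c \<odot> x) = c * ordering_character x"
  using ordering_character_mult[OF scalar_carrier[of c], of x] by (simp add: ordering_character_scalar scalar_mult)

lemma ordering_character_infinitesimal:
  "h \<in> selfadjoint \<Longrightarrow> h \<ominus> real_scalar \<alpha> \<in> infinitesimals \<Longrightarrow> ordering_character h = complex_of_real \<alpha>"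
  by (intro ordering_character_eqI) (simp_all add: selfadjointD flip: real_scalar_def, rule infinitesimals_kernel)

text \<open>If m differs from \<alpha> by an infinitesimal, then \<alpha> + e is the sum of m and a
  member of M for every positive e, and the scalars in M are nonnegative.\<close>

lemma ordering_character_M_nonneg:
  assumes m: "m \<in> M"
  shows "\<exists>\<alpha>\<ge>0. ordering_character m = complex_of_real \<alpha>"
proof -
  have ms: "m \<in> selfadjoint" and mc: "m \<in> carrier A" using m M_simps by auto
  obtain \<alpha> where \<alpha>: "m \<ominus> real_scalar \<alpha> \<in> infinitesimals" using infinitesimals_standard_part[OF ms] .
  have "0 \<le> \<alpha>"
  proof (rule field_le_epsilon)
    fix e :: real assume "0 < e"
    then have "(real_scalar e \<ominus> (m \<ominus> real_scalar \<alpha>)) \<oplus> m \<in> M"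
      using \<alpha> m by (intro M_simps(4)) (auto simp: infinitesimals_def)
    moreover have "(real_scalar e \<ominus> (m \<ominus> real_scalar \<alpha>)) \<oplus> m = real_scalar \<alpha> \<oplus> real_scalar e"
      using mc real_scalar_carrier[of e] real_scalar_carrier[of \<alpha>] by algebra
    ultimately have "real_scalar (\<alpha> + e) \<in> M" by (simp add: real_scalar_add)
    then show "0 \<le> \<alpha> + e" by (simp add: real_scalar_in_M_iff)
  qed
  then show ?thesis using ordering_character_infinitesimal[OF ms \<alpha>] by blast
qed

text \<open>Continuity is part of being a character, so a norm bound is required. It comes from the
  archimedean property: for g = h and g = -h the element
  \<open>real_scalar (anorm A g + e) \<ominus> g\<close> is a sum of squares, hence has a
  nonnegative value.\<close>

lemma ordering_character_selfadjoint_bound: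
  assumes h: "h \<in> selfadjoint"
  shows "cmod (ordering_character h) \<le> anorm A h"
proof (rule field_le_epsilon)
  fix e :: real assume e: "0 < e"
  have hc: "h \<in> carrier A" using h by (rule selfadjointD)
  have oc: "ordering_character (\<ominus> x) = - ordering_character x" if "x \<in> carrier A" for x
    using that by (simp add: neg_eq_smult ordering_character_smult)
  obtain \<alpha> where \<alpha>: "h \<ominus> real_scalar \<alpha> \<in> infinitesimals" using infinitesimals_standard_part[OF h] .
  have bound: "\<beta> \<le> anorm A g + e" if g: "g \<in> selfadjoint" "ordering_character g = complex_of_real \<beta>" for g \<beta>
  proof -
    have gc: "g \<in> carrier A" using g by (intro selfadjointD)
    have "real_scalar (anorm A g + e) \<ominus> g \<in> M"
      using squares_cone_archimedean[OF g(1), of "anorm A g + e"] e squares_cone_subset[OF preordering_M] by auto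
    then obtain \<gamma> where "0 \<le> \<gamma>" "ordering_character (real_scalar (anorm A g + e) \<ominus> g) = complex_of_real \<gamma>"
      using ordering_character_M_nonneg by blast
    moreover have "ordering_character (real_scalar (anorm A g + e) \<ominus> g) = complex_of_real (anorm A g + e - \<beta>)"
      using gc by (simp add: minus_eq ordering_character_add real_scalar_carrier ordering_character_real_scalar oc g(2))
    ultimately show ?thesis by (simp add: of_real_eq_iff del: of_real_add of_real_diff)
  qed
  have ah: "ordering_character h = complex_of_real \<alpha>" by (rule ordering_character_infinitesimal[OF h \<alpha>])
  have "\<alpha> \<le> anorm A h + e" by (rule bound[OF h ah])
  moreover have "- \<alpha> \<le> anorm A h + e"
    using bound[OF selfadjoint_neg[OF h], of "- \<alpha>"] hc by (simp add: oc ah anorm_neg)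
  ultimately show "cmod (ordering_character h) \<le> anorm A h + e" by (simp add: ah)
qed

end

lemma open_coordinate_vimage: "open W \<Longrightarrow> open ((\<lambda>h :: 'i \<Rightarrow> 'b::topological_space. h i) -` W)"
  by (intro open_vimage continuous_on_product_coordinates)

text \<open>The library makes function spaces Hausdorff only for countable index types, through a metric. The
  arities of the superclasses have to be generalised first.\<close>

instance "fun" :: (type, t0_space) t0_space
proof
  fix f g :: "'a \<Rightarrow> 'b" assume "f \<noteq> g"
  then obtain x where x: "f x \<noteq> g x" by blast
  obtain U where "open U" "\<not> (f x \<in> U \<longleftrightarrow> g x \<in> U)"
    using t0_space_class.t0_space[OF x] by blast
  then show "\<exists>U. open U \<and> \<not> (f \<in> U \<longleftrightarrow> g \<in> U)"
    by (intro exI[of _ "(\<lambda>h. h x) -` U"]) (auto intro: open_coordinate_vimage)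
qed

instance "fun" :: (type, t1_space) t1_space
proof
  fix f g :: "'a \<Rightarrow> 'b" assume "f \<noteq> g"
  then obtain x where "f x \<noteq> g x" by blast
  then obtain U where "open U" "f x \<in> U" "g x \<notin> U"
    using t1_space[of "f x" "g x"] by blast
  then show "\<exists>U. open U \<and> f \<in> U \<and> g \<notin> U"
    by (intro exI[of _ "(\<lambda>h. h x) -` U"]) (auto intro: open_coordinate_vimage)
qed

instance "fun" :: (type, t2_space) t2_space
proof
  fix f g :: "'a \<Rightarrow> 'b" assume "f \<noteq> g"
  then obtain x where "f x \<noteq> g x" by blast
  then obtain U V where "open U" "open V" "f x \<in> U" "g x \<in> V" "U \<inter> V = {}"
    using hausdorff[of "f x" "g x"] by blast
  then show "\<exists>U V. open U \<and> open V \<and> f \<in> U \<and> g \<in> V \<and> U \<inter> V = {}"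
    by (intro exI[of _ "(\<lambda>h. h x) -` U"] exI[of _ "(\<lambda>h. h x) -` V"])
       (auto intro: open_coordinate_vimage)
qed

lemma (in cstar) bounded_functional_continuous:
  assumes add: "\<And>x y. \<lbrakk>x \<in> carrier A; y \<in> carrier A\<rbrakk> \<Longrightarrow> \<omega> (x \<oplus> y) = \<omega> x + \<omega> y"
    and smult: "\<And>c x. x \<in> carrier A \<Longrightarrow> \<omega> (c \<odot> x) = c * \<omega> x"
    and bound: "\<And>x. x \<in> carrier A \<Longrightarrow> cmod (\<omega> x) \<le> anorm A x"
  shows "continuous_map metric.mtopology euclidean \<omega>"
  unfolding continuous_map_def
proof (intro conjI allI impI)
  fix U :: "complex set" assume "openin euclidean U"
  then have U: "open U" by simp
  show "openin metric.mtopology {x \<in> topspace metric.mtopology. \<omega> x \<in> U}"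
    unfolding metric.openin_mtopology metric.topspace_mtopology
  proof (intro conjI allI impI)
    fix x assume "x \<in> {x \<in> carrier A. \<omega> x \<in> U}"
    then have x: "x \<in> carrier A" "\<omega> x \<in> U" by auto
    then obtain e where e: "0 < e" "ball (\<omega> x) e \<subseteq> U" using U openE by blast
    have "metric.mball x e \<subseteq> {x \<in> carrier A. \<omega> x \<in> U}"
    proof
      fix y assume "y \<in> metric.mball x e"
      then have y: "y \<in> carrier A" "anorm A (x \<ominus> y) < e" using x by (auto simp: alg_dist_def)
      have "\<omega> (x \<ominus> y) = \<omega> x - \<omega> y"
        using x y by (simp add: minus_eq add neg_eq_smult smult_carrier smult)
      then have "cmod (\<omega> x - \<omega> y) < e" using bound[of "x \<ominus> y"] x y by simp
      then have "\<omega> y \<in> ball (\<omega> x) e" by (simp add: dist_norm)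
      with y e show "y \<in> {x \<in> carrier A. \<omega> x \<in> U}" by blast
    qed
    with e show "\<exists>r>0. metric.mball x r \<subseteq> {x \<in> carrier A. \<omega> x \<in> U}" by blast
  qed auto
qed simp

context cstar_ordering
begin

lemma ordering_character_star:
  assumes x: "x \<in> carrier A"
  shows "ordering_character (star A x) = cnj (ordering_character x)"
proof -
  obtain h k where hk: "h \<in> selfadjoint" "k \<in> selfadjoint" "x = h \<oplus> \<i> \<odot> k" "star A x = h \<ominus> \<i> \<odot> k"
    using selfadjoint_decomposition[OF x] by blast
  have c: "h \<in> carrier A" "k \<in> carrier A" using hk selfadjointD by auto
  obtain \<alpha> where \<alpha>: "ordering_character h = complex_of_real \<alpha>"
    using infinitesimals_standard_part[OF hk(1)] ordering_character_infinitesimal[OF hk(1)] by blast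
  obtain \<beta> where \<beta>: "ordering_character k = complex_of_real \<beta>"
    using infinitesimals_standard_part[OF hk(2)] ordering_character_infinitesimal[OF hk(2)] by blast
  have "ordering_character (star A x) = complex_of_real \<alpha> - \<i> * complex_of_real \<beta>"
    unfolding hk(4) minus_eq neg_smult[OF c(2)] using c
    by (simp add: ordering_character_add ordering_character_smult smult_carrier \<alpha> \<beta>)
  moreover have "ordering_character x = complex_of_real \<alpha> + \<i> * complex_of_real \<beta>"
    unfolding hk(3) using c by (simp add: ordering_character_add ordering_character_smult smult_carrier \<alpha> \<beta>)
  ultimately show ?thesis by simp
qed

text \<open>The C*-identity carries the bound from the self-adjoint element
  \<open>star A x \<otimes> x\<close> to x: both sides are compared after squaring.\<close>

lemma ordering_character_bound:
  assumes x: "x \<in> carrier A"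
  shows "cmod (ordering_character x) \<le> anorm A x"
proof (rule power2_le_imp_le[OF _ anorm_nonneg[OF x]])
  have "ordering_character (star A x \<otimes> x) = cnj (ordering_character x) * ordering_character x"
    using x by (simp add: ordering_character_mult star_closed ordering_character_star)
  then have "(cmod (ordering_character x))\<^sup>2 = cmod (ordering_character (star A x \<otimes> x))"
    by (simp add: norm_mult power2_eq_square)
  also have "\<dots> \<le> anorm A (star A x \<otimes> x)"
    by (rule ordering_character_selfadjoint_bound[OF selfadjoint_star_mult[OF x]])
  finally show "(cmod (ordering_character x))\<^sup>2 \<le> (anorm A x)\<^sup>2" by (simp add: cstar_identity[OF x])
qed

lemma ordering_character_in_characters: "ordering_character \<in> characters A"
proof -
  have "\<exists>x\<in>carrier A. ordering_character x \<noteq> 0"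
    using ordering_character_real_scalar[of 1] real_scalar_carrier[of 1] by (intro bexI[of _ "real_scalar 1"]) simp_all
  moreover have "ordering_character \<in> extensional (carrier A)" by (simp add: ordering_character_def)
  ultimately show ?thesis
    using ordering_character_add ordering_character_smult ordering_character_mult
      bounded_functional_continuous[OF ordering_character_add ordering_character_smult ordering_character_bound]
    by (simp add: characters_def)
qed

end

section \<open>The Positivstellensatz and the topology of the spectrum\<close>

context cstar
begin

text \<open>Descent on \<open>r\<close> in \<open>b + r \<in> T\<close>, for \<open>T\<close> the cone of sums of squares: a certificate \<open>b t = 1 + s\<close>
  and \<open>t \<le> N\<close> allow \<open>r\<close> to be lowered by \<open>1 / N\<close>, since
  \<open>N (b + r) - 1 = (N - t) (b + r) + s + r t\<close>.\<close>

lemma squares_cone_certificate: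
  assumes b: "b \<in> selfadjoint" and s: "s \<in> squares_cone" and t: "t \<in> squares_cone"
    and bt: "b \<otimes> t = \<one> \<oplus> s"
  shows "b \<in> squares_cone"
proof (rule ccontr)
  assume nb: "b \<notin> squares_cone"
  note P = preordering_squares_cone and D = preorderingD[OF preordering_squares_cone]
  have bc: "b \<in> carrier A" using b by (rule selfadjointD)
  have sc: "s \<in> carrier A" and tc: "t \<in> carrier A" using s t D(2) by auto
  obtain N where N: "0 < N" "real_scalar N \<ominus> t \<in> squares_cone"
    using selfadjoint_bounded[OF squares_cone_selfadjoint[OF t]] by blast
  obtain r0 where r0: "real_scalar r0 \<oplus> b \<in> squares_cone" using selfadjoint_bounded[OF b] by blast
  \<comment> \<open>Because b is assumed outside the cone, r cannot be negative: adding the scalar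
    -r would bring b back in. This keeps r t a sum of squares during the descent, and it is what the
    descent finally contradicts.\<close>
  have nonneg: "0 \<le> r" if "b \<oplus> real_scalar r \<in> squares_cone" for r
  proof (rule ccontr)
    assume "\<not> 0 \<le> r"
    then have "(b \<oplus> real_scalar r) \<oplus> real_scalar (- r) \<in> squares_cone"
      using D(4)[OF that preordering_scalar[OF P, of "- r"]] by simp
    moreover have "(b \<oplus> real_scalar r) \<oplus> real_scalar (- r) = b"
      using bc by (simp add: a_assoc real_scalar_carrier real_scalar_add real_scalar_0)
    ultimately show False using nb by simp
  qed
  have step: "b \<oplus> real_scalar (r - 1 / N) \<in> squares_cone" if br: "b \<oplus> real_scalar r \<in> squares_cone" for r
  proof -
    define n \<rho> where "n = real_scalar N" and "\<rho> = real_scalar r"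
    have c: "n \<in> carrier A" "\<rho> \<in> carrier A" by (simp_all add: n_def \<rho>_def real_scalar_carrier)
    have \<rho>: "\<rho> \<in> squares_cone" unfolding \<rho>_def by (rule preordering_scalar[OF P nonneg[OF br]])
    let ?X = "(n \<ominus> t) \<otimes> (b \<oplus> \<rho>) \<oplus> (s \<oplus> \<rho> \<otimes> t)"
    have X: "?X \<in> squares_cone"
      using D(4)[OF D(5)[OF N(2)[folded n_def] br[folded \<rho>_def]] D(4)[OF s D(5)[OF \<rho> t]]] .
    have "?X = (n \<otimes> (b \<oplus> \<rho>) \<oplus> s) \<ominus> b \<otimes> t" using bc sc tc c by algebra
    also have "\<dots> = n \<otimes> (b \<oplus> \<rho>) \<ominus> \<one>" unfolding bt using bc sc c by algebra
    finally have eq: "?X = n \<otimes> (b \<oplus> \<rho>) \<ominus> \<one>" .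
    have "complex_of_real (1 / N) \<odot> ?X \<in> squares_cone"
      using N(1) by (intro preordering_smult[OF P _ X]) simp
    moreover have "complex_of_real (1 / N) \<odot> ?X = real_scalar (1 / N) \<otimes> (n \<otimes> (b \<oplus> \<rho>) \<ominus> \<one>)"
      unfolding eq using bc c by (simp add: real_scalar_mult del: of_real_divide)
    moreover have "real_scalar (1 / N) \<otimes> (n \<otimes> (b \<oplus> \<rho>) \<ominus> \<one>) = (real_scalar (1 / N) \<otimes> n) \<otimes> (b \<oplus> \<rho>) \<ominus> real_scalar (1 / N)"
      using bc c real_scalar_carrier[of "1 / N"] by algebra
    moreover have "real_scalar (1 / N) \<otimes> n = \<one>"
      using N(1) by (simp add: n_def real_scalar_mult real_scalar_carrier real_scalar_smult real_scalar_1 del: of_real_divide)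
    moreover have "\<one> \<otimes> (b \<oplus> \<rho>) \<ominus> real_scalar (1 / N) = b \<oplus> (\<rho> \<ominus> real_scalar (1 / N))"
      using bc c real_scalar_carrier[of "1 / N"] by algebra
    ultimately show ?thesis by (simp add: \<rho>_def real_scalar_diff)
  qed
  have all: "b \<oplus> real_scalar (r0 - real n / N) \<in> squares_cone" for n
  proof (induction n)
    case 0
    then show ?case using r0 bc by (simp add: a_comm real_scalar_carrier)
  next
    case (Suc n)
    from step[OF Suc] show ?case by (simp add: add_divide_distrib algebra_simps)
  qed
  obtain n :: nat where "r0 * N < n" using reals_Archimedean2 by blast
  with N(1) have "r0 - real n / N < 0" by (simp add: field_simps)
  with nonneg[OF all[of n]] show False by simp
qed

text \<open>This replaces the Gelfand isomorphism in what follows.\<close>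

theorem character_positive_imp_squares_cone:
  assumes b: "b \<in> selfadjoint" and pos: "\<And>\<psi>. \<psi> \<in> characters A \<Longrightarrow> 0 < Re (\<psi> b)"
  shows "b \<in> squares_cone"
proof -
  have bc: "b \<in> carrier A" using b by (rule selfadjointD)
  note ext = preordering_extend[OF preordering_squares_cone selfadjoint_neg[OF b]]
  let ?E = "{m \<oplus> (\<ominus> b) \<otimes> n | m n. m \<in> squares_cone \<and> n \<in> squares_cone}"
  show ?thesis
  \<comment> \<open>Adjoin -b to the sums of squares. If the result is improper, its representation
    of -1 is a certificate; the zero algebra, where -1 = 0, belongs here. Otherwise a maximal proper
    extension yields a character at which b is not positive.\<close>
  proof (cases "\<ominus> \<one> \<in> ?E")
    case True
    then obtain s t where st: "s \<in> squares_cone" "t \<in> squares_cone" "\<ominus> \<one> = s \<oplus> (\<ominus> b) \<otimes> t" by blast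
    have c: "s \<in> carrier A" "t \<in> carrier A" using st squares_cone_carrier by auto
    have "b \<otimes> t = s \<ominus> (s \<oplus> (\<ominus> b) \<otimes> t)" using bc c by algebra
    also have "\<dots> = \<one> \<oplus> s" unfolding st(3)[symmetric] using c by algebra
    finally show ?thesis using squares_cone_certificate[OF b st(1,2)] by simp
  next
    case False
    obtain M where M: "preordering M" "\<ominus> \<one> \<notin> M" "?E \<subseteq> M"
      "\<And>a. a \<in> selfadjoint \<Longrightarrow> a \<in> M \<or> \<ominus> a \<in> M"
      using preordering_maximal[OF ext(1) False] by blast
    interpret cstar_ordering A M using M by unfold_locales auto
    have "\<ominus> b \<in> M" using ext(3) M(3) by blast
    then obtain \<alpha> where \<alpha>: "0 \<le> \<alpha>" "ordering_character (\<ominus> b) = complex_of_real \<alpha>"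
      using ordering_character_M_nonneg by blast
    have "ordering_character (\<ominus> b) = - ordering_character b"
      using bc by (simp add: neg_eq_smult ordering_character_smult)
    with \<alpha>(2) have "Re (ordering_character b) = - \<alpha>" by (simp add: complex_eq_iff)
    with pos[OF ordering_character_in_characters] \<alpha>(1) show ?thesis by simp
  qed
qed

text \<open>Characters take the constant value \<open>undefined\<close> off the carrier, so adding
  those coordinates does not change the topology. The type class topology on functions gives access
  to \<open>compact\<close>, \<open>closed_Collect_eq\<close> and Stone-Weierstrass.\<close>

lemma spectrum_eq_subtopology: "spectrum A = subtopology euclidean (characters A)"
proof -
  have chars: "characters A \<subseteq> extensional (carrier A)" by (auto simp: characters_def)
  have sub: "characters A \<subseteq> topspace (product_topology (\<lambda>_. euclidean :: complex topology) (carrier A))"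
    using chars by (auto simp: PiE_def)
  have ts: "topspace (spectrum A) = characters A" "topspace (subtopology euclidean (characters A)) = characters A"
    using sub by (auto simp: spectrum_def)
  have 1: "continuous_map (spectrum A) (subtopology euclidean (characters A)) (\<lambda>\<psi>. \<psi>)"
  proof -
    have "continuous_map (spectrum A) euclidean (\<lambda>\<psi>. \<psi> x)" for x
    proof (cases "x \<in> carrier A")
      case True
      then show ?thesis unfolding spectrum_def
        by (intro continuous_map_from_subtopology continuous_map_product_projection)
    next
      case False
      have "continuous_map (spectrum A) euclidean (\<lambda>\<psi>. undefined :: complex)" by simp
      then show ?thesis
        by (rule continuous_map_eq) (use False chars ts in \<open>auto simp: extensional_def\<close>)
    qed
    then have "continuous_map (spectrum A) (product_topology (\<lambda>_. euclidean) UNIV) (\<lambda>\<psi>. \<psi>)"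
      by (simp add: continuous_map_componentwise_UNIV)
    then show ?thesis
      by (simp add: euclidean_product_topology continuous_map_in_subtopology ts)
  qed
  have 2: "continuous_map (subtopology euclidean (characters A)) (spectrum A) (\<lambda>\<psi>. \<psi>)"
    unfolding spectrum_def continuous_map_in_subtopology continuous_map_componentwise
    using chars by (auto intro!: continuous_on_subset[OF continuous_on_product_coordinates])
  have "openin (spectrum A) U \<longleftrightarrow> openin (subtopology euclidean (characters A)) U" for U
  proof
    assume U: "openin (spectrum A) U"
    have "{\<psi> \<in> topspace (subtopology euclidean (characters A)). \<psi> \<in> U} = U"
      using openin_subset[OF U] ts by auto
    with openin_continuous_map_preimage[OF 2 U] show "openin (subtopology euclidean (characters A)) U" by simp
  next
    assume U: "openin (subtopology euclidean (characters A)) U"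
    have "{\<psi> \<in> topspace (spectrum A). \<psi> \<in> U} = U" using openin_subset[OF U] ts by auto
    with openin_continuous_map_preimage[OF 1 U] show "openin (spectrum A) U" by simp
  qed
  then show ?thesis by (simp add: topology_eq)
qed

lemma topspace_spectrum: "topspace (spectrum A) = characters A"
  by (simp add: spectrum_eq_subtopology)

lemma continuous_map_spectrum_iff:
  fixes g :: "('a \<Rightarrow> complex) \<Rightarrow> 'b::topological_space"
  shows "continuous_map (spectrum A) euclidean g \<longleftrightarrow> continuous_on (characters A) g"
  by (simp add: spectrum_eq_subtopology)

lemma continuous_on_evaluation: "continuous_on S (\<lambda>\<psi> :: 'a \<Rightarrow> complex. \<psi> x)"
  by (rule continuous_on_subset[OF continuous_on_product_coordinates]) simp

text \<open>Norm continuity and being nonzero are not evidently closed conditions under pointwise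
  convergence. The norm bound and the value 1 at the unit, which replace them here, are.\<close>

lemma characters_eq: "characters A = {\<psi>. (\<forall>x. x \<notin> carrier A \<longrightarrow> \<psi> x = undefined) \<and>
    (\<forall>x\<in>carrier A. \<forall>y\<in>carrier A. \<psi> (x \<oplus> y) = \<psi> x + \<psi> y) \<and>
    (\<forall>c. \<forall>x\<in>carrier A. \<psi> (c \<odot> x) = c * \<psi> x) \<and>
    (\<forall>x\<in>carrier A. \<forall>y\<in>carrier A. \<psi> (x \<otimes> y) = \<psi> x * \<psi> y) \<and>
    \<psi> \<one> = 1 \<and> (\<forall>x\<in>carrier A. cmod (\<psi> x) \<le> anorm A x)}" (is "_ = ?R")
proof
  show "characters A \<subseteq> ?R"
    using charactersD character_one character_bound by (auto simp: extensional_def)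
  show "?R \<subseteq> characters A"
  proof
    fix \<psi> assume \<psi>: "\<psi> \<in> ?R"
    then have "continuous_map metric.mtopology euclidean \<psi>"
      by (intro bounded_functional_continuous) auto
    moreover have "\<exists>x\<in>carrier A. \<psi> x \<noteq> 0" using \<psi> by (intro bexI[of _ \<one>]) auto
    ultimately show "\<psi> \<in> characters A" using \<psi> by (simp add: characters_def extensional_def)
  qed
qed

text \<open>The Banach-Alaoglu argument: by Tychonoff a product of discs is compact, with the single
  point \<open>undefined\<close> at indices off the carrier, and the algebraic identities cut out a
  closed subset.\<close>

lemma compact_characters: "compact (characters A)"
proof -
  let ?D = "\<lambda>x. if x \<in> carrier A then cball (0::complex) (anorm A x) else {undefined}"
  have "compactin (product_topology (\<lambda>_. euclidean) UNIV) (PiE UNIV ?D)"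
    by (subst compactin_PiE) auto
  then have D: "compact (PiE UNIV ?D)" by (simp add: euclidean_product_topology)
  have cl: "closed {\<psi> :: 'a \<Rightarrow> complex. f \<psi> = g \<psi>}" if "continuous_on UNIV f" "continuous_on UNIV g"
    for f g :: "('a \<Rightarrow> complex) \<Rightarrow> complex"
    using that by (rule closed_Collect_eq)
  have "closed {\<psi> :: 'a \<Rightarrow> complex. (\<forall>x\<in>carrier A. \<forall>y\<in>carrier A. \<psi> (x \<oplus> y) = \<psi> x + \<psi> y) \<and>
    (\<forall>c. \<forall>x\<in>carrier A. \<psi> (c \<odot> x) = c * \<psi> x) \<and>
    (\<forall>x\<in>carrier A. \<forall>y\<in>carrier A. \<psi> (x \<otimes> y) = \<psi> x * \<psi> y) \<and> \<psi> \<one> = 1}" (is "closed ?C")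
    unfolding Ball_def
    by (intro closed_Collect_conj closed_Collect_all closed_Collect_imp cl continuous_intros
        continuous_on_evaluation) auto
  with D have "compact (PiE UNIV ?D \<inter> ?C)" by (rule compact_Int_closed)
  moreover have "PiE UNIV ?D \<inter> ?C = characters A"
    unfolding characters_eq by (auto simp: PiE_iff split: if_splits)
  ultimately show ?thesis by simp
qed

lemma compact_hausdorff_spectrum: "compact_hausdorff (spectrum A)"
proof
  show "compact_space (spectrum A)"
    using compact_characters by (simp add: spectrum_eq_subtopology compact_space_subtopology)
  show "Hausdorff_space (spectrum A)"
    unfolding spectrum_def by (intro Hausdorff_space_subtopology) (simp add: Hausdorff_space_product_topology)
qed

text \<open>Characters are real on self-adjoint elements, so taking real parts respects products and
  these evaluations form a real function ring. They separate characters, since two characters that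
  differ at x differ at its real or its imaginary part.\<close>

lemma selfadjoint_evaluations_dense:
  assumes g: "continuous_on (characters A) g" and e: "0 < e"
  obtains h where "h \<in> selfadjoint" "\<And>\<psi>. \<psi> \<in> characters A \<Longrightarrow> \<bar>g \<psi> - Re (\<psi> h)\<bar> < e"
proof -
  define R where "R = {f :: ('a \<Rightarrow> complex) \<Rightarrow> real. \<exists>h\<in>selfadjoint. \<forall>\<psi>\<in>characters A. f \<psi> = Re (\<psi> h)}"
  have real: "Im (\<psi> h) = 0" if "\<psi> \<in> characters A" "h \<in> selfadjoint" for \<psi> h
    using character_selfadjoint_real[OF that] .
  interpret function_ring_on R "characters A"
  proof
    show "compact (characters A)" by (rule compact_characters)
  next
    fix f assume "f \<in> R"
    then obtain h where h: "\<And>\<psi>. \<psi> \<in> characters A \<Longrightarrow> f \<psi> = Re (\<psi> h)" by (auto simp: R_def)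
    have "continuous_on (characters A) (\<lambda>\<psi>. Re (\<psi> h))" by (intro continuous_intros continuous_on_evaluation)
    then show "continuous_on (characters A) f" using h by (simp cong: continuous_on_cong)
  next
    fix f k assume "f \<in> R" "k \<in> R"
    then obtain a b where a: "a \<in> selfadjoint" "\<And>\<psi>. \<psi> \<in> characters A \<Longrightarrow> f \<psi> = Re (\<psi> a)"
      and b: "b \<in> selfadjoint" "\<And>\<psi>. \<psi> \<in> characters A \<Longrightarrow> k \<psi> = Re (\<psi> b)" by (auto simp: R_def)
    have c: "a \<in> carrier A" "b \<in> carrier A" using a b selfadjointD by auto
    have "\<forall>\<psi>\<in>characters A. f \<psi> + k \<psi> = Re (\<psi> (a \<oplus> b))"
      using a b c by (simp add: charactersD(2))
    with selfadjoint_add[OF a(1) b(1)] show "(\<lambda>\<psi>. f \<psi> + k \<psi>) \<in> R" unfolding R_def by blast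
    have "\<forall>\<psi>\<in>characters A. f \<psi> * k \<psi> = Re (\<psi> (a \<otimes> b))"
      using a b c real by (simp add: charactersD(4))
    with selfadjoint_mult[OF a(1) b(1)] show "(\<lambda>\<psi>. f \<psi> * k \<psi>) \<in> R" unfolding R_def by blast
  next
    fix c :: real
    have "\<forall>\<psi>\<in>characters A. c = Re (\<psi> (real_scalar c))" by (simp add: real_scalar_def character_scalar)
    with real_scalar_selfadjoint[of c] show "(\<lambda>_. c) \<in> R" unfolding R_def by blast
  next
    fix \<psi> \<phi> assume \<psi>: "\<psi> \<in> characters A" and \<phi>: "\<phi> \<in> characters A" and "\<psi> \<noteq> \<phi>"
    then obtain x where x: "x \<in> carrier A" "\<psi> x \<noteq> \<phi> x"
      using charactersD(1)[OF \<psi>] charactersD(1)[OF \<phi>] extensionalityI by blast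
    obtain h k where hk: "h \<in> selfadjoint" "k \<in> selfadjoint" "x = h \<oplus> \<i> \<odot> k"
      using selfadjoint_decomposition[OF x(1)] by metis
    have c: "h \<in> carrier A" "k \<in> carrier A" using hk selfadjointD by auto
    have "\<psi> h \<noteq> \<phi> h \<or> \<psi> k \<noteq> \<phi> k"
      using x(2) c unfolding hk(3) by (auto simp: charactersD(2,3)[OF \<psi>] charactersD(2,3)[OF \<phi>] smult_carrier)
    then obtain a where a: "a \<in> selfadjoint" "\<psi> a \<noteq> \<phi> a" using hk by blast
    then have "Re (\<psi> a) \<noteq> Re (\<phi> a)" using real[OF \<psi> a(1)] real[OF \<phi> a(1)] by (simp add: complex_eq_iff)
    moreover have "(\<lambda>\<psi>. Re (\<psi> a)) \<in> R" using a by (auto simp: R_def)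
    ultimately show "\<exists>f\<in>R. f \<psi> \<noteq> f \<phi>" by (intro bexI[of _ "\<lambda>\<psi>. Re (\<psi> a)"])
  qed
  obtain f where "f \<in> R" "\<forall>\<psi>\<in>characters A. \<bar>g \<psi> - f \<psi>\<bar> < e"
    using Stone_Weierstrass_basic[OF g e] by blast
  then show thesis using that by (auto simp: R_def)
qed

end

section \<open>States and their representing measures\<close>

lemma small_difference_imp_eq:
  fixes a b c :: real
  assumes "\<And>e. 0 < e \<Longrightarrow> \<bar>a - b\<bar> \<le> c * e"
  shows "a = b"
proof (rule ccontr)
  assume ne: "a \<noteq> b"
  \<comment> \<open>Adding 1 keeps the denominator of e positive for every c; the lemma is applied
    with a constant that may be 0.\<close>
  define q where "q = \<bar>c\<bar> + 1"
  define e where "e = \<bar>a - b\<bar> / (2 * q)"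
  have q: "0 < q" by (simp add: q_def)
  have e: "0 < e" using ne q by (simp add: e_def)
  have "c * e \<le> q * e" using e by (intro mult_right_mono) (auto simp: q_def)
  also have "\<dots> = \<bar>a - b\<bar> / 2" using q by (simp add: e_def)
  finally show False using assms[OF e] ne by simp
qed

locale cstar_state = cstar A for A :: "'a cstar" (structure) +
  fixes \<phi> :: "'a \<Rightarrow> complex"
  assumes state_add: "\<lbrakk>x \<in> carrier A; y \<in> carrier A\<rbrakk> \<Longrightarrow> \<phi> (x \<oplus> y) = \<phi> x + \<phi> y"
    and state_smult: "x \<in> carrier A \<Longrightarrow> \<phi> (c \<odot> x) = c * \<phi> x"
    and state_one: "\<phi> \<one> = 1"
    and state_positive: "x \<in> carrier A \<Longrightarrow> Im (\<phi> (star A x \<otimes> x)) = 0 \<and> 0 \<le> Re (\<phi> (star A x \<otimes> x))"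
begin

lemma state_real_scalar: "\<phi> (real_scalar r) = complex_of_real r"
  by (simp add: real_scalar_def state_smult state_one)

lemma state_diff: "\<lbrakk>x \<in> carrier A; y \<in> carrier A\<rbrakk> \<Longrightarrow> \<phi> (x \<ominus> y) = \<phi> x - \<phi> y"
  by (simp add: minus_eq state_add neg_eq_smult smult_carrier state_smult)

lemma state_squares_cone: "t \<in> squares_cone \<Longrightarrow> Im (\<phi> t) = 0 \<and> 0 \<le> Re (\<phi> t)"
  by (induction rule: squares_cone.induct) (auto simp: state_positive state_add squares_cone_carrier)

lemma state_selfadjoint_real:
  assumes h: "h \<in> selfadjoint"
  shows "Im (\<phi> h) = 0"
proof -
  obtain N where "real_scalar N \<oplus> h \<in> squares_cone" using selfadjoint_bounded[OF h] by blast
  from state_squares_cone[OF this] show ?thesis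
    using selfadjointD(1)[OF h] by (simp add: state_add real_scalar_carrier state_real_scalar)
qed

text \<open>k - h + d + e is strictly positive at every character, hence a sum of squares, on which
  \<phi> is nonnegative; e then tends to 0. The slack d admits pairs h, k that are ordered only
  approximately, as approximations of continuous functions are.\<close>

lemma state_mono:
  assumes h: "h \<in> selfadjoint" and k: "k \<in> selfadjoint"
    and le: "\<And>\<psi>. \<psi> \<in> characters A \<Longrightarrow> Re (\<psi> h) \<le> Re (\<psi> k) + d"
  shows "Re (\<phi> h) \<le> Re (\<phi> k) + d"
proof (rule field_le_epsilon)
  fix e :: real assume e: "0 < e"
  have c: "h \<in> carrier A" "k \<in> carrier A" using h k selfadjointD by auto
  have "(k \<ominus> h) \<oplus> real_scalar (d + e) \<in> squares_cone"
  proof (rule character_positive_imp_squares_cone)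
    show "(k \<ominus> h) \<oplus> real_scalar (d + e) \<in> selfadjoint"
      by (intro selfadjoint_add selfadjoint_diff h k real_scalar_selfadjoint)
    fix \<psi> assume \<psi>: "\<psi> \<in> characters A"
    have "\<psi> ((k \<ominus> h) \<oplus> real_scalar (d + e)) = \<psi> k - \<psi> h + complex_of_real (d + e)"
      unfolding real_scalar_def using c
      by (simp add: charactersD(2)[OF \<psi>] character_diff[OF \<psi>] character_scalar[OF \<psi>] scalar_carrier)
    with le[OF \<psi>] e show "0 < Re (\<psi> ((k \<ominus> h) \<oplus> real_scalar (d + e)))" by simp
  qed
  from state_squares_cone[OF this] show "Re (\<phi> h) \<le> Re (\<phi> k) + d + e"
    using c by (simp add: state_add state_diff real_scalar_carrier state_real_scalar)
qed

text \<open>The upper extension of the state. A direct formula avoids choosing approximating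
  sequences and showing that the limit does not depend on them.\<close>

definition state_extension :: "(('a \<Rightarrow> complex) \<Rightarrow> real) \<Rightarrow> real" where
  "state_extension g = Inf {Re (\<phi> h) | h. h \<in> selfadjoint \<and> (\<forall>\<psi>\<in>characters A. g \<psi> \<le> Re (\<psi> h))}"

text \<open>h + e competes in the infimum, which bounds it above; every competitor k satisfies h
  \<le> k + e on characters, and \<open>state_mono\<close> bounds the infimum below. All properties
  of the extension are derived from this estimate.\<close>

lemma state_extension_approx:
  assumes h: "h \<in> selfadjoint" and close: "\<And>\<psi>. \<psi> \<in> characters A \<Longrightarrow> \<bar>g \<psi> - Re (\<psi> h)\<bar> \<le> e"
  shows "\<bar>state_extension g - Re (\<phi> h)\<bar> \<le> e"
proof -
  let ?S = "{Re (\<phi> h) | h. h \<in> selfadjoint \<and> (\<forall>\<psi>\<in>characters A. g \<psi> \<le> Re (\<psi> h))}"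
  have hc: "h \<in> carrier A" using h by (rule selfadjointD)
  have lower: "Re (\<phi> h) - e \<le> s" if s: "s \<in> ?S" for s
  proof -
    from s obtain k where k: "k \<in> selfadjoint" "\<And>\<psi>. \<psi> \<in> characters A \<Longrightarrow> g \<psi> \<le> Re (\<psi> k)" "s = Re (\<phi> k)"
      by blast
    have "Re (\<phi> h) \<le> Re (\<phi> k) + e"
      using close k(2) by (intro state_mono[OF h k(1)]) (smt (verit))
    then show ?thesis using k(3) by simp
  qed
  have "Re (\<phi> (h \<oplus> real_scalar e)) \<in> ?S"
  proof -
    have "g \<psi> \<le> Re (\<psi> (h \<oplus> real_scalar e))" if "\<psi> \<in> characters A" for \<psi>
    proof -
      have "\<psi> (h \<oplus> real_scalar e) = \<psi> h + complex_of_real e"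
        unfolding real_scalar_def by (simp add: charactersD(2)[OF that hc scalar_carrier] character_scalar[OF that])
      then show ?thesis using close[OF that] by simp
    qed
    with selfadjoint_add[OF h real_scalar_selfadjoint] show ?thesis by blast
  qed
  then have mem: "Re (\<phi> h) + e \<in> ?S"
    using hc by (simp add: state_add real_scalar_carrier state_real_scalar)
  have "Re (\<phi> h) - e \<le> state_extension g"
    unfolding state_extension_def using mem lower by (intro cInf_greatest) auto
  moreover have "state_extension g \<le> Re (\<phi> h) + e"
    unfolding state_extension_def using mem lower by (intro cInf_lower bdd_belowI) auto
  ultimately show ?thesis by linarith
qed

lemma state_extension_eq:
  assumes "h \<in> selfadjoint" "\<And>\<psi>. \<psi> \<in> characters A \<Longrightarrow> g \<psi> = Re (\<psi> h)"
  shows "state_extension g = Re (\<phi> h)"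
  using state_extension_approx[OF assms(1), of g 0] assms(2) by simp

lemma positive_functional_state_extension: "normalized_positive_functional (spectrum A) state_extension"
proof -
  interpret compact_hausdorff "spectrum A" by (rule compact_hausdorff_spectrum)
  show ?thesis
  proof
    fix f g assume "continuous_map (spectrum A) euclideanreal f" "continuous_map (spectrum A) euclideanreal g"
    then have f: "continuous_on (characters A) f" and g: "continuous_on (characters A) g"
      by (auto simp: continuous_map_spectrum_iff)
    show "state_extension (\<lambda>\<psi>. f \<psi> + g \<psi>) = state_extension f + state_extension g"
    \<comment> \<open>The factor 4 is 2 for the sum, approximated by h + k, plus 1 for each
      summand.\<close>
    proof (rule small_difference_imp_eq[of _ _ 4])
      fix e :: real assume e: "0 < e"
      obtain h where h: "h \<in> selfadjoint" "\<And>\<psi>. \<psi> \<in> characters A \<Longrightarrow> \<bar>f \<psi> - Re (\<psi> h)\<bar> < e"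
        using selfadjoint_evaluations_dense[OF f e] by blast
      obtain k where k: "k \<in> selfadjoint" "\<And>\<psi>. \<psi> \<in> characters A \<Longrightarrow> \<bar>g \<psi> - Re (\<psi> k)\<bar> < e"
        using selfadjoint_evaluations_dense[OF g e] by blast
      have c: "h \<in> carrier A" "k \<in> carrier A" using h k selfadjointD by auto
      have "\<bar>state_extension (\<lambda>\<psi>. f \<psi> + g \<psi>) - Re (\<phi> (h \<oplus> k))\<bar> \<le> 2 * e"
      proof (rule state_extension_approx[OF selfadjoint_add[OF h(1) k(1)]])
        fix \<psi> assume \<psi>: "\<psi> \<in> characters A"
        have "\<psi> (h \<oplus> k) = \<psi> h + \<psi> k" by (rule charactersD(2)[OF \<psi> c])
        with h(2)[OF \<psi>] k(2)[OF \<psi>] show "\<bar>f \<psi> + g \<psi> - Re (\<psi> (h \<oplus> k))\<bar> \<le> 2 * e" by simp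
      qed
      moreover have "\<bar>state_extension f - Re (\<phi> h)\<bar> \<le> e"
        using h(2) by (intro state_extension_approx[OF h(1)]) (simp add: less_imp_le)
      moreover have "\<bar>state_extension g - Re (\<phi> k)\<bar> \<le> e"
        using k(2) by (intro state_extension_approx[OF k(1)]) (simp add: less_imp_le)
      ultimately show "\<bar>state_extension (\<lambda>\<psi>. f \<psi> + g \<psi>) - (state_extension f + state_extension g)\<bar> \<le> 4 * e"
        by (simp add: state_add c)
    qed
  next
    fix f and c :: real assume "continuous_map (spectrum A) euclideanreal f"
    then have f: "continuous_on (characters A) f" by (simp add: continuous_map_spectrum_iff)
    show "state_extension (\<lambda>\<psi>. c * f \<psi>) = c * state_extension f"
    proof (rule small_difference_imp_eq[of _ _ "2 * \<bar>c\<bar>"])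
      fix e :: real assume e: "0 < e"
      obtain h where h: "h \<in> selfadjoint" "\<And>\<psi>. \<psi> \<in> characters A \<Longrightarrow> \<bar>f \<psi> - Re (\<psi> h)\<bar> < e"
        using selfadjoint_evaluations_dense[OF f e] by blast
      have hc: "h \<in> carrier A" using h selfadjointD by auto
      have "\<bar>state_extension (\<lambda>\<psi>. c * f \<psi>) - Re (\<phi> (complex_of_real c \<odot> h))\<bar> \<le> \<bar>c\<bar> * e"
      proof (rule state_extension_approx[OF selfadjoint_smult[OF h(1)]])
        fix \<psi> assume \<psi>: "\<psi> \<in> characters A"
        have "\<bar>c * f \<psi> - Re (\<psi> (complex_of_real c \<odot> h))\<bar> = \<bar>c\<bar> * \<bar>f \<psi> - Re (\<psi> h)\<bar>"
          by (simp add: charactersD(3)[OF \<psi> hc] abs_mult[symmetric] right_diff_distrib)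
        also have "\<dots> \<le> \<bar>c\<bar> * e" using h(2)[OF \<psi>] by (intro mult_left_mono) auto
        finally show "\<bar>c * f \<psi> - Re (\<psi> (complex_of_real c \<odot> h))\<bar> \<le> \<bar>c\<bar> * e" .
      qed
      moreover have "\<bar>c * state_extension f - c * Re (\<phi> h)\<bar> \<le> \<bar>c\<bar> * e"
      proof -
        have "\<bar>state_extension f - Re (\<phi> h)\<bar> \<le> e"
          using h(2) by (intro state_extension_approx[OF h(1)]) (simp add: less_imp_le)
        then have "\<bar>c\<bar> * \<bar>state_extension f - Re (\<phi> h)\<bar> \<le> \<bar>c\<bar> * e" by (intro mult_left_mono) auto
        then show ?thesis by (simp add: abs_mult[symmetric] right_diff_distrib)
      qed
      ultimately show "\<bar>state_extension (\<lambda>\<psi>. c * f \<psi>) - c * state_extension f\<bar> \<le> 2 * \<bar>c\<bar> * e"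
        by (simp add: state_smult hc)
    qed
  next
    fix f g assume "continuous_map (spectrum A) euclideanreal f" "continuous_map (spectrum A) euclideanreal g"
      and le: "\<And>\<psi>. \<psi> \<in> topspace (spectrum A) \<Longrightarrow> f \<psi> \<le> g \<psi>"
    then have f: "continuous_on (characters A) f" and g: "continuous_on (characters A) g"
      by (auto simp: continuous_map_spectrum_iff)
    show "state_extension f \<le> state_extension g"
    proof (rule field_le_epsilon)
      fix d :: real assume "0 < d"
      \<comment> \<open>Comparing h with k on characters costs two quarters of d, and replacing the
        two extensions by the values of \<phi> costs the other two.\<close>
      then have e: "0 < d / 4" by simp
      obtain h where h: "h \<in> selfadjoint" "\<And>\<psi>. \<psi> \<in> characters A \<Longrightarrow> \<bar>f \<psi> - Re (\<psi> h)\<bar> < d / 4"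
        using selfadjoint_evaluations_dense[OF f e] by blast
      obtain k where k: "k \<in> selfadjoint" "\<And>\<psi>. \<psi> \<in> characters A \<Longrightarrow> \<bar>g \<psi> - Re (\<psi> k)\<bar> < d / 4"
        using selfadjoint_evaluations_dense[OF g e] by blast
      have "Re (\<phi> h) \<le> Re (\<phi> k) + d / 2"
      proof (rule state_mono[OF h(1) k(1)])
        fix \<psi> assume \<psi>: "\<psi> \<in> characters A"
        then show "Re (\<psi> h) \<le> Re (\<psi> k) + d / 2"
          using h(2)[OF \<psi>] k(2)[OF \<psi>] le[of \<psi>] unfolding topspace_spectrum abs_less_iff by simp
      qed
      moreover have "\<bar>state_extension f - Re (\<phi> h)\<bar> \<le> d / 4"
        using h(2) by (intro state_extension_approx[OF h(1)]) (simp add: less_imp_le)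
      moreover have "\<bar>state_extension g - Re (\<phi> k)\<bar> \<le> d / 4"
        using k(2) by (intro state_extension_approx[OF k(1)]) (simp add: less_imp_le)
      ultimately show "state_extension f \<le> state_extension g + d" by linarith
    qed
  next
    show "state_extension (\<lambda>_. 1) = 1"
      using state_extension_eq[OF real_scalar_selfadjoint[of 1], of "\<lambda>_. 1"]
      by (simp add: state_real_scalar) (simp add: real_scalar_def character_scalar)
  qed
qed

end

section \<open>Regular measures on the spectrum are determined by evaluations\<close>

context cstar
begin

lemma continuous_map_evaluation: "continuous_map (spectrum A) euclidean (\<lambda>\<psi>. \<psi> x)"
  by (simp add: continuous_map_spectrum_iff continuous_on_evaluation)

lemma integrable_evaluation: "M \<in> prob_meas (spectrum A) \<Longrightarrow> integrable M (\<lambda>\<psi>. \<psi> x)"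
  by (rule integrable_continuous_map[OF compact_hausdorff.compact_X[OF compact_hausdorff_spectrum]
        _ _ continuous_map_evaluation]) (auto simp: prob_meas_def)

lemma integral_evaluation_decomposition:
  assumes M: "M \<in> prob_meas (spectrum A)" and c: "h \<in> carrier A" "k \<in> carrier A"
  shows "(LINT \<psi>|M. \<psi> (h \<oplus> \<i> \<odot> k)) = (LINT \<psi>|M. \<psi> h) + \<i> * (LINT \<psi>|M. \<psi> k)"
proof -
  have "(LINT \<psi>|M. \<psi> (h \<oplus> \<i> \<odot> k)) = (LINT \<psi>|M. \<psi> h + \<i> * \<psi> k)"
  proof (rule Bochner_Integration.integral_cong[OF refl])
    fix \<psi> assume "\<psi> \<in> space M"
    then have "\<psi> \<in> characters A" using M by (simp add: prob_meas_def topspace_spectrum)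
    then show "\<psi> (h \<oplus> \<i> \<odot> k) = \<psi> h + \<i> * \<psi> k" using c by (simp add: charactersD(2,3) smult_carrier)
  qed
  then show ?thesis using integrable_evaluation[OF M] by simp
qed

lemma integral_evaluation_selfadjoint:
  assumes M: "M \<in> prob_meas (spectrum A)" and h: "h \<in> selfadjoint"
  shows "(LINT \<psi>|M. \<psi> h) = complex_of_real (LINT \<psi>|M. Re (\<psi> h))"
proof -
  have "(LINT \<psi>|M. \<psi> h) = (LINT \<psi>|M. complex_of_real (Re (\<psi> h)))"
  proof (rule Bochner_Integration.integral_cong[OF refl])
    fix \<psi> assume "\<psi> \<in> space M"
    then have "\<psi> \<in> characters A" using M by (simp add: prob_meas_def topspace_spectrum)
    then show "\<psi> h = complex_of_real (Re (\<psi> h))"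
      using character_selfadjoint_real[OF _ h] by (simp add: complex_eq_iff)
  qed
  then show ?thesis by simp
qed

lemma integral_near_evaluation:
  assumes M: "M \<in> prob_meas (spectrum A)" and g: "continuous_map (spectrum A) euclideanreal g"
    and h: "h \<in> selfadjoint" and close: "\<And>\<psi>. \<psi> \<in> characters A \<Longrightarrow> \<bar>g \<psi> - Re (\<psi> h)\<bar> \<le> e"
  shows "\<bar>(LINT \<psi>|M. g \<psi>) - Re (LINT \<psi>|M. \<psi> h)\<bar> \<le> e"
proof -
  interpret prob_space M using M by (simp add: prob_meas_def)
  have sp: "space M = characters A" using M by (simp add: prob_meas_def topspace_spectrum)
  have ig: "integrable M g"
    using M g compact_hausdorff.compact_X[OF compact_hausdorff_spectrum]
    by (intro integrable_continuous_map) (auto simp: prob_meas_def)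
  have ih: "integrable M (\<lambda>\<psi>. Re (\<psi> h))" using integrable_evaluation[OF M] by simp
  have "(LINT \<psi>|M. g \<psi>) - Re (LINT \<psi>|M. \<psi> h) = (LINT \<psi>|M. g \<psi> - Re (\<psi> h))"
    using ig ih by (simp add: integral_evaluation_selfadjoint[OF M h])
  also have "\<bar>\<dots>\<bar> \<le> (LINT \<psi>|M. \<bar>g \<psi> - Re (\<psi> h)\<bar>)" by (rule integral_abs_bound)
  also have "\<dots> \<le> (LINT \<psi>|M. e)"
    using ig ih close by (intro integral_mono) (auto simp: sp)
  finally show ?thesis by (simp add: prob_space)
qed

text \<open>Self-adjoint evaluations are uniformly dense in the continuous real functions, so they
  fix all integrals that \<open>open_regular_eqI\<close> asks for.\<close>

lemma prob_meas_spectrum_eqI: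
  assumes M: "M \<in> prob_meas (spectrum A)" and N: "N \<in> prob_meas (spectrum A)"
    and eq: "\<And>h. h \<in> selfadjoint \<Longrightarrow> (LINT \<psi>|M. \<psi> h) = (LINT \<psi>|N. \<psi> h)"
  shows "M = N"
proof -
  interpret compact_hausdorff "spectrum A" by (rule compact_hausdorff_spectrum)
  show ?thesis
  proof (rule open_regular_eqI[OF prob_meas_open_regular[OF M] prob_meas_open_regular[OF N]])
    fix g assume g: "continuous_map (spectrum A) euclideanreal g"
    then have cg: "continuous_on (characters A) g" by (simp add: continuous_map_spectrum_iff)
    show "(LINT \<psi>|M. g \<psi>) = (LINT \<psi>|N. g \<psi>)"
    proof (rule small_difference_imp_eq[of _ _ 2])
      fix e :: real assume e: "0 < e"
      obtain h where h: "h \<in> selfadjoint" "\<And>\<psi>. \<psi> \<in> characters A \<Longrightarrow> \<bar>g \<psi> - Re (\<psi> h)\<bar> < e"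
        using selfadjoint_evaluations_dense[OF cg e] by blast
      note near = integral_near_evaluation[OF _ g h(1) less_imp_le[OF h(2)]]
      from near[OF M] near[OF N] show "\<bar>(LINT \<psi>|M. g \<psi>) - (LINT \<psi>|N. g \<psi>)\<bar> \<le> 2 * e" using eq[OF h(1)] by simp
    qed
  qed
qed

end

context cstar_state
begin

theorem state_representation:
  "\<exists>!M. M \<in> prob_meas (spectrum A) \<and> (\<forall>x\<in>carrier A. (LINT \<psi>|M. \<psi> x) = \<phi> x)"
proof (rule ex_ex1I)
  interpret normalized_positive_functional "spectrum A" state_extension
    by (rule positive_functional_state_extension)
  note M = rep_measure_prob_meas
  have sa: "(LINT \<psi>|rep_measure. \<psi> h) = \<phi> h" if h: "h \<in> selfadjoint" for h
  proof -
    have "(LINT \<psi>|rep_measure. Re (\<psi> h)) = state_extension (\<lambda>\<psi>. Re (\<psi> h))"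
      by (intro integral_rep_measure) (simp add: continuous_map_spectrum_iff continuous_on_Re continuous_on_evaluation)
    also have "\<dots> = Re (\<phi> h)" by (rule state_extension_eq[OF h refl])
    finally show ?thesis
      using state_selfadjoint_real[OF h] by (simp add: integral_evaluation_selfadjoint[OF M h] complex_eq_iff)
  qed
  have "(LINT \<psi>|rep_measure. \<psi> x) = \<phi> x" if x: "x \<in> carrier A" for x
  proof -
    obtain h k where hk: "h \<in> selfadjoint" "k \<in> selfadjoint" "x = h \<oplus> \<i> \<odot> k"
      using selfadjoint_decomposition[OF x] by metis
    have c: "h \<in> carrier A" "k \<in> carrier A" using hk selfadjointD by auto
    show ?thesis
      unfolding hk(3) integral_evaluation_decomposition[OF M c] sa[OF hk(1)] sa[OF hk(2)]
      using c by (simp add: state_add state_smult smult_carrier)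
  qed
  with M show "\<exists>M. M \<in> prob_meas (spectrum A) \<and> (\<forall>x\<in>carrier A. (LINT \<psi>|M. \<psi> x) = \<phi> x)" by blast
next
  fix M N assume M: "M \<in> prob_meas (spectrum A) \<and> (\<forall>x\<in>carrier A. (LINT \<psi>|M. \<psi> x) = \<phi> x)"
    and N: "N \<in> prob_meas (spectrum A) \<and> (\<forall>x\<in>carrier A. (LINT \<psi>|N. \<psi> x) = \<phi> x)"
  show "M = N"
    by (rule prob_meas_spectrum_eqI) (use M N selfadjointD(1) in auto)
qed

end

section \<open>The spectrum functor\<close>

lemma pos_unital_mapsD:
  assumes "f \<in> pos_unital_maps B A"
  shows "f \<in> extensional (carrier B)" "x \<in> carrier B \<Longrightarrow> f x \<in> carrier A"
    "\<lbrakk>x \<in> carrier B; y \<in> carrier B\<rbrakk> \<Longrightarrow> f (x \<oplus>\<^bsub>B\<^esub> y) = f x \<oplus>\<^bsub>A\<^esub> f y"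
    "x \<in> carrier B \<Longrightarrow> f (c \<odot>\<^bsub>B\<^esub> x) = c \<odot>\<^bsub>A\<^esub> f x"
    "\<exists>K. \<forall>x\<in>carrier B. anorm A (f x) \<le> K * anorm B x"
    "f \<one>\<^bsub>B\<^esub> = \<one>\<^bsub>A\<^esub>"
    "x \<in> carrier B \<Longrightarrow> f (star B x \<otimes>\<^bsub>B\<^esub> x) \<in> positive_elements A"
  using assms by (auto simp: pos_unital_maps_def PiE_def)

lemma cstar_of_comm_cstar_algebra: "comm_cstar_algebra A \<Longrightarrow> cstar A"
  by (simp add: cstar_def)

section \<open>The category of algebras and its opposite\<close>

lemma identity_pos_unital_map:
  assumes "comm_cstar_algebra A"
  shows "(\<lambda>x\<in>carrier A. x) \<in> pos_unital_maps A A"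
proof -
  interpret cstar A using assms by (rule cstar_of_comm_cstar_algebra)
  have "\<exists>K. \<forall>x\<in>carrier A. anorm A ((\<lambda>x\<in>carrier A. x) x) \<le> K * anorm A x" by (intro exI[of _ 1]) simp
  then show ?thesis
    unfolding pos_unital_maps_def
    by (auto simp: smult_carrier star_closed positive_elements_def)
qed

lemma compose_pos_unital_maps:
  assumes "comm_cstar_algebra A" "comm_cstar_algebra B" "comm_cstar_algebra C"
    and f: "f \<in> pos_unital_maps A B" and g: "g \<in> pos_unital_maps B C"
  shows "compose (carrier A) g f \<in> pos_unital_maps A C"
proof -
  interpret A: cstar A using assms(1) by (rule cstar_of_comm_cstar_algebra)
  interpret B: cstar B using assms(2) by (rule cstar_of_comm_cstar_algebra)
  interpret C: cstar C using assms(3) by (rule cstar_of_comm_cstar_algebra)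
  note F = pos_unital_mapsD[OF f] and G = pos_unital_mapsD[OF g]
  obtain K where K: "\<And>x. x \<in> carrier A \<Longrightarrow> anorm B (f x) \<le> K * anorm A x" using F(5) by blast
  obtain L where L: "\<And>x. x \<in> carrier B \<Longrightarrow> anorm C (g x) \<le> L * anorm B x" using G(5) by blast
  have bound: "anorm C (g (f x)) \<le> (\<bar>L\<bar> * K) * anorm A x" if x: "x \<in> carrier A" for x
  proof -
    have "anorm C (g (f x)) \<le> L * anorm B (f x)" by (rule L[OF F(2)[OF x]])
    also have "\<dots> \<le> \<bar>L\<bar> * anorm B (f x)" by (intro mult_right_mono B.anorm_nonneg F(2) x) simp
    also have "\<dots> \<le> \<bar>L\<bar> * (K * anorm A x)" by (intro mult_left_mono K x) simp
    finally show ?thesis by simp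
  qed
  have pos: "g (f (star A x \<otimes>\<^bsub>A\<^esub> x)) \<in> positive_elements C" if "x \<in> carrier A" for x
    using F(7)[OF that] G(7) by (auto simp: positive_elements_def)
  show ?thesis
    unfolding pos_unital_maps_def
    using F G pos bound
    by (auto simp: compose_def A.smult_carrier A.star_closed intro!: exI[of _ "\<bar>L\<bar> * K"])
qed

lemma category_cCstarAlgPos: "category cCstarAlgPos"
proof
  fix A :: "'a cstar" assume "A \<in> Obj cCstarAlgPos"
  then show "Ident cCstarAlgPos A \<in> Hom cCstarAlgPos A A"
    by (simp add: cCstarAlgPos_def identity_pos_unital_map)
next
  fix A B C :: "'a cstar" and f g
  assume "A \<in> Obj cCstarAlgPos" "B \<in> Obj cCstarAlgPos" "C \<in> Obj cCstarAlgPos"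
    "f \<in> Hom cCstarAlgPos A B" "g \<in> Hom cCstarAlgPos B C"
  then show "Comp cCstarAlgPos A B C g f \<in> Hom cCstarAlgPos A C"
    by (simp add: cCstarAlgPos_def compose_pos_unital_maps)
next
  fix A B :: "'a cstar" and f
  assume "f \<in> Hom cCstarAlgPos A B"
  then have f: "f \<in> pos_unital_maps A B" by (simp add: cCstarAlgPos_def)
  note F = pos_unital_mapsD[OF f]
  show "Comp cCstarAlgPos A B B (Ident cCstarAlgPos B) f = f"
    using F(2) by (auto simp: cCstarAlgPos_def compose_def intro!: extensionalityI[OF _ F(1)])
  show "Comp cCstarAlgPos A A B f (Ident cCstarAlgPos A) = f"
    by (auto simp: cCstarAlgPos_def compose_def intro!: extensionalityI[OF _ F(1)])
next
  fix A B C D :: "'a cstar" and f g h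
  assume "f \<in> Hom cCstarAlgPos A B"
  then have f: "f \<in> pos_unital_maps A B" by (simp add: cCstarAlgPos_def)
  show "Comp cCstarAlgPos A B D (Comp cCstarAlgPos B C D h g) f =
      Comp cCstarAlgPos A C D h (Comp cCstarAlgPos A B C g f)"
    using pos_unital_mapsD(2)[OF f] by (auto simp: cCstarAlgPos_def compose_def fun_eq_iff)
qed

lemma category_op_cat:
  assumes "category \<C>"
  shows "category (op_cat \<C>)"
proof -
  interpret category \<C> by fact
  show ?thesis
    by unfold_locales
      (auto simp: op_cat_def Ident_in_Hom Ident_left Ident_right intro: Comp_in_Hom Comp_assoc[symmetric])
qed

text \<open>f sends b* b to some a* a, whose value under \<omega> is the squared modulus of \<omega>
  a because characters respect the involution.\<close>

lemma character_pos_unital_map_state: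
  assumes "comm_cstar_algebra A" "comm_cstar_algebra B"
    and f: "f \<in> pos_unital_maps B A" and \<omega>: "\<omega> \<in> characters A"
  shows "cstar_state B (\<lambda>b. \<omega> (f b))"
proof -
  interpret A: cstar A using assms(1) by (rule cstar_of_comm_cstar_algebra)
  interpret B: cstar B using assms(2) by (rule cstar_of_comm_cstar_algebra)
  note F = pos_unital_mapsD[OF f]
  show ?thesis
  proof
    fix b assume "b \<in> carrier B"
    then obtain a where a: "a \<in> carrier A" "f (star B b \<otimes>\<^bsub>B\<^esub> b) = star A a \<otimes>\<^bsub>A\<^esub> a"
      using F(7) by (auto simp: positive_elements_def)
    then have "\<omega> (f (star B b \<otimes>\<^bsub>B\<^esub> b)) = cnj (\<omega> a) * \<omega> a"
      by (simp add: A.charactersD(4)[OF \<omega>] A.star_closed A.character_star[OF \<omega>])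
    then show "Im (\<omega> (f (star B b \<otimes>\<^bsub>B\<^esub> b))) = 0 \<and> 0 \<le> Re (\<omega> (f (star B b \<otimes>\<^bsub>B\<^esub> b)))"
      by simp
  qed (simp_all add: F A.charactersD(2,3)[OF \<omega>] A.character_one[OF \<omega>])
qed

section \<open>The stochastic map of a positive unital map, and functoriality\<close>

context
  fixes A B :: "'a cstar" and f :: "'a \<Rightarrow> 'a"
  assumes A: "comm_cstar_algebra A" and B: "comm_cstar_algebra B" and f: "f \<in> pos_unital_maps B A"
begin

interpretation A: cstar A using A by (rule cstar_of_comm_cstar_algebra)
interpretation B: cstar B using B by (rule cstar_of_comm_cstar_algebra)

lemma spectrum_map_prob_meas: "\<omega> \<in> characters A \<Longrightarrow> spectrum_map A B f \<omega> \<in> prob_meas (spectrum B)"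
  and integral_spectrum_map:
    "\<lbrakk>\<omega> \<in> characters A; b \<in> carrier B\<rbrakk> \<Longrightarrow> (LINT \<psi>|spectrum_map A B f \<omega>. \<psi> b) = \<omega> (f b)"
  using theI'[OF cstar_state.state_representation[OF character_pos_unital_map_state[OF A B f]]]
  by (auto simp: spectrum_map_def)

lemma spectrum_map_eqI:
  assumes \<omega>: "\<omega> \<in> characters A" and M: "M \<in> prob_meas (spectrum B)"
    and eq: "\<And>h. h \<in> B.selfadjoint \<Longrightarrow> (LINT \<psi>|M. \<psi> h) = \<omega> (f h)"
  shows "spectrum_map A B f \<omega> = M"
  by (rule B.prob_meas_spectrum_eqI[OF spectrum_map_prob_meas[OF \<omega>] M])
     (simp add: eq integral_spectrum_map[OF \<omega>] B.selfadjointD)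

text \<open>Uniformly on \<open>\<sigma> A\<close>, the integral of \<open>g\<close> is close to the evaluation at \<open>f h\<close> for some \<open>h\<close>.\<close>

lemma spectrum_map_stoch_maps: "spectrum_map A B f \<in> stoch_maps (spectrum A) (spectrum B)"
proof -
  interpret SB: compact_hausdorff "spectrum B" by (rule B.compact_hausdorff_spectrum)
  have "continuous_on (characters A) (\<lambda>\<omega>. LINT \<psi>|spectrum_map A B f \<omega>. g \<psi>)"
    if g: "continuous_map (spectrum B) euclideanreal g" for g
  proof -
    have "\<exists>h\<in>B.selfadjoint. \<forall>\<psi>\<in>characters B. \<bar>g \<psi> - Re (\<psi> h)\<bar> < inverse (real (Suc n))" for n
    proof -
      have cg: "continuous_on (characters B) g" using g by (simp add: B.continuous_map_spectrum_iff)
      have "0 < inverse (real (Suc n))" by simp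
      from B.selfadjoint_evaluations_dense[OF cg this] show ?thesis by metis
    qed
    then obtain h where h: "\<And>n. h n \<in> B.selfadjoint"
      "\<And>n \<psi>. \<psi> \<in> characters B \<Longrightarrow> \<bar>g \<psi> - Re (\<psi> (h n))\<bar> < inverse (real (Suc n))" by metis
    show ?thesis
    proof (rule uniform_limit_theorem[of _ _ sequentially])
      show "\<forall>\<^sub>F n in sequentially. continuous_on (characters A) (\<lambda>\<omega>. Re (\<omega> (f (h n))))"
        by (intro always_eventually allI continuous_on_Re A.continuous_on_evaluation)
      show "uniform_limit (characters A) (\<lambda>n \<omega>. Re (\<omega> (f (h n)))) (\<lambda>\<omega>. LINT \<psi>|spectrum_map A B f \<omega>. g \<psi>) sequentially"
      proof (rule uniform_limitI)
        fix e :: real assume "0 < e"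
        then obtain N where N: "inverse (real (Suc N)) < e" using reals_Archimedean by blast
        show "\<forall>\<^sub>F n in sequentially. \<forall>\<omega>\<in>characters A.
            dist (Re (\<omega> (f (h n)))) (LINT \<psi>|spectrum_map A B f \<omega>. g \<psi>) < e"
        proof (rule eventually_sequentiallyI[of N], intro ballI)
          fix n \<omega> assume n: "N \<le> n" and \<omega>: "\<omega> \<in> characters A"
          have "\<bar>(LINT \<psi>|spectrum_map A B f \<omega>. g \<psi>) - Re (LINT \<psi>|spectrum_map A B f \<omega>. \<psi> (h n))\<bar>
              \<le> inverse (real (Suc n))"
            using h(2) by (intro B.integral_near_evaluation spectrum_map_prob_meas \<omega> g h(1)) (simp add: less_imp_le)
          also have "\<dots> \<le> inverse (real (Suc N))" using n by (intro le_imp_inverse_le) auto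
          finally show "dist (Re (\<omega> (f (h n)))) (LINT \<psi>|spectrum_map A B f \<omega>. g \<psi>) < e"
            using N by (simp add: integral_spectrum_map[OF \<omega>] B.selfadjointD(1)[OF h(1)] dist_real_def abs_minus_commute)
        qed
      qed
    qed simp
  qed
  then show ?thesis
    unfolding stoch_maps_iff[OF SB.compact_X] A.continuous_map_spectrum_iff A.topspace_spectrum
    using spectrum_map_prob_meas by (auto simp: spectrum_map_def)
qed

end

lemma spectrum_map_identity:
  assumes A: "comm_cstar_algebra A"
  shows "spectrum_map A A (\<lambda>x\<in>carrier A. x) = (\<lambda>\<omega>\<in>topspace (spectrum A). return (borel_of (spectrum A)) \<omega>)"
proof
  fix \<omega>
  interpret cstar A using A by (rule cstar_of_comm_cstar_algebra)
  interpret compact_hausdorff "spectrum A" by (rule compact_hausdorff_spectrum)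
  show "spectrum_map A A (\<lambda>x\<in>carrier A. x) \<omega> = (\<lambda>\<omega>\<in>topspace (spectrum A). return (borel_of (spectrum A)) \<omega>) \<omega>"
  proof (cases "\<omega> \<in> characters A")
    case True
    have "spectrum_map A A (\<lambda>x\<in>carrier A. x) \<omega> = return (borel_of (spectrum A)) \<omega>"
    proof (rule spectrum_map_eqI[OF A A identity_pos_unital_map[OF A] True])
      show "return (borel_of (spectrum A)) \<omega> \<in> prob_meas (spectrum A)"
        using True by (intro return_prob_meas compact_X Hausdorff_X) (simp add: topspace_spectrum)
      show "(LINT \<psi>|return (borel_of (spectrum A)) \<omega>. \<psi> h) = \<omega> ((\<lambda>x\<in>carrier A. x) h)"
        if "h \<in> selfadjoint" for h
        using True that
        by (simp add: integral_return topspace_spectrum continuous_map_borel_measurable[OF continuous_map_evaluation]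
            selfadjointD)
    qed
    with True show ?thesis by (simp add: topspace_spectrum)
  next
    case False
    then show ?thesis by (simp add: spectrum_map_def topspace_spectrum)
  qed
qed

lemma spectrum_map_compose:
  assumes A: "comm_cstar_algebra A" and B: "comm_cstar_algebra B" and C: "comm_cstar_algebra C"
    and f: "f \<in> pos_unital_maps B A" and g: "g \<in> pos_unital_maps C B"
  shows "spectrum_map A C (compose (carrier C) f g) =
    stoch_comp (spectrum A) (spectrum B) (spectrum C) (spectrum_map B C g) (spectrum_map A B f)"
proof
  fix \<omega>
  interpret A: cstar A using A by (rule cstar_of_comm_cstar_algebra)
  interpret B: cstar B using B by (rule cstar_of_comm_cstar_algebra)
  interpret C: cstar C using C by (rule cstar_of_comm_cstar_algebra)
  interpret SB: compact_hausdorff "spectrum B" by (rule B.compact_hausdorff_spectrum)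
  interpret SC: compact_hausdorff "spectrum C" by (rule C.compact_hausdorff_spectrum)
  note fm = spectrum_map_stoch_maps[OF A B f] and gm = spectrum_map_stoch_maps[OF B C g]
  let ?\<mu> = "spectrum_map A B f" and ?\<nu> = "spectrum_map B C g"
  show "spectrum_map A C (compose (carrier C) f g) \<omega> =
    stoch_comp (spectrum A) (spectrum B) (spectrum C) ?\<nu> ?\<mu> \<omega>"
  proof (cases "\<omega> \<in> characters A")
    case \<omega>: True
    have M: "?\<mu> \<omega> \<in> prob_meas (spectrum B)" by (rule spectrum_map_prob_meas[OF A B f \<omega>])
    interpret bind: stoch_map_bind "spectrum C" "spectrum B" ?\<nu> "?\<mu> \<omega>"
      by (rule stoch_map_bind_of_stoch_maps[OF SB.compact_X SB.Hausdorff_X SC.compact_X SC.Hausdorff_X gm M])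
    have "spectrum_map A C (compose (carrier C) f g) \<omega> = ?\<mu> \<omega> \<bind> ?\<nu>"
    proof (rule spectrum_map_eqI[OF A C compose_pos_unital_maps[OF C B A g f] \<omega> bind.bind_prob_meas])
      fix h assume h: "h \<in> C.selfadjoint"
      have hc: "h \<in> carrier C" using h by (rule C.selfadjointD)
      have gh: "g h \<in> carrier B" by (rule pos_unital_mapsD(2)[OF g hc])
      \<comment> \<open>\<open>integral_bind_M\<close> concerns real integrands, so the computation
        passes to real parts and back. Returning needs \<psi> to be real at g h, which holds because
        \<open>\<psi> \<circ> g\<close> is a state of C and h is self-adjoint.\<close>
      have real: "Im (\<psi> (g h)) = 0" if "\<psi> \<in> characters B" for \<psi>
        using cstar_state.state_selfadjoint_real[OF character_pos_unital_map_state[OF B C g that] h] .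
      have "(LINT \<psi>|(?\<mu> \<omega> \<bind> ?\<nu>). Re (\<psi> h)) = (LINT \<psi>|?\<mu> \<omega>. (LINT \<theta>|?\<nu> \<psi>. Re (\<theta> h)))"
        by (intro bind.integral_bind_M continuous_map_Re C.continuous_map_evaluation)
      also have "\<dots> = (LINT \<psi>|?\<mu> \<omega>. Re (\<psi> (g h)))"
      proof (rule Bochner_Integration.integral_cong[OF refl])
        fix \<psi> assume "\<psi> \<in> space (?\<mu> \<omega>)"
        then have \<psi>: "\<psi> \<in> characters B" using M by (simp add: prob_meas_def B.topspace_spectrum)
        have "complex_of_real (LINT \<theta>|?\<nu> \<psi>. Re (\<theta> h)) = \<psi> (g h)"
          using C.integral_evaluation_selfadjoint[OF spectrum_map_prob_meas[OF B C g \<psi>] h]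
          by (simp add: integral_spectrum_map[OF B C g \<psi> hc])
        then show "(LINT \<theta>|?\<nu> \<psi>. Re (\<theta> h)) = Re (\<psi> (g h))" by (metis Re_complex_of_real)
      qed
      finally have "complex_of_real (LINT \<psi>|(?\<mu> \<omega> \<bind> ?\<nu>). Re (\<psi> h)) =
          (LINT \<psi>|?\<mu> \<omega>. complex_of_real (Re (\<psi> (g h))))" by simp
      also have "\<dots> = (LINT \<psi>|?\<mu> \<omega>. \<psi> (g h))"
      proof (rule Bochner_Integration.integral_cong[OF refl])
        fix \<psi> assume "\<psi> \<in> space (?\<mu> \<omega>)"
        then have "\<psi> \<in> characters B" using M by (simp add: prob_meas_def B.topspace_spectrum)
        then show "complex_of_real (Re (\<psi> (g h))) = \<psi> (g h)" using real by (simp add: complex_eq_iff)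
      qed
      also have "\<dots> = \<omega> (compose (carrier C) f g h)"
        using integral_spectrum_map[OF A B f \<omega> gh] hc by (simp add: compose_def)
      finally show "(LINT \<psi>|(?\<mu> \<omega> \<bind> ?\<nu>). \<psi> h) = \<omega> (compose (carrier C) f g h)"
        by (simp add: C.integral_evaluation_selfadjoint[OF bind.bind_prob_meas h])
    qed
    also have "\<dots> = stoch_comp (spectrum A) (spectrum B) (spectrum C) ?\<nu> ?\<mu> \<omega>"
      using \<omega> by (intro stoch_comp_eq_bind[symmetric] SB.compact_X SB.Hausdorff_X SC.compact_X SC.Hausdorff_X fm gm)
        (simp add: A.topspace_spectrum)
    finally show ?thesis .
  next
    case False
    then show ?thesis by (simp add: spectrum_map_def stoch_comp_def A.topspace_spectrum)
  qed
qed

theorem theorem4p151: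
  shows "category_functor
    (op_cat (cCstarAlgPos :: ('a cstar, 'a \<Rightarrow> 'a) cat))
    (cHausStoch :: (('a \<Rightarrow> complex) topology, ('a \<Rightarrow> complex) \<Rightarrow> ('a \<Rightarrow> complex) measure) cat)
    spectrum
    spectrum_map"
proof (rule category_functor.intro[OF category_op_cat[OF category_cCstarAlgPos] category_cHausStoch],
    rule category_functor_axioms.intro)
  fix A :: "'a cstar" assume "A \<in> Obj (op_cat cCstarAlgPos)"
  then have A: "comm_cstar_algebra A" by (simp add: op_cat_def cCstarAlgPos_def)
  interpret compact_hausdorff "spectrum A"
    by (rule cstar.compact_hausdorff_spectrum[OF cstar_of_comm_cstar_algebra[OF A]])
  show "spectrum A \<in> Obj cHausStoch" using compact_X Hausdorff_X by (simp add: cHausStoch_def)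
  show "spectrum_map A A (Ident (op_cat cCstarAlgPos) A) = Ident cHausStoch (spectrum A)"
    by (simp add: op_cat_def cCstarAlgPos_def cHausStoch_def spectrum_map_identity[OF A])
next
  fix A B :: "'a cstar" and f
  assume "A \<in> Obj (op_cat cCstarAlgPos)" "B \<in> Obj (op_cat cCstarAlgPos)"
    "f \<in> Hom (op_cat cCstarAlgPos) A B"
  then show "spectrum_map A B f \<in> Hom cHausStoch (spectrum A) (spectrum B)"
    by (simp add: op_cat_def cCstarAlgPos_def cHausStoch_def spectrum_map_stoch_maps)
next
  fix A B C :: "'a cstar" and f g
  assume "A \<in> Obj (op_cat cCstarAlgPos)" "B \<in> Obj (op_cat cCstarAlgPos)" "C \<in> Obj (op_cat cCstarAlgPos)"
    "f \<in> Hom (op_cat cCstarAlgPos) A B" "g \<in> Hom (op_cat cCstarAlgPos) B C"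
  then show "spectrum_map A C (Comp (op_cat cCstarAlgPos) A B C g f) =
      Comp cHausStoch (spectrum A) (spectrum B) (spectrum C) (spectrum_map B C g) (spectrum_map A B f)"
    by (simp add: op_cat_def cCstarAlgPos_def cHausStoch_def spectrum_map_compose)
qed

end
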